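(* Let $\Omega\subset\mathbb R^3$ be the meshed domain of the context. For every $p^h\in\widetilde S(\Omega)$ there exists $\boldsymbol u^h\in D(\Omega)$ with $\mathrm{div}\,\boldsymbol u^h=p^h$; in terms of degrees of freedom, $$\mathbb M^{(3)}\,\mathbb E^{3,2}\,\mathcal N^2(\boldsymbol u^h)=\widetilde{\mathcal N}^0(p^h).$$
   Context: Fix $N\ge1$; let $-1=\xi_0<\dots<\xi_N=1$ be the Gauss–Lobatto–Legendre (GLL) nodes, i.e. the roots of $(1-\xi^2)L_N'(\xi)$, $L_N$ the Legendre polynomial of degree $N$. $\mathcal P$, $\mathcal Q$ are the polynomials on $[-1,1]$ of degree at most $N$, $N-1$. On $K=[-1,1]^3$: $D(K)=(\mathcal P\otimes\mathcal Q\otimes\mathcal Q)\times(\mathcal Q\otimes\mathcal P\otimes\mathcal Q)\times(\mathcal Q\otimes\mathcal Q\otimes\mathcal P)$ and $S(K)=\mathcal Q\otimes\mathcal Q\otimes\mathcal Q$. $\Omega\subset\mathbb R^3$ is a bounded Lipschitz domain partitioned into conforming non-overlapping elements $\Omega_m=\Phi_m(K)$, $\Phi_m$ diffeomorphisms with Jacobian matrix $\mathsf J$ ($\det\mathsf J>0$), such that the global map is continuous; the images of the GLL grid form a global mesh of small faces and small volumes. $D(\Omega)\subset H(\mathrm{div};\Omega)$ consists of the vector fields with continuous normal component across element boundaries (no condition on $\partial\Omega$) equal to $\big(\frac1{\det\mathsf J}\mathsf J\bar{\boldsymbol u}\big)\circ\Phi_m^{-1}$, $\bar{\boldsymbol u}\in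 D(K)$, on each $\Omega_m$. $S(\Omega)\subset L^2(\Omega)$ consists of the functions equal to $\big(\frac1{\det\mathsf J}\bar g\big)\circ\Phi_m^{-1}$, $\bar g\in S(K)$, on each $\Omega_m$. $\mathcal N^2(\boldsymbol q^h)$ is the column vector of fluxes of $\boldsymbol q^h\in D(\Omega)$ through the oriented small faces, $\mathcal N^3(f^h)$ the column vector of integrals of $f^h\in S(\Omega)$ over the small volumes; $\Psi^2,\Psi^3$ are the corresponding row vectors of basis functions, with $\boldsymbol q^h=\Psi^2\mathcal N^2(\boldsymbol q^h)$, $f^h=\Psi^3\mathcal N^3(f^h)$. The incidence matrix $\mathbb E^{3,2}$ (entries $-1,0,1$) is defined by $\mathrm{div}\,\boldsymbol q^h=\Psi^3\mathbb E^{3,2}\mathcal N^2(\boldsymbol q^h)$. $\mathbb M^{(3)}=\int_\Omega(\Psi^3)^\intercal\Psi^3\,\mathrm d\Omega$. $\widetilde S(\Omega)$ is the space $S(\Omega)$ with elements expanded in the dual basis $\widetilde\Psi^0=\Psi^3(\mathbb M^{(3)})^{-1}$, with dual degrees of freedom $\widetilde{\mathcal N}^0(p^h)=\mathbb M^{(3)}\mathcal N^3(p^h)$. *)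

theory Defs
  imports "HOL-Analysis.Analysis" "HOL-Computational_Algebra.Polynomial"
begin

section \<open>Gauss--Lobatto--Legendre nodes and polynomial spaces on the reference cube\<close>

text \<open>Rodrigues' formula.\<close>
definition legendre :: "nat \<Rightarrow> real poly" where
  "legendre n = smult (1 / (2 ^ n * fact n)) ((pderiv ^^ n) ([:-1, 0, 1:] ^ n))"

definition gll :: "nat \<Rightarrow> nat \<Rightarrow> real" where
  "gll N i = sorted_list_of_set {x. (1 - x\<^sup>2) * poly (pderiv (legendre N)) x = 0} ! i"

definition ref_cube :: "(real^3) set" where
  "ref_cube = cbox (vec (-1)) (vec 1)"

definition ref_facet :: "3 \<Rightarrow> real \<Rightarrow> (real^3) set" where
  "ref_facet d s = {\<xi>\<in>ref_cube. \<xi> $ d = s}"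

text \<open>The tensor product of the univariate polynomials of degree at most \<open>n 1\<close>, \<open>n 2\<close>, \<open>n 3\<close>:
  finite sums of elementary tensors.\<close>
definition tensor_poly :: "(3 \<Rightarrow> nat) \<Rightarrow> (real^3 \<Rightarrow> real) set" where
  "tensor_poly n = {f. \<exists>(r::nat) (P :: nat \<Rightarrow> 3 \<Rightarrow> real poly).
      (\<forall>t<r. \<forall>i. degree (P t i) \<le> n i) \<and> f = (\<lambda>\<xi>. \<Sum>t<r. \<Prod>i\<in>UNIV. poly (P t i) (\<xi> $ i))}"

definition S_ref :: "nat \<Rightarrow> (real^3 \<Rightarrow> real) set" where
  "S_ref N = tensor_poly (\<lambda>_. N - 1)"

definition D_ref :: "nat \<Rightarrow> (real^3 \<Rightarrow> real^3) set" where
  "D_ref N = {u. \<forall>d. (\<lambda>\<xi>. u \<xi> $ d) \<in> tensor_poly (\<lambda>i. if i = d then N else N - 1)}"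


section \<open>Domains, diffeomorphisms, weak divergence\<close>

text \<open>Locally, after a rigid motion, the domain is the region above a Lipschitz graph.\<close>
definition lipschitz_domain :: "(real^3) set \<Rightarrow> bool" where
  "lipschitz_domain \<Omega> \<longleftrightarrow> open \<Omega> \<and> connected \<Omega> \<and> \<Omega> \<noteq> {} \<and>
    (\<forall>x\<in>frontier \<Omega>. \<exists>(T :: real^3 \<Rightarrow> real^3) (\<gamma> :: real \<times> real \<Rightarrow> real) L r.
       orthogonal_transformation T \<and> L-lipschitz_on UNIV \<gamma> \<and> r > 0 \<and>
       (\<forall>y\<in>ball x r. y \<in> \<Omega> \<longleftrightarrow> T (y - x) $ 3 > \<gamma> (T (y - x) $ 1, T (y - x) $ 2)))"

text \<open>On a set that is not open (such as the closed cube) derivatives are taken within the set.\<close>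
definition C1_on :: "(real^3) set \<Rightarrow> (real^3 \<Rightarrow> real^3) \<Rightarrow> bool" where
  "C1_on S f \<longleftrightarrow> (\<exists>f' :: real^3 \<Rightarrow> (real^3) \<Rightarrow>\<^sub>L (real^3).
     (\<forall>x\<in>S. (f has_derivative blinfun_apply (f' x)) (at x within S)) \<and> continuous_on S f')"

definition diffeomorphism_on :: "(real^3) set \<Rightarrow> (real^3 \<Rightarrow> real^3) \<Rightarrow> bool" where
  "diffeomorphism_on S f \<longleftrightarrow> inj_on f S \<and> C1_on S f \<and> C1_on (f ` S) (inv_into S f)"

definition L2_on :: "(real^3) set \<Rightarrow> (real^3 \<Rightarrow> 'b::euclidean_space) \<Rightarrow> bool" where
  "L2_on \<Omega> f \<longleftrightarrow> set_borel_measurable lebesgue \<Omega> f \<and> set_integrable lebesgue \<Omega> (\<lambda>x. (norm (f x))\<^sup>2)"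

text \<open>\<open>has_divergence \<Omega> u g\<close>: the field \<open>u\<close> has weak divergence \<open>g\<close>, both in \<open>L\<^sup>2(\<Omega>)\<close>.
  The test functions are the continuously differentiable functions with compact support in \<open>\<Omega>\<close>;
  \<open>G\<close> is the gradient of the test function \<open>\<phi>\<close>. The relation determines \<open>g\<close> almost everywhere.\<close>
definition has_divergence ::
  "(real^3) set \<Rightarrow> (real^3 \<Rightarrow> real^3) \<Rightarrow> (real^3 \<Rightarrow> real) \<Rightarrow> bool" where
  "has_divergence \<Omega> u g \<longleftrightarrow> L2_on \<Omega> u \<and> L2_on \<Omega> g \<and>
    (\<forall>(\<phi> :: real^3 \<Rightarrow> real) G C.
       (\<forall>x. GDERIV \<phi> x :> G x) \<and> continuous_on UNIV G \<and>
       compact C \<and> C \<subseteq> \<Omega> \<and> (\<forall>x. x \<notin> C \<longrightarrow> \<phi> x = 0) \<longrightarrow>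
       integral \<Omega> (\<lambda>x. u x \<bullet> G x) = - integral \<Omega> (\<lambda>x. g x * \<phi> x))"

definition Hdiv :: "(real^3) set \<Rightarrow> (real^3 \<Rightarrow> real^3) set" where
  "Hdiv \<Omega> = {u. \<exists>g. has_divergence \<Omega> u g}"


section \<open>Matrices with rows and columns indexed by finite sets\<close>

definition mat_vec :: "'j set \<Rightarrow> ('i \<Rightarrow> 'j \<Rightarrow> real) \<Rightarrow> ('j \<Rightarrow> real) \<Rightarrow> 'i \<Rightarrow> real" where
  "mat_vec J A x = (\<lambda>i. \<Sum>j\<in>J. A i j * x j)"


section \<open>The mesh\<close>

text \<open>The boxes of the GLL grid in the reference cube. A small face orthogonal to direction \<open>d\<close>
  lies in the plane with node number \<open>k $ d\<close>.\<close>
definition vol_box :: "nat \<Rightarrow> nat^3 \<Rightarrow> (real^3) set" where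
  "vol_box N k = cbox (\<chi> i. gll N (k $ i)) (\<chi> i. gll N (k $ i + 1))"

definition face_box :: "nat \<Rightarrow> 3 \<Rightarrow> nat^3 \<Rightarrow> (real^3) set" where
  "face_box N d k = cbox (\<chi> i. gll N (k $ i)) (\<chi> i. gll N (if i = d then k $ i else k $ i + 1))"

text \<open>The elements are \<open>\<Phi> m ` ref_cube\<close> for \<open>m < n\<close>. Conformity: two different elements meet in
  nothing (\<open>F = {}\<close>) or in a common vertex, edge or face, which is the image of a face \<open>F\<close> of the cube
  under both maps, and there the two maps agree up to a symmetry \<open>\<sigma>\<close> of the cube. Thus the map
  from the glued cubes to the closure of \<open>\<Omega>\<close> is well defined and continuous, and the GLL grids of
  the two elements match.\<close>
locale gll_mesh =
  fixes N n :: nat and \<Phi> :: "nat \<Rightarrow> real^3 \<Rightarrow> real^3" and \<Omega> :: "(real^3) set"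
  assumes N_pos: "N \<ge> 1"
    and domain: "bounded \<Omega>" "lipschitz_domain \<Omega>"
    and diffeo: "\<And>m. m < n \<Longrightarrow> diffeomorphism_on ref_cube (\<Phi> m)"
    and det_pos: "\<And>m \<xi>. m < n \<Longrightarrow> \<xi> \<in> ref_cube \<Longrightarrow>
                    det (jacobian (\<Phi> m) (at \<xi> within ref_cube)) > 0"
    and cover: "closure \<Omega> = (\<Union>m<n. \<Phi> m ` ref_cube)"
    and conforming: "\<And>m m'. m < n \<Longrightarrow> m' < n \<Longrightarrow> m \<noteq> m' \<Longrightarrow>
          \<exists>F \<sigma>. F face_of ref_cube \<and> F \<noteq> ref_cube \<and>
                orthogonal_transformation \<sigma> \<and> \<sigma> ` ref_cube = ref_cube \<and>
                \<Phi> m ` ref_cube \<inter> \<Phi> m' ` ref_cube = \<Phi> m ` F \<and>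
                (\<forall>\<xi>\<in>F. \<Phi> m' (\<sigma> \<xi>) = \<Phi> m \<xi>)"
begin

definition elem :: "nat \<Rightarrow> (real^3) set" where
  "elem m = \<Phi> m ` ref_cube"

definition jac :: "nat \<Rightarrow> real^3 \<Rightarrow> real^3^3" where
  "jac m \<xi> = jacobian (\<Phi> m) (at \<xi> within ref_cube)"

text \<open>A normal vector at \<open>\<Phi> m \<xi>\<close> of the surface on which the reference coordinate \<open>d\<close> is constant;
  its norm is the surface element. The indices \<open>d + 1\<close>, \<open>d + 2\<close> are modulo 3.\<close>
definition area_vector :: "nat \<Rightarrow> 3 \<Rightarrow> real^3 \<Rightarrow> real^3" where
  "area_vector m d \<xi> = cross3 (column (d + 1) (jac m \<xi>)) (column (d + 2) (jac m \<xi>))"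

definition small_volumes :: "(real^3) set set" where
  "small_volumes = {\<Phi> m ` vol_box N k | m k. m < n \<and> (\<forall>i. k $ i < N)}"

definition is_local_face :: "nat \<times> 3 \<times> (nat^3) \<Rightarrow> bool" where
  "is_local_face = (\<lambda>(m, d, k). m < n \<and> k $ d \<le> N \<and> (\<forall>i. i \<noteq> d \<longrightarrow> k $ i < N))"

definition face_set :: "nat \<times> 3 \<times> (nat^3) \<Rightarrow> (real^3) set" where
  "face_set = (\<lambda>(m, d, k). \<Phi> m ` face_box N d k)"

text \<open>A small face shared by two elements occurs only once.\<close>
definition small_faces :: "(real^3) set set" where
  "small_faces = face_set ` Collect is_local_face"

text \<open>Functions are arbitrary on the element boundaries (a null set), hence the reference interior
  in the next definitions.\<close>
definition S_space :: "(real^3 \<Rightarrow> real) set" where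
  "S_space = {f. L2_on \<Omega> f \<and>
     (\<forall>m<n. \<exists>g\<in>S_ref N. \<forall>\<xi>\<in>interior ref_cube. f (\<Phi> m \<xi>) = g \<xi> / det (jac m \<xi>))}"

definition elem_trace :: "nat \<Rightarrow> (real^3 \<Rightarrow> real^3) \<Rightarrow> real^3 \<Rightarrow> real^3" where
  "elem_trace m q x = Lim (at x within interior (elem m)) q"

definition D_space :: "(real^3 \<Rightarrow> real^3) set" where
  "D_space = {q \<in> Hdiv \<Omega>.
     (\<forall>m<n. \<exists>u\<in>D_ref N. \<forall>\<xi>\<in>interior ref_cube.
        q (\<Phi> m \<xi>) = (1 / det (jac m \<xi>)) *\<^sub>R (jac m \<xi> *v u \<xi>)) \<and>
     (\<forall>m<n. \<forall>m'<n. \<forall>d. \<forall>s\<in>{-1, 1}. m \<noteq> m' \<and> \<Phi> m ` ref_facet d s \<subseteq> elem m' \<longrightarrow>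
        (\<forall>\<xi>\<in>ref_facet d s.
           elem_trace m q (\<Phi> m \<xi>) \<bullet> area_vector m d \<xi> = elem_trace m' q (\<Phi> m \<xi>) \<bullet> area_vector m d \<xi>))}"

definition N3 :: "(real^3 \<Rightarrow> real) \<Rightarrow> (real^3) set \<Rightarrow> real" where
  "N3 f v = integral v f"

definition is_basis3 :: "((real^3) set \<Rightarrow> real^3 \<Rightarrow> real) \<Rightarrow> bool" where
  "is_basis3 B \<longleftrightarrow>
     (\<forall>v\<in>small_volumes. B v \<in> S_space \<and> (\<forall>w\<in>small_volumes. N3 (B v) w = (if w = v then 1 else 0))) \<and>
     (\<forall>f\<in>S_space. AE x in lebesgue_on \<Omega>. f x = (\<Sum>v\<in>small_volumes. B v x * N3 f v))"

text \<open>The choice only concerns the values on the element boundaries and outside the mesh.\<close>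
definition Psi3 :: "(real^3) set \<Rightarrow> real^3 \<Rightarrow> real" where
  "Psi3 = (SOME B. is_basis3 B)"

definition M3 :: "(real^3) set \<Rightarrow> (real^3) set \<Rightarrow> real" where
  "M3 v w = integral \<Omega> (\<lambda>x. Psi3 v x * Psi3 w x)"

text \<open>As a set, the dual space is the primal one; only the degrees of freedom differ.\<close>
definition S_tilde :: "(real^3 \<Rightarrow> real) set" where
  "S_tilde = S_space"

definition N0_tilde :: "(real^3 \<Rightarrow> real) \<Rightarrow> (real^3) set \<Rightarrow> real" where
  "N0_tilde p = mat_vec small_volumes M3 (N3 p)"

end

text \<open>The small faces are oriented by continuous unit normal fields \<open>\<nu> s\<close>.\<close>
locale oriented_gll_mesh = gll_mesh N n \<Phi> \<Omega>
  for N n :: nat and \<Phi> :: "nat \<Rightarrow> real^3 \<Rightarrow> real^3" and \<Omega> :: "(real^3) set" +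
  fixes \<nu> :: "(real^3) set \<Rightarrow> real^3 \<Rightarrow> real^3"
  assumes normal_continuous: "\<And>s. s \<in> small_faces \<Longrightarrow> continuous_on s (\<nu> s)"
    and normal_unit: "\<And>s x. s \<in> small_faces \<Longrightarrow> x \<in> s \<Longrightarrow> norm (\<nu> s x) = 1"
    and normal_orthogonal: "\<And>m d k \<xi> i. is_local_face (m, d, k) \<Longrightarrow> \<xi> \<in> face_box N d k \<Longrightarrow> i \<noteq> d \<Longrightarrow>
          \<nu> (face_set (m, d, k)) (\<Phi> m \<xi>) \<bullet> column i (jac m \<xi>) = 0"
begin

text \<open>The surface integral of \<open>q \<bullet> \<nu> s\<close> over the small face \<open>s\<close>, computed in the parametrization
  by one of the elements containing \<open>s\<close>; by continuity of the normal component any element will do.\<close>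
definition N2 :: "(real^3 \<Rightarrow> real^3) \<Rightarrow> (real^3) set \<Rightarrow> real" where
  "N2 q s =
    (let (m, d, k) = (SOME f. is_local_face f \<and> face_set f = s) in
     integral (cbox (gll N (k $ (d + 1)), gll N (k $ (d + 2)))
                    (gll N (k $ (d + 1) + 1), gll N (k $ (d + 2) + 1)))
       (\<lambda>(\<eta>, \<zeta>).
          let \<xi> = (\<chi> i. if i = d then gll N (k $ d) else if i = d + 1 then \<eta> else \<zeta>)
          in (elem_trace m q (\<Phi> m \<xi>) \<bullet> \<nu> s (\<Phi> m \<xi>)) * norm (area_vector m d \<xi>)))"

definition is_incidence :: "((real^3) set \<Rightarrow> (real^3) set \<Rightarrow> real) \<Rightarrow> bool" where
  "is_incidence E \<longleftrightarrow>
     (\<forall>v\<in>small_volumes. \<forall>s\<in>small_faces. E v s \<in> {-1, 0, 1}) \<and>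
     (\<forall>q\<in>D_space. has_divergence \<Omega> q
        (\<lambda>x. \<Sum>v\<in>small_volumes. Psi3 v x * mat_vec small_faces E (N2 q) v))"

text \<open>The entries with indices in \<open>small_volumes\<close> and \<open>small_faces\<close> are uniquely determined.\<close>
definition E32 :: "(real^3) set \<Rightarrow> (real^3) set \<Rightarrow> real" where
  "E32 = (SOME E. is_incidence E)"

end

end

theory Submission
  imports Defs
begin

text \<open>On one element the divergence maps onto \<open>S(K)\<close>: after subtracting a constant from the given
  polynomial, averaging in one direction after the other yields a field with vanishing normal
  traces, and the constant is the divergence of an affine field with prescribed constant normal
  traces on the six facets. It remains to choose these constants so that they match across shared
  facets, that is, to find a network flow with prescribed excess on the graph of elements. It exists
  because every element is joined by a chain of shared facets to a facet on the boundary of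
  \<open>\<Omega>\<close>; otherwise some union of elements would have its whole boundary in the (one-dimensional)
  element edges.

  Two elements sharing a facet lie on opposite sides of it, so with positive Jacobian determinants
  their reference coordinates are related by a cube symmetry of determinant \<open>-1\<close>. This makes
  the boundary terms of the elementwise divergence theorem cancel, and the Piola transform turns
  the elementwise divergence into the weak divergence on \<open>\<Omega>\<close>. Applied to a single small volume,
  the divergence theorem gives the entries of the incidence matrix; the equation for the degrees of
  freedom then follows from the uniqueness of the weak divergence.\<close>

section \<open>Gauss--Lobatto--Legendre nodes and edge polynomials\<close>

text \<open>Constant facet values are suitable unknowns for the gluing because a cube symmetry may
  rotate or reflect a facet without changing a constant: matching becomes a condition on one number
  per facet. All dependence on position is absorbed by the fields with vanishing normal traces.
  Nothing is prescribed on the boundary of \<Omega>, so a surplus can be led out there, and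
  \<open>p\<close> has to satisfy no mean value condition.

  The element maps are just continuously differentiable, so a Piola transformed field is in general
  merely continuous inside an element and cannot be differentiated there. Integration by parts is
  therefore carried out on the reference cube, with the test function pulled back.

  \<open>Psi3\<close> and \<open>E32\<close> are choices by \<open>SOME\<close>, and
  \<open>N2\<close> chooses an element for each face. Before they can be used, a basis and an
  incidence matrix have to be exhibited, and the flux has to be shown independent of the chosen
  element. The basis comes from univariate polynomials dual to the integrals over the grid
  intervals.\<close>

lemma rolle_roots:
  fixes p :: "real poly"
  assumes "finite A" "A \<noteq> {}" "\<And>x. x \<in> A \<Longrightarrow> poly p x = 0"
  shows "\<exists>B. finite B \<and> card B = card A - 1 \<and> (\<forall>x\<in>B. Min A < x \<and> x < Max A \<and> poly (pderiv p) x = 0)"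
  using assms
proof (induction A rule: finite_linorder_max_induct)
  case empty
  then show ?case by simp
next
  case (insert b A)
  show ?case
  proof (cases "A = {}")
    case True
    then show ?thesis by (auto intro!: exI[of _ "{}"])
  next
    case False
    then obtain B where B: "finite B" "card B = card A - 1"
      "\<And>x. x \<in> B \<Longrightarrow> Min A < x \<and> x < Max A \<and> poly (pderiv p) x = 0"
      using insert by (metis insertCI)
    have mb: "Max A < b" "Max A \<in> A" "Min A \<in> A" using False insert by auto
    then have "Min A < b" using insert by auto
    \<comment> \<open>Points are added in increasing order, so this root lies beyond all roots found
      earlier and is new.\<close>
    obtain c where c: "Max A < c" "c < b" "poly (pderiv p) c = 0"
      using poly_MVT[OF mb(1), of p] insert(5)[of b] insert(5)[of "Max A"] mb by auto
    have "Max (insert b A) = b" by (rule Max_eqI) (use insert in force)+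
    moreover have "Min (insert b A) = Min A"
      by (rule Min_eqI) (use insert mb \<open>Min A < b\<close> in force)+
    moreover have "c \<notin> B" using B(3) c(1) by fastforce
    moreover have "Min A \<le> Max A" using insert False by (simp add: mb)
    moreover have "b \<notin> A" "card A > 0" using insert False by (auto simp: card_gt_0_iff)
    moreover have "Min A < x \<and> x < b \<and> poly (pderiv p) x = 0" if "x \<in> insert c B" for x
      using that B(3) c mb(1) calculation(4) by fastforce
    ultimately show ?thesis
      using B(1,2) insert(1) by (intro exI[of _ "insert c B"]) simp
  qed
qed

lemma power_dvd_pderiv:
  fixes p r :: "'a::idom poly"
  assumes "p ^ Suc j dvd r"
  shows "p ^ j dvd pderiv r"
proof -
  obtain t where "r = p ^ Suc j * t" using assms by (auto elim: dvdE)
  then have "pderiv r = p ^ j * (p * pderiv t + t * (smult (of_nat (Suc j)) 1 * pderiv p))"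
    by (simp only: pderiv_mult pderiv_power_Suc) (simp add: algebra_simps)
  then show ?thesis by simp
qed

text \<open>As long as \<open>k < n\<close>, the points -1 and 1 remain roots of the k-th
  derivative, of multiplicity at least \<open>n - k\<close>. Together with the \<open>k\<close>
  interior roots they are \<open>k + 2\<close> points, and Rolle yields \<open>k + 1\<close>
  interior roots of the next derivative. For \<open>k = n\<close> these are the roots of the
  Legendre polynomial.\<close>

lemma pderiv_power_roots:
  fixes n k :: nat
  defines "q \<equiv> [:-1, 0, 1:] :: real poly"
  assumes "k \<le> n"
  shows "q ^ (n - k) dvd (pderiv ^^ k) (q ^ n) \<and>
    (\<exists>B. finite B \<and> card B = k \<and> (\<forall>x\<in>B. -1 < x \<and> x < 1 \<and> poly ((pderiv ^^ k) (q ^ n)) x = 0))"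
  using assms(2)
proof (induction k)
  case 0
  then show ?case by (auto intro!: exI[of _ "{}"])
next
  case (Suc k)
  let ?r = "(pderiv ^^ k) (q ^ n)"
  have dvd: "q ^ Suc (n - Suc k) dvd ?r" using Suc by (simp add: Suc_diff_Suc)
  obtain B where B: "finite B" "card B = k" "\<And>x. x \<in> B \<Longrightarrow> -1 < x \<and> x < 1 \<and> poly ?r x = 0"
    using Suc by auto
  have "q dvd ?r" using dvd by (metis dvd_mult_left power_Suc)
  then have ends: "poly ?r 1 = 0" "poly ?r (-1) = 0"
    unfolding q_def dvd_def by auto
  let ?A = "insert (-1) (insert 1 B)"
  have "1 \<notin> B" "-1 \<notin> B" using B(3) by force+
  then have card: "card ?A = k + 2" using B by simp
  have MM: "Min ?A = -1" "Max ?A = 1"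
    by (rule Min_eqI Max_eqI; use B in force)+
  obtain C where "finite C" "card C = card ?A - 1"
    "\<And>x. x \<in> C \<Longrightarrow> Min ?A < x \<and> x < Max ?A \<and> poly (pderiv ?r) x = 0"
    using rolle_roots[of ?A ?r] B ends by auto
  then have "finite C \<and> card C = Suc k \<and> (\<forall>x\<in>C. -1 < x \<and> x < 1 \<and> poly ((pderiv ^^ Suc k) (q ^ n)) x = 0)"
    unfolding MM card by simp
  then show ?case using power_dvd_pderiv[OF dvd] by auto
qed

text \<open>Rolle applied to the \<open>N\<close> roots of the Legendre polynomial gives
  \<open>N - 1\<close> roots of its derivative, as many as the degree allows; with the two end
  points this makes \<open>N + 1\<close> nodes. The list in the definition of \<open>gll\<close>
  thus has exactly the indices 0 to \<open>N\<close>.\<close>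

lemma gll_set:
  assumes "N \<ge> 1"
  defines "S \<equiv> {x. (1 - x\<^sup>2) * poly (pderiv (legendre N)) x = 0}"
  shows "finite S" "card S = N + 1" "S \<subseteq> {-1..1}"
proof -
  let ?q = "[:-1, 0, 1:] :: real poly"
  let ?r = "(pderiv ^^ N) (?q ^ N)"
  obtain B where B: "finite B" "card B = N" "\<And>x. x \<in> B \<Longrightarrow> -1 < x \<and> x < 1 \<and> poly ?r x = 0"
    using pderiv_power_roots[of N N] by auto
  have "B \<noteq> {}" using B assms by auto
  then obtain C where C: "finite C" "card C = N - 1"
    "\<And>x. x \<in> C \<Longrightarrow> Min B < x \<and> x < Max B \<and> poly (pderiv ?r) x = 0"
    using rolle_roots[of B ?r] B by auto
  have C1: "-1 < x \<and> x < 1" if "x \<in> C" for x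
    using C(3)[OF that] B \<open>B \<noteq> {}\<close> by (meson Max_in Min_in less_trans)
  have roots: "poly (pderiv (legendre N)) x = 0 \<longleftrightarrow> poly (pderiv ?r) x = 0" for x
    by (simp add: legendre_def pderiv_smult)
  have deg: "degree (?q ^ N) = 2 * N" by (simp add: degree_power_eq)
  have "degree ?r = N" by (simp add: degree_higher_pderiv deg)
  then have dr: "pderiv ?r \<noteq> 0" "degree (pderiv ?r) = N - 1" using assms
    by (auto simp: pderiv_eq_0_iff degree_pderiv)
  have fin: "finite {x. poly (pderiv ?r) x = 0}" using dr by (simp add: poly_roots_finite)
  have "card {x. poly (pderiv ?r) x = 0} \<le> N - 1"
    using card_poly_roots_bound[OF dr(1)] dr(2) by simp
  then have CR: "C = {x. poly (pderiv ?r) x = 0}"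
    using C fin by (intro card_seteq) auto
  have S: "S = insert (-1) (insert 1 C)"
    unfolding S_def CR by (auto simp: power2_eq_1_iff roots)
  show "finite S" "S \<subseteq> {-1..1}" using C C1 S by force+
  have "1 \<notin> C" "-1 \<notin> C" using C1 by force+
  then show "card S = N + 1" using C assms(1) unfolding S by simp
qed

lemma gll_strict_mono:
  assumes "N \<ge> 1" "i < j" "j \<le> N"
  shows "gll N i < gll N j"
  unfolding gll_def
  by (rule sorted_wrt_nth_less[OF strict_sorted_list_of_set assms(2)])
    (use gll_set[OF assms(1)] assms in \<open>simp del: mult_eq_0_iff\<close>)

lemma gll_range:
  assumes "N \<ge> 1" "i \<le> N"
  shows "-1 \<le> gll N i" "gll N i \<le> 1"
proof -
  let ?S = "{x. (1 - x\<^sup>2) * poly (pderiv (legendre N)) x = 0}"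
  have "gll N i \<in> set (sorted_list_of_set ?S)"
    unfolding gll_def using gll_set[OF assms(1)] assms by (intro nth_mem) simp
  then have "gll N i \<in> {-1..1}" using gll_set[OF assms(1)] by auto
  then show "-1 \<le> gll N i" "gll N i \<le> 1" by auto
qed

section \<open>Polynomials dual to the integrals between consecutive nodes\<close>

definition poly_antideriv :: "real poly \<Rightarrow> real poly" where
  "poly_antideriv p = (\<Sum>i\<le>degree p. monom (coeff p i / real (Suc i)) (Suc i))"

lemma pderiv_poly_antideriv [simp]: "pderiv (poly_antideriv p) = p"
proof -
  have "pderiv (poly_antideriv p) = (\<Sum>i\<le>degree p. monom (coeff p i) i)"
    using higher_pderiv_sum[of 1 "\<lambda>i. monom (coeff p i / real (Suc i)) (Suc i)" "{..degree p}"]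
    by (simp add: poly_antideriv_def pderiv_monom del: of_nat_Suc)
  then show ?thesis by (simp add: poly_as_sum_of_monoms)
qed

lemma degree_poly_antideriv: "degree (poly_antideriv p) \<le> Suc (degree p)"
  unfolding poly_antideriv_def
  by (intro degree_sum_le) (auto intro: order_trans[OF degree_monom_le])

lemma integral_pderiv:
  fixes p :: "real poly"
  assumes "a \<le> b"
  shows "integral {a..b} (poly (pderiv p)) = poly p b - poly p a"
proof (intro integral_unique fundamental_theorem_of_calculus assms)
  show "(poly p has_vector_derivative poly (pderiv p) x) (at x within {a..b})" for x
    using has_field_derivative_at_within[OF poly_DERIV[of p x]]
    unfolding has_real_derivative_iff_has_vector_derivative .
qed

definition lagrange_poly :: "nat \<Rightarrow> (nat \<Rightarrow> real) \<Rightarrow> nat \<Rightarrow> real poly" where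
  "lagrange_poly N x l = (\<Prod>j\<in>{..N} - {l}. [:- x j / (x l - x j), 1 / (x l - x j):])"

lemma degree_lagrange_poly:
  assumes "l \<le> N" shows "degree (lagrange_poly N x l) \<le> N"
proof -
  have "degree (lagrange_poly N x l)
      \<le> (\<Sum>j\<in>{..N} - {l}. degree [:- x j / (x l - x j), 1 / (x l - x j):])"
    unfolding lagrange_poly_def by (rule order_trans[OF degree_prod_sum_le]) (simp_all add: o_def)
  also have "\<dots> \<le> (\<Sum>j\<in>{..N} - {l}. 1)" by (intro sum_mono) simp
  also have "\<dots> \<le> N" using assms by simp
  finally show ?thesis .
qed

lemma poly_lagrange_poly:
  assumes "inj_on x {..N}" "l \<le> N" "i \<le> N"
  shows "poly (lagrange_poly N x l) (x i) = (if i = l then 1 else 0)"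
proof (cases "i = l")
  case True
  have "x l \<noteq> x j" if "j \<in> {..N} - {l}" for j using assms that by (auto dest: inj_onD)
  then show ?thesis using True
    by (auto simp: lagrange_poly_def poly_prod divide_simps intro!: prod.neutral)
next
  case False
  then have "x i - x l \<noteq> 0" using assms by (auto dest: inj_onD)
  then show ?thesis using False assms
    by (auto simp: lagrange_poly_def poly_prod intro!: bexI[of _ i])
qed

text \<open>Edge polynomial: derivative of the nodal interpolant of the step that jumps between the
  nodes \<open>i\<close> and \<open>i + 1\<close>.\<close>
definition edge_poly :: "nat \<Rightarrow> nat \<Rightarrow> real poly" where
  "edge_poly N i = pderiv (\<Sum>l\<in>{i<..N}. lagrange_poly N (gll N) l)"

lemma inj_gll: "N \<ge> 1 \<Longrightarrow> inj_on (gll N) {..N}"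
  by (rule linorder_inj_onI') (metis atMost_iff gll_strict_mono less_irrefl)

lemma degree_edge_poly: "degree (edge_poly N i) \<le> N - 1"
proof -
  have "degree (\<Sum>l\<in>{i<..N}. lagrange_poly N (gll N) l) \<le> N"
    by (intro degree_sum_le) (auto intro: degree_lagrange_poly)
  then show ?thesis by (simp add: edge_poly_def degree_pderiv)
qed

text \<open>The interpolant whose derivative is \<open>edge_poly N i\<close> has value 0 at the
  nodes up to \<open>i\<close> and 1 at the later ones, so it changes over just one grid
  interval.\<close>

lemma integral_edge_poly:
  assumes "N \<ge> 1" "i < N" "j < N"
  shows "integral {gll N j..gll N (Suc j)} (poly (edge_poly N i)) = (if i = j then 1 else 0)"
proof -
  have node: "poly (\<Sum>l\<in>{i<..N}. lagrange_poly N (gll N) l) (gll N k) = (if i < k then 1 else 0)"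
    if "k \<le> N" for k
    using that assms by (simp add: poly_sum poly_lagrange_poly[OF inj_gll])
  have "gll N j \<le> gll N (Suc j)" using gll_strict_mono[of N j "Suc j"] assms by simp
  then show ?thesis
    unfolding edge_poly_def by (subst integral_pderiv) (use assms in \<open>auto simp: node\<close>)
qed

text \<open>A polynomial of degree at most \<open>N - 1\<close> is determined by its
  \<open>N\<close> integrals between consecutive nodes: if all of them vanish, its antiderivative
  has degree at most \<open>N\<close> and takes one and the same value at \<open>N + 1\<close>
  nodes, hence is constant. This is applied to the difference \<open>R\<close> of the two
  sides.\<close>

lemma edge_poly_expansion:
  assumes "N \<ge> 1" "degree P \<le> N - 1"
  shows "P = (\<Sum>j<N. smult (integral {gll N j..gll N (Suc j)} (poly P)) (edge_poly N j))"
proof -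
  define c where "c j = integral {gll N j..gll N (Suc j)} (poly P)" for j
  define R where "R = P - (\<Sum>j<N. smult (c j) (edge_poly N j))"
  define Q where "Q = poly_antideriv R"
  have le: "gll N j \<le> gll N (Suc j)" if "j < N" for j
    using gll_strict_mono[of N j "Suc j"] assms that by simp
  have cont: "(poly p) integrable_on {a..b}" for p and a b :: real
    by (intro integrable_continuous_interval continuous_intros)
  have "integral {gll N i..gll N (Suc i)} (poly R) = 0" if "i < N" for i
  proof -
    have "integral {gll N i..gll N (Suc i)} (poly R)
       = c i - (\<Sum>j<N. c j * integral {gll N i..gll N (Suc i)} (poly (edge_poly N j)))"
    proof -
      have "poly R = (\<lambda>t. poly P t - (\<Sum>j<N. c j * poly (edge_poly N j) t))"
        by (simp add: R_def poly_sum fun_eq_iff)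
      moreover have "(\<lambda>t. c j * poly (edge_poly N j) t) integrable_on {gll N i..gll N (Suc i)}" for j
        by (intro integrable_continuous_interval continuous_intros)
      ultimately show ?thesis
        by (simp add: integral_diff[OF cont integrable_sum] integral_sum c_def[symmetric])
    qed
    also have "(\<Sum>j<N. c j * integral {gll N i..gll N (Suc i)} (poly (edge_poly N j)))
        = (\<Sum>j<N. if i = j then c j else 0)"
      using that assms(1) by (intro sum.cong refl) (simp add: integral_edge_poly)
    also have "c i - \<dots> = 0" using that by simp
    finally show ?thesis .
  qed
  then have step: "poly Q (gll N (Suc i)) = poly Q (gll N i)" if "i < N" for i
    using integral_pderiv[OF le[OF that], of Q] that unfolding Q_def pderiv_poly_antideriv
    by (metis eq_iff_diff_eq_0)
  have "poly Q (gll N i) = poly Q (gll N 0)" if "i \<le> N" for i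
    using that
  proof (induction i)
    case (Suc i)
    then show ?case using step[of i] by simp
  qed simp
  note const = this
  have sub: "gll N ` {..N} \<subseteq> {x. poly (Q - [:poly Q (gll N 0):]) x = 0}"
  proof (rule image_subsetI)
    fix i assume "i \<in> {..N}"
    then show "gll N i \<in> {x. poly (Q - [:poly Q (gll N 0):]) x = 0}" using const[of i] by simp
  qed
  have "degree R \<le> N - 1" unfolding R_def
  proof (rule degree_diff_le)
    show "degree (\<Sum>j<N. smult (c j) (edge_poly N j)) \<le> N - 1"
      by (rule degree_sum_le) (use degree_edge_poly[of N] in auto)
  qed (rule assms)
  then have "degree Q \<le> N"
    using degree_poly_antideriv[of R] assms unfolding Q_def by linarith
  then have dQ: "degree (Q - [:poly Q (gll N 0):]) \<le> N"
    by (rule degree_diff_le) simp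
  have "Q - [:poly Q (gll N 0):] = 0"
  proof (rule ccontr)
    assume *: "Q - [:poly Q (gll N 0):] \<noteq> 0"
    have "N + 1 = card (gll N ` {..N})" using inj_gll[OF assms(1)] by (simp add: card_image)
    also have "\<dots> \<le> card {x. poly (Q - [:poly Q (gll N 0):]) x = 0}"
      by (intro card_mono poly_roots_finite * sub)
    also have "\<dots> \<le> N" using card_poly_roots_bound[OF *] dQ by simp
    finally show False by simp
  qed
  then have "Q = [:poly Q (gll N 0):]" by (simp only: right_minus_eq)
  from arg_cong[OF this, of pderiv] have "pderiv Q = 0" by (simp only: pderiv_singleton)
  then have "R = 0" by (simp add: Q_def)
  then show ?thesis unfolding R_def c_def by (simp only: right_minus_eq)
qed

section \<open>Integrals over boxes\<close>

text \<open>Addition in the index type \<open>3\<close> is modulo 3, so \<open>d\<close>,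
  \<open>d + 1\<close>, \<open>d + 2\<close> are the three directions for every \<open>d\<close>.
  Statements about a direction are written in this cyclic form, which agrees with the orientation of
  \<open>cross3\<close>.\<close>

lemma three_add [simp]:
  fixes d :: 3
  shows "d + 1 \<noteq> d" "d + 2 \<noteq> d" "d + 1 \<noteq> d + 2" "d \<noteq> d + 1" "d \<noteq> d + 2" "d + 2 \<noteq> d + 1"
  by simp_all

lemma three_cases: fixes d i :: 3 shows "i = d \<or> i = d + 1 \<or> i = d + 2"
  using exhaust_3[of d] exhaust_3[of i] by (elim disjE) simp_all

lemma all_three: fixes d :: 3 shows "(\<forall>i. P i) \<longleftrightarrow> P d \<and> P (d + 1) \<and> P (d + 2)"
  using three_cases[of _ d] by metis

lemma UNIV_three: fixes d :: 3 shows "UNIV = {d, d + 1, d + 2}"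
  using three_cases[of _ d] by auto

text \<open>Parametrizes the planes orthogonal to direction \<open>d\<close>, with the in-plane
  coordinates in the same cyclic order as in \<open>N2\<close>.\<close>

definition emb :: "3 \<Rightarrow> real \<Rightarrow> real \<times> real \<Rightarrow> real^3" where
  "emb d t q = (\<chi> i. if i = d then t else if i = d + 1 then fst q else snd q)"

definition upd :: "real^3 \<Rightarrow> 3 \<Rightarrow> real \<Rightarrow> real^3" where
  "upd x d t = (\<chi> i. if i = d then t else x $ i)"

lemma upd_nth [simp]: "upd x d t $ i = (if i = d then t else x $ i)"
  by (simp add: upd_def)

lemma emb_nth [simp]:
  "emb d t q $ d = t" "emb d t q $ (d + 1) = fst q" "emb d t q $ (d + 2) = snd q"
  by (simp_all add: emb_def)

lemma upd_emb [simp]: "upd (emb d t q) d s = emb d s q"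
  by (simp add: vec_eq_iff emb_def)

lemma upd_same [simp]: "upd x d (x $ d) = x"
  by (simp add: vec_eq_iff)

lemma upd_upd [simp]: "upd (upd x d s) d t = upd x d t"
  by (simp add: vec_eq_iff)

lemma emb_eq_upd: "emb d (x $ d) (x $ (d + 1), x $ (d + 2)) = x"
  using three_cases[of _ d] by (auto simp: vec_eq_iff all_three[of _ d])

lemma emb_in_cbox:
  "emb d t q \<in> cbox a b \<longleftrightarrow>
    t \<in> {a $ d..b $ d} \<and> q \<in> cbox (a $ (d + 1), a $ (d + 2)) (b $ (d + 1), b $ (d + 2))"
  by (cases q) (auto simp: mem_box_cart all_three[of _ d] cbox_Pair_iff)

lemma continuous_on_emb [continuous_intros]:
  assumes "continuous_on S f" "continuous_on S g"
  shows "continuous_on S (\<lambda>x. emb d (f x) (g x))"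
proof -
  have "continuous_on S (\<lambda>x. if i = d then f x else if i = d + 1 then fst (g x) else snd (g x))" for i
    using assms by (cases "i = d"; cases "i = d + 1") (auto intro!: continuous_intros)
  then show ?thesis unfolding emb_def by (rule continuous_on_vec_lambda)
qed

lemma continuous_on_upd [continuous_intros]:
  assumes "continuous_on S f" "continuous_on S g"
  shows "continuous_on S (\<lambda>x. upd (f x) d (g x))"
proof -
  have "continuous_on S (\<lambda>x. if i = d then g x else f x $ i)" for i
    using assms by (cases "i = d") (auto intro!: continuous_intros)
  then show ?thesis unfolding upd_def by (rule continuous_on_vec_lambda)
qed

text \<open>Regrouping the coordinates maps boxes to boxes of the same content, so integrals are
  preserved. In the product type Fubini applies, with direction \<open>d\<close> as the inner
  variable.\<close>

lemma has_integral_cbox_emb: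
  fixes f :: "real^3 \<Rightarrow> real"
  assumes "(f has_integral I) (cbox a b)"
  shows "((\<lambda>(q, t). f (emb d t q)) has_integral I)
    (cbox ((a $ (d + 1), a $ (d + 2)), a $ d) ((b $ (d + 1), b $ (d + 2)), b $ d))"
proof -
  define g where "g = (\<lambda>(q, t). emb d t q)"
  define h where "h x = ((x $ (d + 1), x $ (d + 2)), x $ d)" for x :: "real^3"
  have hg: "h (g x) = x" for x by (auto simp: h_def g_def split: prod.splits)
  have gh: "g (h x) = x" for x by (simp add: h_def g_def emb_eq_upd)
  have hmem: "h x \<in> cbox (h u) (h v) \<longleftrightarrow> x \<in> cbox u v" for x u v
    by (auto simp: h_def mem_box_cart cbox_Pair_iff all_three[of _ d])
  have himg: "h ` cbox u v = cbox (h u) (h v)" for u v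
  proof safe
    fix x y z assume "((x, y), z) \<in> cbox (h u) (h v)"
    then have "g ((x, y), z) \<in> cbox u v" using hmem[of "g ((x, y), z)"] hg by simp
    then show "((x, y), z) \<in> h ` cbox u v" using hg by (metis imageI)
  qed (use hmem in auto)
  have gimg: "g ` cbox u v = cbox (g u) (g v)" for u v
    using himg[of "g u" "g v"] by (metis (no_types, lifting) gh hg image_cong image_ident image_image)
  have "((\<lambda>x. f (g x)) has_integral (1 / 1) *\<^sub>R I) (h ` cbox a b)"
  proof (rule has_integral_twiddle[of 1 h g, OF _ hg gh _ _ _ _ assms])
    show "isCont g x" for x
    proof -
      have "continuous_on UNIV g" unfolding g_def case_prod_unfold by (intro continuous_intros)
      then show ?thesis using continuous_on_eq_continuous_at[OF open_UNIV, of g] by blast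
    qed
    show "measure lborel (g ` cbox u v) = 1 * measure lborel (cbox u v)" for u v
    proof -
      obtain u1 u2 u3 v1 v2 v3 where uv: "u = ((u1, u2), u3)" "v = ((v1, v2), v3)"
        by (metis prod.exhaust)
      have "measure lborel (cbox (g u) (g v)) = (if g v \<in> cbox (g u) (g v) then \<Prod>i\<in>{d, d + 1, d + 2}. g v $ i - g u $ i else 0)"
        unfolding UNIV_three[of d, symmetric]
        by (auto simp: content_cbox_if_cart interval_eq_empty_cart mem_box_cart not_le[symmetric])
      also have "\<dots> = (if u1 \<le> v1 \<and> u2 \<le> v2 \<and> u3 \<le> v3 then (v3 - u3) * (v1 - u1) * (v2 - u2) else 0)"
        by (simp add: g_def uv mem_box_cart all_three[of _ d])
      also have "\<dots> = measure lborel (cbox u v)"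
        by (auto simp: uv content_Pair)
      finally show ?thesis by (simp add: gimg)
    qed
    show "\<exists>w z. g ` cbox u v = cbox w z" for u v using gimg by blast
    show "\<exists>w z. h ` cbox u v = cbox w z" for u v using himg by blast
  qed simp
  then show ?thesis by (simp add: himg) (simp add: h_def g_def case_prod_unfold)
qed

lemma integral_cbox_slices:
  fixes f :: "real^3 \<Rightarrow> real"
  assumes "continuous_on (cbox a b) f"
  shows "integral (cbox a b) f =
    integral (cbox (a $ (d + 1), a $ (d + 2)) (b $ (d + 1), b $ (d + 2)))
      (\<lambda>q. integral {a $ d..b $ d} (\<lambda>t. f (emb d t q)))"
proof -
  let ?a = "(a $ (d + 1), a $ (d + 2))" and ?b = "(b $ (d + 1), b $ (d + 2))"
  have "integral (cbox a b) f = integral (cbox (?a, a $ d) (?b, b $ d)) (\<lambda>(q, t). f (emb d t q))"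
    using has_integral_cbox_emb[OF integrable_integral[OF integrable_continuous[OF assms]], of d]
    by (simp add: integral_unique)
  also have "\<dots> = integral (cbox ?a ?b)
      (\<lambda>q. integral (cbox (a $ d) (b $ d)) (\<lambda>t. (\<lambda>(q, t). f (emb d t q)) (q, t)))"
  proof (rule integral_prod_continuous)
    show "continuous_on (cbox (?a, a $ d) (?b, b $ d)) (\<lambda>(q, t). f (emb d t q))"
      unfolding case_prod_unfold
      by (rule continuous_on_compose2[OF assms])
        (auto intro!: continuous_intros simp: emb_in_cbox cbox_Pair_iff)
  qed
  finally show ?thesis by simp
qed

text \<open>Thickening of a planar integral: a function that ignores coordinate \<open>d\<close> is
  integrated over a box instead of a face. In this form the change of variables in space applies to
  integrals over facets.\<close>

lemma integral_cbox_upd: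
  fixes f :: "real^3 \<Rightarrow> real"
  assumes "continuous_on (cbox a b) (\<lambda>x. f (upd x d s))" "a $ d \<le> b $ d"
  shows "integral (cbox a b) (\<lambda>x. f (upd x d s)) =
    (b $ d - a $ d) *
      integral (cbox (a $ (d + 1), a $ (d + 2)) (b $ (d + 1), b $ (d + 2))) (\<lambda>q. f (emb d s q))"
  unfolding integral_cbox_slices[OF assms(1), of d] using assms(2) by simp

text \<open>Fundamental theorem of calculus in direction \<open>d\<close>, then integration over the
  cross section. It gives the divergence theorem both on the whole cube, with a test function, and
  on a single grid box.\<close>

lemma integral_cbox_partial:
  fixes F F' :: "real^3 \<Rightarrow> real"
  assumes le: "a $ d \<le> b $ d"
    and F': "continuous_on (cbox a b) F'"
    and deriv: "\<And>x. x \<in> cbox a b \<Longrightarrow>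
      ((\<lambda>t. F (upd x d t)) has_real_derivative F' x) (at (x $ d) within {a $ d..b $ d})"
  shows "integral (cbox a b) F' =
    integral (cbox (a $ (d + 1), a $ (d + 2)) (b $ (d + 1), b $ (d + 2)))
      (\<lambda>q. F (emb d (b $ d) q) - F (emb d (a $ d) q))"
  unfolding integral_cbox_slices[OF F', of d]
proof (rule integral_cong, rule integral_unique)
  fix q assume q: "q \<in> cbox (a $ (d + 1), a $ (d + 2)) (b $ (d + 1), b $ (d + 2))"
  show "((\<lambda>t. F' (emb d t q)) has_integral F (emb d (b $ d) q) - F (emb d (a $ d) q)) {a $ d..b $ d}"
  proof (rule fundamental_theorem_of_calculus[OF le])
    fix t assume "t \<in> {a $ d..b $ d}"
    then show "((\<lambda>t. F (emb d t q)) has_vector_derivative F' (emb d t q)) (at t within {a $ d..b $ d})"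
      using deriv[of "emb d t q"] q
      by (simp add: emb_in_cbox has_real_derivative_iff_has_vector_derivative)
  qed
qed

lemma integral_cbox_prod:
  fixes f :: "3 \<Rightarrow> real \<Rightarrow> real"
  assumes "\<And>i. continuous_on UNIV (f i)"
  shows "integral (cbox a b) (\<lambda>x. \<Prod>i\<in>UNIV. f i (x $ i)) = (\<Prod>i\<in>UNIV. integral {a $ i..b $ i} (f i))"
proof -
  have cont: "continuous_on S (f i)" for S i
    by (rule continuous_on_subset[OF assms]) simp
  have c1 [continuous_intros]: "continuous_on S g \<Longrightarrow> continuous_on S (\<lambda>x. f i (g x))"
    for S i and g :: "real^3 \<Rightarrow> real"
    by (rule continuous_on_compose2[OF cont[of UNIV i]]) auto
  have c2 [continuous_intros]: "continuous_on S g \<Longrightarrow> continuous_on S (\<lambda>x. f i (g x))"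
    for S i and g :: "real \<times> real \<Rightarrow> real"
    by (rule continuous_on_compose2[OF cont[of UNIV i]]) auto
  have U: "(\<Prod>i\<in>UNIV. h i) = h 1 * (h 2 * h (3::3))" for h :: "3 \<Rightarrow> real"
  proof -
    have "(\<Prod>i\<in>{1, 2, 3::3}. h i) = h 1 * (h 2 * h (3::3))" by (subst prod.insert; simp)+
    then show ?thesis by (simp only: UNIV_3)
  qed
  have cont': "continuous_on (cbox a b) (\<lambda>x. \<Prod>i\<in>UNIV. f i (x $ i))"
    by (intro continuous_intros)
  let ?I = "\<lambda>i. integral {a $ i..b $ i} (f i)"
  have "integral (cbox a b) (\<lambda>x. \<Prod>i\<in>UNIV. f i (x $ i)) =
    integral (cbox (a $ (1 + 1), a $ (1 + 2)) (b $ (1 + 1), b $ (1 + 2)))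
      (\<lambda>q. integral {a $ 1..b $ 1} (\<lambda>t. f 1 t * (f 2 (fst q) * f 3 (snd q))))"
    unfolding integral_cbox_slices[OF cont', of 1] by (simp add: U emb_def)
  also have "\<dots> = integral (cbox (a $ 2, a $ 3) (b $ 2, b $ 3)) (\<lambda>q. ?I 1 * (f 2 (fst q) * f 3 (snd q)))"
    by simp
  also have "\<dots> = integral (cbox (a $ 2) (b $ 2)) (\<lambda>x. integral (cbox (a $ 3) (b $ 3)) (\<lambda>y. ?I 1 * (f 2 x * f 3 y)))"
    by (subst integral_prod_continuous) (auto intro!: continuous_intros)
  also have "\<dots> = ?I 1 * (?I 2 * ?I 3)"
    by simp
  finally show ?thesis by (simp add: U)
qed

section \<open>Tensor product polynomials\<close>

definition tensor :: "(3 \<Rightarrow> real poly) \<Rightarrow> real^3 \<Rightarrow> real" where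
  "tensor P \<xi> = (\<Prod>i\<in>UNIV. poly (P i) (\<xi> $ i))"

lemma prod_3_UNIV: "(\<Prod>i\<in>UNIV. h i) = h 1 * (h 2 * h (3::3))" for h :: "3 \<Rightarrow> real"
proof -
  have "(\<Prod>i\<in>{1, 2, 3::3}. h i) = h 1 * (h 2 * h (3::3))" by (subst prod.insert; simp)+
  then show ?thesis by (simp only: UNIV_3)
qed

lemma tensor_3: "tensor P \<xi> = poly (P 1) (\<xi> $ 1) * (poly (P 2) (\<xi> $ 2) * poly (P 3) (\<xi> $ 3))"
  unfolding tensor_def by (rule prod_3_UNIV)

lemma tensor_polyE:
  assumes "f \<in> tensor_poly n"
  obtains r :: nat and P where "\<And>t i. t < r \<Longrightarrow> degree (P t i) \<le> n i"
    "f = (\<lambda>\<xi>. \<Sum>t<r. tensor (P t) \<xi>)"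
  using assms unfolding tensor_poly_def tensor_def by blast

lemma tensor_polyI:
  assumes "\<And>t i. t < (r::nat) \<Longrightarrow> degree (P t i) \<le> n i" "\<And>\<xi>. f \<xi> = (\<Sum>t<r. tensor (P t) \<xi>)"
  shows "f \<in> tensor_poly n"
  unfolding tensor_poly_def
  by (rule CollectI, rule exI[of _ r], rule exI[of _ P]) (use assms in \<open>auto simp: tensor_def fun_eq_iff\<close>)

lemma tensor_poly_zero: "(\<lambda>_. 0) \<in> tensor_poly n"
  by (rule tensor_polyI[of 0]) auto

lemma sum_lessThan_add: "(\<Sum>t<r + s. F t) = (\<Sum>t<r. F t) + (\<Sum>t<(s::nat). F (r + t))"
  for F :: "nat \<Rightarrow> real"
  by (induction s) (auto simp: add.assoc)

lemma tensor_poly_add: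
  assumes "f \<in> tensor_poly n" "g \<in> tensor_poly n"
  shows "(\<lambda>\<xi>. f \<xi> + g \<xi>) \<in> tensor_poly n"
proof -
  obtain r :: nat and P where P: "\<And>t i. t < r \<Longrightarrow> degree (P t i) \<le> n i"
    "f = (\<lambda>\<xi>. \<Sum>t<r. tensor (P t) \<xi>)" by (rule tensor_polyE[OF assms(1)]) blast
  obtain s :: nat and Q where Q: "\<And>t i. t < s \<Longrightarrow> degree (Q t i) \<le> n i"
    "g = (\<lambda>\<xi>. \<Sum>t<s. tensor (Q t) \<xi>)" by (rule tensor_polyE[OF assms(2)]) blast
  show ?thesis
    by (rule tensor_polyI[of "r + s" "\<lambda>t. if t < r then P t else Q (t - r)"])
      (use P(1) Q(1) in \<open>auto simp: P(2) Q(2) sum_lessThan_add\<close>)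
qed

lemma tensor_poly_tensor:
  assumes "\<And>i. degree (P i) \<le> n i"
  shows "tensor P \<in> tensor_poly n"
  by (rule tensor_polyI[of 1 "\<lambda>_. P"]) (use assms in auto)

lemma tensor_poly_induct [consumes 1, case_names zero add]:
  assumes "f \<in> tensor_poly n"
    and "Q (\<lambda>_. 0)"
    and "\<And>f P. f \<in> tensor_poly n \<Longrightarrow> Q f \<Longrightarrow> (\<And>i. degree (P i) \<le> n i) \<Longrightarrow> Q (\<lambda>\<xi>. f \<xi> + tensor P \<xi>)"
  shows "Q f"
proof -
  obtain r :: nat and P where P: "\<And>t i. t < r \<Longrightarrow> degree (P t i) \<le> n i"
    "f = (\<lambda>\<xi>. \<Sum>t<r. tensor (P t) \<xi>)" by (rule tensor_polyE[OF assms(1)]) blast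
  have "Q (\<lambda>\<xi>. \<Sum>t<s. tensor (P t) \<xi>)" if "s \<le> r" for s
    using that
  proof (induction s)
    case (Suc s)
    have "(\<lambda>\<xi>. \<Sum>t<s. tensor (P t) \<xi>) \<in> tensor_poly n"
      by (rule tensor_polyI[of s P]) (use Suc P(1) in auto)
    from assms(3)[OF this, of "P s"] Suc P(1) show ?case by simp
  qed (simp add: assms(2))
  then show ?thesis using P(2) by simp
qed

lemma tensor_scale:
  "c * tensor P \<xi> = tensor (P(1 := smult c (P 1))) \<xi>"
  unfolding tensor_3 by simp

lemma tensor_poly_scale:
  assumes "f \<in> tensor_poly n"
  shows "(\<lambda>\<xi>. c * f \<xi>) \<in> tensor_poly n"
  using assms
proof (induction rule: tensor_poly_induct)
  case zero
  then show ?case by (simp add: tensor_poly_zero)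
next
  case (add f P)
  have "tensor (P(1 := smult c (P 1))) \<in> tensor_poly n"
    by (rule tensor_poly_tensor) (use add.hyps(2) order_trans[OF degree_smult_le] in auto)
  from tensor_poly_add[OF add.IH this] show ?case
    by (simp add: distrib_left tensor_scale)
qed

lemma tensor_poly_sum:
  assumes "\<And>x. x \<in> A \<Longrightarrow> f x \<in> tensor_poly n"
  shows "(\<lambda>\<xi>. \<Sum>x\<in>A. f x \<xi>) \<in> tensor_poly n"
  using assms by (induction A rule: infinite_finite_induct) (auto intro: tensor_poly_zero tensor_poly_add)

lemma continuous_on_tensor_poly:
  assumes "f \<in> tensor_poly n"
  shows "continuous_on S f"
proof -
  obtain r :: nat and P where "f = (\<lambda>\<xi>. \<Sum>t<r. tensor (P t) \<xi>)" by (rule tensor_polyE[OF assms]) blast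
  then show ?thesis unfolding tensor_def by (auto intro!: continuous_intros)
qed

text \<open>Only the diagonal derivatives are recorded; their sum over \<open>d\<close> is the
  divergence on the reference cube.\<close>

definition partials :: "(real^3 \<Rightarrow> real^3) \<Rightarrow> (3 \<Rightarrow> real^3 \<Rightarrow> real) \<Rightarrow> bool" where
  "partials u w \<longleftrightarrow> (\<forall>d \<xi>. ((\<lambda>t. u (upd \<xi> d t) $ d) has_real_derivative w d \<xi>) (at (\<xi> $ d)))"

lemma tensor_partial:
  "((\<lambda>t. tensor P (upd \<xi> d t)) has_real_derivative tensor (P(d := pderiv (P d))) \<xi>) (at (\<xi> $ d))"
  unfolding tensor_def UNIV_three[of d]
  by (auto intro!: derivative_eq_intros)

lemma tensor_poly_partial:
  assumes "f \<in> tensor_poly n"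
  shows "\<exists>f'\<in>tensor_poly (n(d := n d - 1)).
    \<forall>\<xi>. ((\<lambda>t. f (upd \<xi> d t)) has_real_derivative f' \<xi>) (at (\<xi> $ d))"
  using assms
proof (induction rule: tensor_poly_induct)
  case zero
  then show ?case by (auto intro!: bexI[OF _ tensor_poly_zero])
next
  case (add f P)
  then obtain f' where f': "f' \<in> tensor_poly (n(d := n d - 1))"
    "\<And>\<xi>. ((\<lambda>t. f (upd \<xi> d t)) has_real_derivative f' \<xi>) (at (\<xi> $ d))" by blast
  have "tensor (P(d := pderiv (P d))) \<in> tensor_poly (n(d := n d - 1))"
    by (rule tensor_poly_tensor) (use add.hyps(2) in \<open>auto simp: degree_pderiv diff_le_mono\<close>)
  from tensor_poly_add[OF f'(1) this] show ?case
    by (rule bexI[rotated]) (auto intro!: DERIV_add f'(2) tensor_partial)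
qed

text \<open>The component \<open>d\<close> has the raised degree \<open>N\<close> in direction
  \<open>d\<close> alone, and differentiation in that direction lowers it to \<open>N - 1\<close>.
  This is why the divergence maps D(K) into S(K).\<close>

lemma D_ref_partials:
  assumes "u \<in> D_ref N"
  shows "\<exists>w. (\<forall>d. w d \<in> S_ref N) \<and> partials u w"
proof -
  have "\<exists>f'\<in>S_ref N. \<forall>\<xi>. ((\<lambda>t. u (upd \<xi> d t) $ d) has_real_derivative f' \<xi>) (at (\<xi> $ d))" for d
  proof -
    have "(\<lambda>\<xi>. u \<xi> $ d) \<in> tensor_poly (\<lambda>i. if i = d then N else N - 1)"
      using assms unfolding D_ref_def by blast
    from tensor_poly_partial[OF this, of d]
    show ?thesis unfolding S_ref_def by (simp add: fun_upd_def cong: if_cong)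
  qed
  then show ?thesis unfolding partials_def by metis
qed

lemma continuous_on_D_ref:
  assumes "u \<in> D_ref N" shows "continuous_on S u"
proof -
  have "continuous_on S (\<lambda>\<xi>. u \<xi> $ d)" for d
    using assms unfolding D_ref_def by (blast intro: continuous_on_tensor_poly)
  then have "continuous_on S (\<lambda>\<xi>. \<chi> d. u \<xi> $ d)" by (rule continuous_on_vec_lambda)
  then show ?thesis by simp
qed

lemma partials_unique:
  assumes "partials u w" "partials u w'" shows "w d \<xi> = w' d \<xi>"
  using assms unfolding partials_def by (blast intro: DERIV_unique)

section \<open>Functions of S(K) and their integrals over the grid boxes\<close>

definition vol_index :: "nat \<Rightarrow> (nat^3) set" where
  "vol_index N = {k. \<forall>i. k $ i < N}"

definition vol_poly :: "nat \<Rightarrow> nat^3 \<Rightarrow> real^3 \<Rightarrow> real" where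
  "vol_poly N k = tensor (\<lambda>i. edge_poly N (k $ i))"

lemma vol_index_eq: "vol_index N = vec_lambda ` (PiE UNIV (\<lambda>_. {..<N}))"
proof safe
  fix k assume "k \<in> vol_index N"
  then have "($) k \<in> PiE UNIV (\<lambda>_. {..<N})" by (auto simp: vol_index_def)
  then show "k \<in> vec_lambda ` (PiE UNIV (\<lambda>_. {..<N}))" by (metis image_eqI vec_nth_inverse)
qed (auto simp: vol_index_def PiE_iff)

lemma finite_vol_index: "finite (vol_index N)"
  unfolding vol_index_eq by (intro finite_imageI finite_PiE) auto

lemma vol_poly_S_ref: "vol_poly N k \<in> S_ref N"
  unfolding vol_poly_def S_ref_def by (intro tensor_poly_tensor degree_edge_poly)

lemma integral_vol_box_tensor:
  "integral (vol_box N k) (tensor P) = (\<Prod>i\<in>UNIV. integral {gll N (k $ i)..gll N (k $ i + 1)} (poly (P i)))"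
proof -
  have "integral (vol_box N k) (\<lambda>x. \<Prod>i\<in>UNIV. poly (P i) (x $ i)) =
    (\<Prod>i\<in>UNIV. integral {(\<chi> i. gll N (k $ i)) $ i..(\<chi> i. gll N (k $ i + 1)) $ i} (poly (P i)))"
    unfolding vol_box_def by (rule integral_cbox_prod) (auto intro: continuous_intros)
  then show ?thesis by (simp add: tensor_def[abs_def])
qed

lemma integral_vol_poly:
  assumes "N \<ge> 1" "k \<in> vol_index N" "l \<in> vol_index N"
  shows "integral (vol_box N l) (vol_poly N k) = (if k = l then 1 else 0)"
proof -
  have "integral (vol_box N l) (vol_poly N k) = (\<Prod>i\<in>UNIV. if k $ i = l $ i then 1 else 0)"
    unfolding vol_poly_def integral_vol_box_tensor
    using assms by (intro prod.cong refl) (simp add: vol_index_def integral_edge_poly)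
  also have "\<dots> = (if k = l then 1 else 0)" by (auto simp: vec_eq_iff)
  finally show ?thesis .
qed

text \<open>Each factor is expanded in edge polynomials and the product is multiplied out; the
  choices of one edge polynomial per direction are exactly the box indices, and the coefficients
  multiply to box integrals.\<close>

lemma tensor_expansion:
  assumes "N \<ge> 1" "\<And>i. degree (P i) \<le> N - 1"
  shows "tensor P \<xi> = (\<Sum>k\<in>vol_index N. integral (vol_box N k) (tensor P) * vol_poly N k \<xi>)"
proof -
  let ?c = "\<lambda>i j. integral {gll N j..gll N (Suc j)} (poly (P i))"
  let ?e = "\<lambda>i j. ?c i j * poly (edge_poly N j) (\<xi> $ i)"
  have "poly (P i) (\<xi> $ i) = (\<Sum>j<N. ?e i j)" for i
  proof -
    have "poly (P i) (\<xi> $ i) = poly (\<Sum>j<N. smult (?c i j) (edge_poly N j)) (\<xi> $ i)"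
      using edge_poly_expansion[OF assms(1) assms(2)[of i]] by (rule arg_cong)
    then show ?thesis by (simp add: poly_sum)
  qed
  then have "tensor P \<xi> = (\<Prod>i\<in>UNIV. \<Sum>j<N. ?e i j)" unfolding tensor_def by (intro prod.cong refl)
  also have "\<dots> = (\<Sum>g\<in>PiE UNIV (\<lambda>_. {..<N}). \<Prod>i\<in>UNIV. ?e i (g i))"
    by (rule prod_sum_PiE) auto
  also have "\<dots> = (\<Sum>k\<in>vol_index N. \<Prod>i\<in>UNIV. ?e i (k $ i))"
    unfolding vol_index_eq by (subst sum.reindex) (auto simp: inj_on_def vec_lambda_inject)
  also have "\<dots> = (\<Sum>k\<in>vol_index N. integral (vol_box N k) (tensor P) * vol_poly N k \<xi>)"
    by (intro sum.cong refl) (simp add: integral_vol_box_tensor vol_poly_def tensor_def prod.distrib)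
  finally show ?thesis .
qed

lemma S_ref_expansion:
  assumes "N \<ge> 1" "g \<in> S_ref N"
  shows "g \<xi> = (\<Sum>k\<in>vol_index N. integral (vol_box N k) g * vol_poly N k \<xi>)"
proof -
  obtain r :: nat and P where P: "\<And>t i. t < r \<Longrightarrow> degree (P t i) \<le> N - 1"
    "g = (\<lambda>\<xi>. \<Sum>t<r. tensor (P t) \<xi>)"
    by (rule tensor_polyE[OF assms(2)[unfolded S_ref_def]]) blast
  have int: "tensor Q integrable_on vol_box N k" for Q k
    unfolding vol_box_def tensor_def[abs_def] by (intro integrable_continuous continuous_intros)
  have "g \<xi> = (\<Sum>t<r. \<Sum>k\<in>vol_index N. integral (vol_box N k) (tensor (P t)) * vol_poly N k \<xi>)"
    unfolding P(2) by (intro sum.cong refl tensor_expansion assms) (use P(1) in auto)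
  also have "\<dots> = (\<Sum>k\<in>vol_index N. (\<Sum>t<r. integral (vol_box N k) (tensor (P t))) * vol_poly N k \<xi>)"
    by (subst sum.swap) (simp add: sum_distrib_right)
  also have "\<dots> = (\<Sum>k\<in>vol_index N. integral (vol_box N k) g * vol_poly N k \<xi>)"
    unfolding P(2) using int by (simp add: integral_sum)
  finally show ?thesis .
qed

text \<open>Serves to identify a divergence from its integrals over the grid boxes, which are known
  from fluxes.\<close>

lemma S_ref_eqI:
  assumes "N \<ge> 1" "g \<in> S_ref N" "h \<in> S_ref N"
    "\<And>k. k \<in> vol_index N \<Longrightarrow> integral (vol_box N k) g = integral (vol_box N k) h"
  shows "g = h"
proof
  fix \<xi>
  show "g \<xi> = h \<xi>"
    unfolding S_ref_expansion[OF assms(1,2), of \<xi>] S_ref_expansion[OF assms(1,3), of \<xi>]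
    by (intro sum.cong refl) (simp add: assms(4))
qed

section \<open>A right inverse of the divergence on the reference cube\<close>

lemma zero_trace_antideriv:
  fixes P :: "real poly"
  assumes "N \<ge> 1" "degree P \<le> N - 1"
  shows "\<exists>c R. degree R \<le> N \<and> pderiv R = P - [:c:] \<and> poly R 1 = 0 \<and> poly R (-1) = 0"
proof -
  define Q where "Q = poly_antideriv P"
  \<comment> \<open>The mean value of \<open>P\<close>. It is the slope of the affine function that
    agrees with \<open>Q\<close> at both ends; subtracting this function leaves an antiderivative of
    \<open>P - [:c:]\<close> vanishing at both ends.\<close>
  define c where "c = (poly Q 1 - poly Q (-1)) / 2"
  have "degree Q \<le> N" using degree_poly_antideriv[of P] assms unfolding Q_def by linarith
  moreover have "degree [:poly Q (-1) + c, c:] \<le> N" using assms by simp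
  ultimately have "degree (Q - [:poly Q (-1) + c, c:]) \<le> N" by (rule degree_diff_le)
  moreover have "pderiv (Q - [:poly Q (-1) + c, c:]) = P - [:c:]"
    by (simp add: Q_def pderiv_diff pderiv_pCons)
  ultimately show ?thesis
    by (intro exI[of _ c] exI[of _ "Q - [:poly Q (-1) + c, c:]"]) (auto simp: c_def field_simps)
qed

text \<open>Averaging in one direction after the other: with \<open>P\<^sub>i - c\<^sub>i\<close> the derivative of a polynomial
  vanishing at both ends,
  \<open>P\<^sub>1P\<^sub>2P\<^sub>3 - c\<^sub>1c\<^sub>2c\<^sub>3 = (P\<^sub>1 - c\<^sub>1)P\<^sub>2P\<^sub>3 + c\<^sub>1(P\<^sub>2 - c\<^sub>2)P\<^sub>3 + c\<^sub>1c\<^sub>2(P\<^sub>3 - c\<^sub>3)\<close>.\<close>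
lemma zero_trace_field:
  assumes "N \<ge> 1" "g \<in> S_ref N"
  shows "\<exists>c. \<exists>u\<in>D_ref N. \<exists>w. partials u w \<and> (\<forall>\<xi>. (\<Sum>d\<in>UNIV. w d \<xi>) = g \<xi> - c) \<and>
    (\<forall>\<xi> d. \<bar>\<xi> $ d\<bar> = 1 \<longrightarrow> u \<xi> $ d = 0)"
  using assms(2) unfolding S_ref_def
proof (induction rule: tensor_poly_induct)
  case zero
  have "(\<lambda>_. 0) \<in> D_ref N" by (simp add: D_ref_def tensor_poly_zero)
  then show ?case
    by (intro exI[of _ 0] bexI[of _ "\<lambda>_. 0"] exI[of _ "\<lambda>_ _. 0"]) (auto simp: partials_def)
next
  case (add g P)
  then obtain c u w where u: "u \<in> D_ref N" "partials u w"
    "\<And>\<xi>. (\<Sum>d\<in>UNIV. w d \<xi>) = g \<xi> - c" "\<And>\<xi> d. \<bar>\<xi> $ d\<bar> = 1 \<Longrightarrow> u \<xi> $ d = 0" by blast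
  obtain a R where R: "\<And>i. degree (R i) \<le> N" "\<And>i. pderiv (R i) = P i - [:a i:]"
    "\<And>i. poly (R i) 1 = 0" "\<And>i. poly (R i) (-1) = 0"
    using zero_trace_antideriv[OF assms(1) add.hyps(2)] by metis
  define A where "A d = (if d = 1 then P(1 := R 1) else if d = 2 then P(1 := [:a 1:], 2 := R 2)
    else (\<lambda>i. [:a i:])(3 := R 3))" for d :: 3
  define v where "v \<xi> = (\<chi> d. tensor (A d) \<xi>)" for \<xi>
  define z where "z d = tensor ((A d)(d := pderiv (A d d)))" for d
  have three: "(d::3) = 1 \<or> d = 2 \<or> d = 3" for d by (rule exhaust_3)
  have AR: "A d d = R d" for d using three[of d] by (auto simp: A_def)
  have degA: "degree (A d i) \<le> (if i = d then N else N - 1)" for d i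
    using R(1) add.hyps(2) three[of d] by (auto simp: A_def)
  have v: "v \<in> D_ref N" unfolding D_ref_def v_def
    by (auto intro!: tensor_poly_tensor degA)
  have pz: "partials v z" unfolding partials_def v_def z_def using tensor_partial by simp
  have sumz: "(\<Sum>d\<in>UNIV. z d \<xi>) = tensor P \<xi> - a 1 * a 2 * a 3" for \<xi>
  proof -
    have A: "A 1 = P(1 := R 1)" "A 2 = P(1 := [:a 1:], 2 := R 2)" "A 3 = (\<lambda>i. [:a i:])(3 := R 3)"
      by (simp_all add: A_def)
    have "z 1 \<xi> = (poly (P 1) (\<xi> $ 1) - a 1) * (poly (P 2) (\<xi> $ 2) * poly (P 3) (\<xi> $ 3))"
      "z 2 \<xi> = a 1 * ((poly (P 2) (\<xi> $ 2) - a 2) * poly (P 3) (\<xi> $ 3))"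
      "z 3 \<xi> = a 1 * (a 2 * (poly (P 3) (\<xi> $ 3) - a 3))"
      unfolding z_def tensor_3 A by (simp_all add: R(2))
    moreover have "(p - x) * (q * r) + x * ((q - y) * r) + x * (y * (r - t)) = p * (q * r) - x * y * t"
      for p q r x y t :: real by (simp add: algebra_simps)
    ultimately show ?thesis unfolding sum_3 tensor_3 by simp
  qed
  have "v \<xi> $ d = 0" if "\<bar>\<xi> $ d\<bar> = 1" for \<xi> d
  proof -
    have "\<xi> $ d = 1 \<or> \<xi> $ d = -1" using that by linarith
    then have "poly (A d d) (\<xi> $ d) = 0" unfolding AR using R(3,4) by auto
    then show ?thesis unfolding v_def tensor_def by (auto intro!: prod_zero)
  qed
  moreover have "(\<lambda>\<xi>. u \<xi> + v \<xi>) \<in> D_ref N"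
    using u(1) v unfolding D_ref_def by (auto intro: tensor_poly_add)
  moreover have "partials (\<lambda>\<xi>. u \<xi> + v \<xi>) (\<lambda>d \<xi>. w d \<xi> + z d \<xi>)"
    using u(2) pz unfolding partials_def by (auto intro!: DERIV_add)
  ultimately show ?case
    using u(4)
    by (intro exI[of _ "c + a 1 * a 2 * a 3"] bexI[of _ "\<lambda>\<xi>. u \<xi> + v \<xi>"]
        exI[of _ "\<lambda>d \<xi>. w d \<xi> + z d \<xi>"]) (auto simp: sum.distrib u(3) sumz)
qed

text \<open>The zero-trace field misses \<open>g\<close> by a constant \<open>c\<close>. An affine
  function with values \<open>a d (-1)\<close> and \<open>a d 1\<close> at the two ends contributes
  the slope \<open>(a d 1 - a d (-1)) / 2\<close>, so any facet values with the right sum repair the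
  defect. The order of quantifiers matters: \<open>c\<close> depends on \<open>g\<close> alone, and
  the facet values can be chosen later, for all elements together.\<close>

lemma facet_constant_field:
  assumes "N \<ge> 1" "g \<in> S_ref N"
  shows "\<exists>c. \<forall>a :: 3 \<Rightarrow> real \<Rightarrow> real. (\<Sum>d\<in>UNIV. (a d 1 - a d (-1)) / 2) = c \<longrightarrow>
    (\<exists>u\<in>D_ref N. \<exists>w. partials u w \<and> (\<forall>\<xi>. (\<Sum>d\<in>UNIV. w d \<xi>) = g \<xi>) \<and>
      (\<forall>\<xi> d. \<bar>\<xi> $ d\<bar> = 1 \<longrightarrow> u \<xi> $ d = a d (\<xi> $ d)))"
proof -
  obtain c u w where u: "u \<in> D_ref N" "partials u w"
    "\<And>\<xi>. (\<Sum>d\<in>UNIV. w d \<xi>) = g \<xi> - c" "\<And>\<xi> d. \<bar>\<xi> $ d\<bar> = 1 \<Longrightarrow> u \<xi> $ d = 0"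
    using zero_trace_field[OF assms] by blast
  show ?thesis
  proof (rule exI[of _ c], intro allI impI)
    fix a :: "3 \<Rightarrow> real \<Rightarrow> real"
    assume a: "(\<Sum>d\<in>UNIV. (a d 1 - a d (-1)) / 2) = c"
    define q where "q d = [:(a d 1 + a d (-1)) / 2, (a d 1 - a d (-1)) / 2:]" for d
    define v where "v \<xi> = (\<chi> d. poly (q d) (\<xi> $ d))" for \<xi> :: "real^3"
    have vt: "(\<lambda>\<xi>. v \<xi> $ d) = tensor ((\<lambda>_. 1)(d := q d))" for d
    proof
      fix \<xi>
      have "tensor ((\<lambda>_. 1)(d := q d)) \<xi> = (\<Prod>i\<in>UNIV. if i = d then poly (q d) (\<xi> $ d) else 1)"
        unfolding tensor_def by (intro prod.cong) auto
      then show "v \<xi> $ d = tensor ((\<lambda>_. 1)(d := q d)) \<xi>" by (simp add: v_def)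
    qed
    have "(\<lambda>\<xi>. v \<xi> $ d) \<in> tensor_poly (\<lambda>i. if i = d then N else N - 1)" for d
      unfolding vt by (rule tensor_poly_tensor) (use assms in \<open>auto simp: q_def\<close>)
    then have "v \<in> D_ref N" unfolding D_ref_def by blast
    then have "(\<lambda>\<xi>. u \<xi> + v \<xi>) \<in> D_ref N"
      using u(1) unfolding D_ref_def by (auto intro: tensor_poly_add)
    moreover have "partials (\<lambda>\<xi>. u \<xi> + v \<xi>) (\<lambda>d \<xi>. w d \<xi> + (a d 1 - a d (-1)) / 2)"
      unfolding partials_def
    proof (intro allI)
      fix d \<xi>
      have "((\<lambda>t. v (upd \<xi> d t) $ d) has_real_derivative (a d 1 - a d (-1)) / 2) (at (\<xi> $ d))"
        unfolding v_def q_def by (auto intro!: derivative_eq_intros)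
      then show "((\<lambda>t. (u (upd \<xi> d t) + v (upd \<xi> d t)) $ d) has_real_derivative
          w d \<xi> + (a d 1 - a d (-1)) / 2) (at (\<xi> $ d))"
        using u(2) unfolding partials_def by (auto intro!: DERIV_add)
    qed
    moreover have "(\<Sum>d\<in>UNIV. w d \<xi> + (a d 1 - a d (-1)) / 2) = g \<xi>" for \<xi>
      by (simp add: sum.distrib u(3) a)
    moreover have "(u \<xi> + v \<xi>) $ d = a d (\<xi> $ d)" if "\<bar>\<xi> $ d\<bar> = 1" for \<xi> d
    proof -
      have "\<xi> $ d = 1 \<or> \<xi> $ d = -1" using that by linarith
      then show ?thesis using u(4)[OF that] by (auto simp: v_def q_def field_simps)
    qed
    ultimately show "\<exists>u\<in>D_ref N. \<exists>w. partials u w \<and> (\<forall>\<xi>. (\<Sum>d\<in>UNIV. w d \<xi>) = g \<xi>) \<and>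
      (\<forall>\<xi> d. \<bar>\<xi> $ d\<bar> = 1 \<longrightarrow> u \<xi> $ d = a d (\<xi> $ d))" by blast
  qed
qed

section \<open>Change of variables on the mesh\<close>

text \<open>The scalar case of the change of variables for vector functions, obtained through
  \<open>real^1\<close>.\<close>

lemma change_of_variables_real:
  fixes f :: "real^3 \<Rightarrow> real" and g :: "real^3 \<Rightarrow> real^3"
  assumes "S \<in> sets lebesgue" "\<And>x. x \<in> S \<Longrightarrow> (g has_derivative g' x) (at x within S)" "inj_on g S"
    and "(\<lambda>x. \<bar>det (matrix (g' x))\<bar> * f (g x)) absolutely_integrable_on S"
  shows "f absolutely_integrable_on (g ` S)"
    "integral (g ` S) f = integral S (\<lambda>x. \<bar>det (matrix (g' x))\<bar> * f (g x))"
proof -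
  let ?D = "\<lambda>x. \<bar>det (matrix (g' x))\<bar> * f (g x)"
  let ?F = "\<lambda>x. vec (f x) :: real^1"
  have eq: "(\<lambda>x. \<bar>det (matrix (g' x))\<bar> *\<^sub>R ?F (g x)) = (\<lambda>x. vec (?D x))"
    by (simp add: fun_eq_iff vec_eq_iff)
  have "(\<lambda>x. vec (?D x) :: real^1) absolutely_integrable_on S \<and>
      integral S (\<lambda>x. vec (?D x) :: real^1) = vec (integral S ?D)"
    unfolding absolutely_integrable_on_1_iff integral_on_1_eq using assms(4) by simp
  then have "?F absolutely_integrable_on (g ` S) \<and> integral (g ` S) ?F = vec (integral S ?D)"
    using has_absolute_integral_change_of_variables[OF assms(1-3), of ?F "vec (integral S ?D)"]
    unfolding eq by blast
  then show "f absolutely_integrable_on (g ` S)" "integral (g ` S) f = integral S ?D"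
    unfolding absolutely_integrable_on_1_iff integral_on_1_eq by (simp_all add: vec_eq_iff)
qed

text \<open>Near a boundary point the region strictly below the Lipschitz graph is open and misses
  \<Omega>, and it comes arbitrarily close to the point; so the point is not interior to the
  closure. In particular \<Omega> has no slits.\<close>

lemma lipschitz_domain_interior_closure:
  assumes "lipschitz_domain \<Omega>"
  shows "interior (closure \<Omega>) \<subseteq> \<Omega>"
proof
  fix x assume x: "x \<in> interior (closure \<Omega>)"
  show "x \<in> \<Omega>"
  proof (rule ccontr)
    assume nx: "x \<notin> \<Omega>"
    have "open \<Omega>" using assms by (simp add: lipschitz_domain_def)
    then have "x \<in> frontier \<Omega>" using x nx interior_subset by (auto simp: frontier_def interior_open)
    then obtain T :: "real^3 \<Rightarrow> real^3" and \<gamma> :: "real \<times> real \<Rightarrow> real" and L r where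
      T: "orthogonal_transformation T" and \<gamma>: "L-lipschitz_on UNIV \<gamma>" and r: "r > 0"
      and graph: "\<And>y. y \<in> ball x r \<Longrightarrow> y \<in> \<Omega> \<longleftrightarrow> T (y - x) $ 3 > \<gamma> (T (y - x) $ 1, T (y - x) $ 2)"
      using assms unfolding lipschitz_domain_def by blast
    have linT: "linear T" using T by (simp add: orthogonal_transformation_def)
    have contT [continuous_intros]: "continuous_on S h \<Longrightarrow> continuous_on S (\<lambda>y. T (h y))"
      for S and h :: "real^3 \<Rightarrow> real^3"
      by (rule linear_continuous_on_compose[OF _ linT])
    have cont\<gamma>: "continuous_on UNIV \<gamma>" using \<gamma> by (rule lipschitz_on_continuous_on)
    have le: "0 \<le> \<gamma> (0, 0)" using graph[of x] nx r by (simp add: linear_0[OF linT])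
    obtain v where v: "T v = axis 3 1" using orthogonal_transformation_surj[OF T] by (metis surjD)
    have nv: "norm v = 1" using T v by (metis norm_axis_1 orthogonal_transformation_norm)
    obtain e where e: "e > 0" "ball x e \<subseteq> closure \<Omega>"
      using x by (auto simp: mem_interior)
    define t where "t = min e r / 2"
    have t: "t > 0" "t < e" "t < r" using e r by (auto simp: t_def)
    \<comment> \<open>A point slightly below \<open>x\<close> in the vertical direction of the local
      graph. As \<open>x\<close> is not in \<Omega>, the graph does not pass below \<open>x\<close>,
      so \<open>y\<close> is strictly below it.\<close>
    define y where "y = x - t *\<^sub>R v"
    have dy: "dist x y = t" using t nv by (simp add: y_def dist_norm)
    have Ty: "T (y - x) = - t *\<^sub>R axis 3 1"
      by (simp add: y_def linear_neg[OF linT] linear_scale[OF linT] v)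
    define U where "U = {z. T (z - x) $ 3 < \<gamma> (T (z - x) $ 1, T (z - x) $ 2)} \<inter> ball x r"
    have "open U" unfolding U_def
      by (intro open_Int open_Collect_less open_ball continuous_intros continuous_on_compose2[OF cont\<gamma>]) auto
    moreover have "y \<in> U" unfolding U_def using le t dy by (simp add: Ty axis_def)
    moreover have "U \<inter> \<Omega> = {}" using graph unfolding U_def by fastforce
    ultimately have "y \<notin> closure \<Omega>" by (meson disjoint_iff open_Int_closure_eq_empty)
    then show False using e dy t by auto
  qed
qed

lemma ref_cube_mem: "\<xi> \<in> ref_cube \<longleftrightarrow> (\<forall>i. \<bar>\<xi> $ i\<bar> \<le> 1)"
  by (auto simp: ref_cube_def mem_box_cart abs_le_iff minus_le_iff)

lemma ref_cube_mem_interior: "\<xi> \<in> interior ref_cube \<longleftrightarrow> (\<forall>i. \<bar>\<xi> $ i\<bar> < 1)"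
  by (auto simp: ref_cube_def interior_cbox mem_box_cart abs_less_iff minus_less_iff)

lemma compact_ref_cube: "compact ref_cube" and convex_ref_cube: "convex ref_cube"
  by (auto simp: ref_cube_def)

lemma ref_cube_closure_interior: "closure (interior ref_cube) = ref_cube"
proof -
  have "0 \<in> interior ref_cube" by (simp add: ref_cube_mem_interior)
  then show ?thesis
    using convex_closure_interior[OF convex_ref_cube] compact_ref_cube
    by (metis closure_closed compact_imp_closed empty_iff)
qed

lemma negligible_ref_cube_boundary: "negligible (ref_cube - interior ref_cube)"
proof -
  have "ref_cube - interior ref_cube \<subseteq> frontier ref_cube"
    using closure_subset by (auto simp: frontier_def)
  then show ?thesis using negligible_convex_frontier[OF convex_ref_cube] negligible_subset by blast
qed

lemma vol_box_subset:
  assumes "N \<ge> 1" "k \<in> vol_index N" shows "vol_box N k \<subseteq> ref_cube"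
proof
  fix \<xi> assume "\<xi> \<in> vol_box N k"
  then have "gll N (k $ i) \<le> \<xi> $ i" "\<xi> $ i \<le> gll N (k $ i + 1)" for i
    by (auto simp: vol_box_def mem_box_cart)
  moreover have "-1 \<le> gll N (k $ i)" "gll N (k $ i + 1) \<le> 1" for i
    using gll_range[OF assms(1), of "k $ i"] gll_range[OF assms(1), of "k $ i + 1"] assms(2)
    by (auto simp: vol_index_def Suc_le_eq less_imp_le)
  ultimately show "\<xi> \<in> ref_cube"
    unfolding ref_cube_mem abs_le_iff by (meson minus_le_iff order_trans)
qed

text \<open>The cube has positive length in all directions, so even at its boundary points the
  derivative within the cube is unique.\<close>

lemma ref_cube_derivative_unique:
  fixes f :: "real^3 \<Rightarrow> 'b::real_normed_vector"
  assumes "\<xi> \<in> ref_cube" "(f has_derivative f') (at \<xi> within ref_cube)"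
    "(f has_derivative f'') (at \<xi> within ref_cube)"
  shows "f' = f''"
proof (rule frechet_derivative_unique_within_closed_interval)
  show "(vec (-1) :: real^3) \<bullet> i < vec 1 \<bullet> i" if "i \<in> Basis" for i
    using that by (auto simp: Basis_vec_def inner_axis)
qed (use assms in \<open>auto simp: ref_cube_def\<close>)

section \<open>The element maps\<close>

context gll_mesh begin

abbreviation (input) "K \<equiv> ref_cube"
abbreviation (input) "Ki \<equiv> interior ref_cube"

lemma Ki_subset: "\<xi> \<in> Ki \<Longrightarrow> \<xi> \<in> K"
  using interior_subset by blast

text \<open>\<open>jac\<close> is defined through \<open>jacobian\<close>, whereas the regularity of
  the map speaks of some continuous derivative. Uniqueness within the cube identifies the two, so
  \<open>jac\<close> is continuous up to the boundary.\<close>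

lemma C1_jac:
  assumes "m < n"
  shows "\<And>\<xi>. \<xi> \<in> K \<Longrightarrow> (\<Phi> m has_derivative (\<lambda>h. jac m \<xi> *v h)) (at \<xi> within K)"
    and "continuous_on K (jac m)"
proof -
  obtain f' :: "real^3 \<Rightarrow> (real^3) \<Rightarrow>\<^sub>L (real^3)" where
    f': "\<And>\<xi>. \<xi> \<in> K \<Longrightarrow> (\<Phi> m has_derivative blinfun_apply (f' \<xi>)) (at \<xi> within K)"
    and cont: "continuous_on K f'"
    using diffeo[OF assms] unfolding diffeomorphism_on_def C1_on_def by blast
  show der: "(\<Phi> m has_derivative (\<lambda>h. jac m \<xi> *v h)) (at \<xi> within K)" if "\<xi> \<in> K" for \<xi>
    using f'[OF that] unfolding jac_def jacobian_works[symmetric] differentiable_def by blast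
  have eq: "jac m \<xi> *v h = blinfun_apply (f' \<xi>) h" if "\<xi> \<in> K" for \<xi> h
  proof -
    have "(\<lambda>h. jac m \<xi> *v h) = blinfun_apply (f' \<xi>)"
      by (rule ref_cube_derivative_unique[OF that der[OF that] f'[OF that]])
    then show ?thesis by metis
  qed
  have "continuous_on K (\<lambda>\<xi>. \<chi> i j. blinfun_apply (f' \<xi>) (axis j 1) $ i)"
    by (intro continuous_on_vec_lambda continuous_intros blinfun.continuous_on cont)
  then show "continuous_on K (jac m)"
  proof (rule continuous_on_eq)
    fix \<xi> assume "\<xi> \<in> K"
    then show "(\<chi> i j. blinfun_apply (f' \<xi>) (axis j 1) $ i) = jac m \<xi>"
      by (simp add: vec_eq_iff eq[symmetric] matrix_vector_mult_basis column_def)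
  qed
qed

lemma jac_entry_continuous: "m < n \<Longrightarrow> continuous_on K (\<lambda>\<xi>. jac m \<xi> $ i $ j)"
  by (intro continuous_intros C1_jac)

lemma det_jac_continuous: "m < n \<Longrightarrow> continuous_on K (\<lambda>\<xi>. det (jac m \<xi>))"
  unfolding det_3 by (intro continuous_intros C1_jac)

lemma det_jac_pos: "m < n \<Longrightarrow> \<xi> \<in> K \<Longrightarrow> det (jac m \<xi>) > 0"
  using det_pos unfolding jac_def .

lemma Phi_continuous: "m < n \<Longrightarrow> continuous_on K (\<Phi> m)"
  by (rule has_derivative_continuous_on) (rule C1_jac)

lemma Phi_inj: "m < n \<Longrightarrow> inj_on (\<Phi> m) K"
  using diffeo by (simp add: diffeomorphism_on_def)

lemma Phi_eq_iff: "m < n \<Longrightarrow> \<xi> \<in> K \<Longrightarrow> \<eta> \<in> K \<Longrightarrow> \<Phi> m \<xi> = \<Phi> m \<eta> \<longleftrightarrow> \<xi> = \<eta>"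
  using Phi_inj by (auto dest: inj_onD)

definition inv_Phi :: "nat \<Rightarrow> real^3 \<Rightarrow> real^3" where
  "inv_Phi m = inv_into K (\<Phi> m)"

lemma inv_Phi_Phi [simp]: "m < n \<Longrightarrow> \<xi> \<in> K \<Longrightarrow> inv_Phi m (\<Phi> m \<xi>) = \<xi>"
  unfolding inv_Phi_def by (simp add: Phi_inj)

lemma Phi_inv_Phi: "x \<in> elem m \<Longrightarrow> \<Phi> m (inv_Phi m x) = x"
  unfolding inv_Phi_def elem_def by (rule f_inv_into_f)

lemma inv_Phi_in: "x \<in> elem m \<Longrightarrow> inv_Phi m x \<in> K"
  unfolding inv_Phi_def elem_def by (rule inv_into_into)

lemma compact_elem: "m < n \<Longrightarrow> compact (elem m)"
  unfolding elem_def by (rule compact_continuous_image[OF Phi_continuous compact_ref_cube])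

lemma inv_Phi_continuous: "m < n \<Longrightarrow> continuous_on (elem m) (inv_Phi m)"
  unfolding elem_def
  by (rule continuous_on_inv[OF Phi_continuous compact_ref_cube]) auto

text \<open>Chain rule for the identity \<open>inv_Phi m (\<Phi> m \<xi>) = \<xi>\<close>. It holds
  at boundary points too, where it will tell on which side of a facet the element lies.\<close>

lemma inv_Phi_derivative:
  assumes "m < n" "\<xi> \<in> K"
  shows "\<exists>B. (inv_Phi m has_derivative B) (at (\<Phi> m \<xi>) within elem m) \<and> (\<forall>h. B (jac m \<xi> *v h) = h)"
proof -
  have "C1_on (elem m) (inv_Phi m)"
    using diffeo[OF assms(1)] by (simp add: diffeomorphism_on_def elem_def inv_Phi_def)
  then obtain B where B: "(inv_Phi m has_derivative B) (at (\<Phi> m \<xi>) within elem m)"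
    unfolding C1_on_def elem_def using assms(2) by blast
  have "((\<lambda>\<eta>. inv_Phi m (\<Phi> m \<eta>)) has_derivative (\<lambda>h. B (jac m \<xi> *v h))) (at \<xi> within K)"
    by (rule has_derivative_in_compose[OF C1_jac(1)[OF assms] B[unfolded elem_def]])
  then have "((\<lambda>\<eta>. \<eta>) has_derivative (\<lambda>h. B (jac m \<xi> *v h))) (at \<xi> within K)"
    by (rule has_derivative_transform[OF assms(2), rotated]) (simp add: assms)
  then have "(\<lambda>h. B (jac m \<xi> *v h)) = (\<lambda>h. h)"
    by (rule ref_cube_derivative_unique[OF assms(2)]) (rule has_derivative_ident)
  then show ?thesis using B by metis
qed

lemma open_Phi_Ki: "m < n \<Longrightarrow> open (\<Phi> m ` Ki)"
  by (rule invariance_of_domain[OF continuous_on_subset[OF Phi_continuous interior_subset]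
    open_interior inj_on_subset[OF Phi_inj interior_subset]])

text \<open>Invariance of domain, applied to \<open>\<Phi> m\<close> on the open cube for one
  inclusion and to \<open>inv_Phi m\<close> on the interior of the element for the other.\<close>

lemma interior_elem:
  assumes "m < n" shows "interior (elem m) = \<Phi> m ` Ki"
proof
  show "\<Phi> m ` Ki \<subseteq> interior (elem m)"
    by (rule interior_maximal) (use open_Phi_Ki[OF assms] interior_subset in \<open>auto simp: elem_def\<close>)
  have "open (inv_Phi m ` interior (elem m))"
  proof (rule invariance_of_domain)
    show "continuous_on (interior (elem m)) (inv_Phi m)"
      by (rule continuous_on_subset[OF inv_Phi_continuous[OF assms] interior_subset])
    show "inj_on (inv_Phi m) (interior (elem m))"
      by (rule inj_on_inverseI[of _ "\<Phi> m"]) (use Phi_inv_Phi interior_subset in blast)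
  qed simp
  moreover have "inv_Phi m ` interior (elem m) \<subseteq> K"
    using interior_subset inv_Phi_in by blast
  ultimately have "inv_Phi m ` interior (elem m) \<subseteq> Ki" by (simp add: interior_maximal)
  note sub = this
  show "interior (elem m) \<subseteq> \<Phi> m ` Ki"
  proof
    fix x assume x: "x \<in> interior (elem m)"
    then have "x = \<Phi> m (inv_Phi m x)" using Phi_inv_Phi interior_subset by fastforce
    moreover have "inv_Phi m x \<in> Ki" using sub x by blast
    ultimately show "x \<in> \<Phi> m ` Ki" by (rule image_eqI)
  qed
qed

lemma closure_Phi_Ki:
  assumes "m < n" shows "elem m \<subseteq> closure (\<Phi> m ` Ki)"
  unfolding elem_def
  using image_closure_subset[of Ki "\<Phi> m" "closure (\<Phi> m ` Ki)"] Phi_continuous[OF assms]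
  by (simp add: ref_cube_closure_interior closure_subset)

text \<open>By conformity the common part of two elements is the image of a proper face of the cube,
  and proper faces avoid the interior.\<close>

lemma elem_Int:
  assumes "m < n" "m' < n" "m \<noteq> m'"
  shows "elem m \<inter> \<Phi> m' ` Ki = {}"
proof -
  obtain F \<sigma> where F: "F face_of K" "F \<noteq> K" "elem m' \<inter> elem m = \<Phi> m' ` F"
    using conforming[OF assms(2,1)] assms(3) unfolding elem_def by metis
  have "F \<inter> Ki = {}" using F by (simp add: face_of_disjoint_interior)
  show ?thesis
  proof safe
    fix \<xi> assume x: "\<Phi> m' \<xi> \<in> elem m" "\<xi> \<in> Ki"
    then have "\<Phi> m' \<xi> \<in> \<Phi> m' ` F" using F(3) Ki_subset unfolding elem_def by blast
    then have "\<xi> \<in> F"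
      using Phi_eq_iff[OF assms(2)] face_of_imp_subset[OF F(1)] Ki_subset[OF x(2)] by blast
    then show "\<Phi> m' \<xi> \<in> {}" using \<open>F \<inter> Ki = {}\<close> x by blast
  qed
qed

text \<open>\<open>cover\<close> places the open elements in the closure of \<Omega>. Being open
  they lie in the interior of this closure, which for a Lipschitz domain is contained in
  \<Omega>.\<close>

lemma Phi_Ki_subset_Omega:
  assumes "m < n" shows "\<Phi> m ` Ki \<subseteq> \<Omega>"
proof -
  have "\<Phi> m ` Ki \<subseteq> closure \<Omega>" using cover assms interior_subset by blast
  then have "\<Phi> m ` Ki \<subseteq> interior (closure \<Omega>)" by (rule interior_maximal[OF _ open_Phi_Ki[OF assms]])
  then show ?thesis using lipschitz_domain_interior_closure[OF domain(2)] by blast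
qed

lemma negligible_Phi_image:
  assumes "m < n" "S \<subseteq> K" "negligible S" shows "negligible (\<Phi> m ` S)"
proof (rule negligible_differentiable_image_negligible[OF _ assms(3)])
  show "\<Phi> m differentiable_on S"
    unfolding differentiable_on_def differentiable_def
    using has_derivative_subset[OF C1_jac(1)[OF assms(1)] assms(2)] assms(2) by blast
qed simp

lemma negligible_Omega_diff: "negligible (\<Omega> - (\<Union>m<n. \<Phi> m ` Ki))"
proof (rule negligible_subset)
  show "negligible (\<Union>m<n. \<Phi> m ` (K - Ki))"
    by (intro negligible_Union) (auto intro!: negligible_Phi_image negligible_ref_cube_boundary)
  show "\<Omega> - (\<Union>m<n. \<Phi> m ` Ki) \<subseteq> (\<Union>m<n. \<Phi> m ` (K - Ki))"
  proof
    fix x assume x: "x \<in> \<Omega> - (\<Union>m<n. \<Phi> m ` Ki)"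
    then have "x \<in> (\<Union>m<n. \<Phi> m ` K)" using closure_subset[of \<Omega>] unfolding cover[symmetric] by (rule_tac subsetD) auto
    then show "x \<in> (\<Union>m<n. \<Phi> m ` (K - Ki))" using x by auto
  qed
qed

text \<open>The values of \<open>f\<close> are prescribed at images of interior points of the cube.
  The rest of \<open>S\<close> is negligible and so is its image, so both integrals are restricted
  to the interior points; positivity of the determinant removes the absolute value.\<close>

lemma Phi_change_of_variables:
  fixes f :: "real^3 \<Rightarrow> real"
  assumes m: "m < n" and S: "S \<subseteq> K" "S \<in> sets lebesgue" and h: "continuous_on K h"
    and f: "\<And>\<xi>. \<xi> \<in> S \<inter> Ki \<Longrightarrow> f (\<Phi> m \<xi>) = h \<xi>"
  shows "f absolutely_integrable_on (\<Phi> m ` S)"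
    "integral (\<Phi> m ` S) f = integral S (\<lambda>\<xi>. det (jac m \<xi>) * h \<xi>)"
proof -
  let ?D = "\<lambda>\<xi>. \<bar>det (matrix ((*v) (jac m \<xi>)))\<bar> * f (\<Phi> m \<xi>)"
  let ?h = "\<lambda>\<xi>. det (jac m \<xi>) * h \<xi>"
  let ?S = "S \<inter> Ki"
  have D: "?D \<xi> = ?h \<xi>" if "\<xi> \<in> ?S" for \<xi>
    using that f[OF that] det_jac_pos[OF m, of \<xi>] S by (auto simp: matrix_of_matrix_vector_mul)
  have lS: "?S \<in> sets lebesgue" using S(2) by (intro sets.Int) (auto simp: borel_open)
  have "?h absolutely_integrable_on K" unfolding ref_cube_def
    by (rule absolutely_integrable_continuous, fold ref_cube_def)
      (intro continuous_intros h det_jac_continuous m)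
  then have hS: "?h absolutely_integrable_on ?S"
    by (rule set_integrable_subset) (use S lS in auto)
  have DS: "?D absolutely_integrable_on ?S"
    using hS by (rule absolutely_integrable_spike[OF _ negligible_empty]) (use D in auto)
  have der: "(\<Phi> m has_derivative (*v) (jac m \<xi>)) (at \<xi> within ?S)" if "\<xi> \<in> ?S" for \<xi>
    using C1_jac(1)[OF m] that S(1) by (blast intro: has_derivative_subset)
  have inj: "inj_on (\<Phi> m) ?S" using Phi_inj[OF m] S(1) by (meson inf_le1 inj_on_subset)
  note cov = change_of_variables_real[OF lS der inj DS]
  have neg: "negligible (S - ?S)"
    using negligible_ref_cube_boundary by (rule negligible_subset) (use S in auto)
  then have neg': "negligible (\<Phi> m ` (S - ?S))" using S by (intro negligible_Phi_image[OF m]) auto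
  have sub: "\<Phi> m ` S - \<Phi> m ` ?S \<subseteq> \<Phi> m ` (S - ?S)" "\<Phi> m ` ?S - \<Phi> m ` S = {}" by auto
  show "f absolutely_integrable_on (\<Phi> m ` S)"
  proof (rule absolutely_integrable_spike_set[OF cov(1)])
    show "negligible {x \<in> \<Phi> m ` S - \<Phi> m ` ?S. f x \<noteq> 0}"
      by (rule negligible_subset[OF neg']) (use sub in blast)
    have "{x \<in> \<Phi> m ` ?S - \<Phi> m ` S. f x \<noteq> 0} = {}" by auto
    then show "negligible {x \<in> \<Phi> m ` ?S - \<Phi> m ` S. f x \<noteq> 0}" by (simp only: negligible_empty)
  qed
  have "integral (\<Phi> m ` S) f = integral (\<Phi> m ` ?S) f"
    by (rule integral_spike_set; rule negligible_subset[OF neg']) (use sub in blast)+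
  also have "\<dots> = integral ?S ?D" by (rule cov(2))
  also have "\<dots> = integral ?S ?h" by (rule integral_cong) (use D in auto)
  also have "\<dots> = integral S ?h"
    by (rule integral_spike_set; rule negligible_subset[OF neg]) auto
  finally show "integral (\<Phi> m ` S) f = integral S ?h" .
qed

lemma sets_lebesgue_Ki: "Ki \<in> sets lebesgue"
  by (auto simp: borel_open)

lemma piecewise_integral:
  fixes f :: "real^3 \<Rightarrow> real"
  assumes h: "\<And>m. m < n \<Longrightarrow> continuous_on K (h m)"
    and f: "\<And>m \<xi>. m < n \<Longrightarrow> \<xi> \<in> Ki \<Longrightarrow> f (\<Phi> m \<xi>) = h m \<xi>"
  shows "f absolutely_integrable_on \<Omega>"
    "integral \<Omega> f = (\<Sum>m<n. integral K (\<lambda>\<xi>. det (jac m \<xi>) * h m \<xi>))"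
proof -
  let ?U = "\<Union>m<n. \<Phi> m ` Ki"
  have ai: "f absolutely_integrable_on (\<Phi> m ` Ki)"
    and int: "integral (\<Phi> m ` Ki) f = integral Ki (\<lambda>\<xi>. det (jac m \<xi>) * h m \<xi>)" if "m < n" for m
    using Phi_change_of_variables[OF that interior_subset sets_lebesgue_Ki h[OF that], of f] f[OF that] by auto
  have neg: "negligible (\<Omega> - ?U)" "?U - \<Omega> = {}"
    using negligible_Omega_diff Phi_Ki_subset_Omega by auto
  have "f absolutely_integrable_on ?U"
    by (rule set_integrable_UN) (auto intro!: ai simp: open_Phi_Ki borel_open)
  then show "f absolutely_integrable_on \<Omega>"
    by (rule absolutely_integrable_spike_set) (use neg in \<open>auto intro: negligible_subset\<close>)
  have "(f has_integral (\<Sum>m<n. integral (\<Phi> m ` Ki) f)) ?U"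
  proof (rule has_integral_UN)
    show "(f has_integral integral (\<Phi> m ` Ki) f) (\<Phi> m ` Ki)" if "m \<in> {..<n}" for m
      using ai that by (auto simp: absolutely_integrable_on_def integrable_integral)
    show "pairwise (\<lambda>m m'. negligible (\<Phi> m ` Ki \<inter> \<Phi> m' ` Ki)) {..<n}"
    proof (rule pairwiseI)
      fix m m' assume "m \<in> {..<n}" "m' \<in> {..<n}" "m \<noteq> m'"
      then have "\<Phi> m ` Ki \<inter> \<Phi> m' ` Ki = {}"
        using elem_Int[of m m'] interior_subset unfolding elem_def by blast
      then show "negligible (\<Phi> m ` Ki \<inter> \<Phi> m' ` Ki)" by simp
    qed
  qed simp
  then have "integral ?U f = (\<Sum>m<n. integral (\<Phi> m ` Ki) f)" by (rule integral_unique)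
  also have "\<dots> = (\<Sum>m<n. integral K (\<lambda>\<xi>. det (jac m \<xi>) * h m \<xi>))"
  proof (rule sum.cong[OF refl])
    fix m assume "m \<in> {..<n}"
    then have "integral (\<Phi> m ` Ki) f = integral Ki (\<lambda>\<xi>. det (jac m \<xi>) * h m \<xi>)" using int by simp
    also have "\<dots> = integral K (\<lambda>\<xi>. det (jac m \<xi>) * h m \<xi>)"
      by (rule integral_spike_set; rule negligible_subset[OF negligible_ref_cube_boundary])
        (use interior_subset[of K] in auto)
    finally show "integral (\<Phi> m ` Ki) f = integral K (\<lambda>\<xi>. det (jac m \<xi>) * h m \<xi>)" .
  qed
  finally have "integral ?U f = (\<Sum>m<n. integral K (\<lambda>\<xi>. det (jac m \<xi>) * h m \<xi>))" .
  moreover have "integral \<Omega> f = integral ?U f"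
    by (rule integral_spike_set; rule negligible_subset[OF neg(1)]) (use neg(2) in auto)
  ultimately show "integral \<Omega> f = (\<Sum>m<n. integral K (\<lambda>\<xi>. det (jac m \<xi>) * h m \<xi>))" by simp
qed

lemma piecewise_L2_on:
  fixes f :: "real^3 \<Rightarrow> 'b::euclidean_space"
  assumes h: "\<And>m. m < n \<Longrightarrow> continuous_on K (h m)"
    and f: "\<And>m \<xi>. m < n \<Longrightarrow> \<xi> \<in> Ki \<Longrightarrow> f (\<Phi> m \<xi>) = h m \<xi>"
  shows "L2_on \<Omega> f"
proof -
  have "(\<lambda>x. f x \<bullet> b) absolutely_integrable_on \<Omega>" for b
    by (rule piecewise_integral(1)[of "\<lambda>m \<xi>. h m \<xi> \<bullet> b"]) (auto intro!: continuous_intros h simp: f)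
  then have "f absolutely_integrable_on \<Omega>"
    by (rule absolutely_integrable_componentwise)
  then have "set_borel_measurable lebesgue \<Omega> f"
    unfolding set_borel_measurable_def set_integrable_def by (rule borel_measurable_integrable)
  moreover have "set_integrable lebesgue \<Omega> (\<lambda>x. (norm (f x))\<^sup>2)"
    by (rule piecewise_integral(1)[of "\<lambda>m \<xi>. (norm (h m \<xi>))\<^sup>2"]) (auto intro!: continuous_intros h simp: f)
  ultimately show ?thesis unfolding L2_on_def by blast
qed

end

section \<open>Shared facets\<close>

text \<open>Restriction to the segment leaves a function of one variable, whose derivative is unique
  even at the end of an interval. Thus \<open>x\<close> may be a boundary point of
  \<open>S\<close>.\<close>

lemma has_derivative_zero_direction:
  fixes f :: "'a::real_normed_vector \<Rightarrow> 'b::real_normed_vector"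
  assumes f: "(f has_derivative f') (at x within S)"
    and seg: "\<And>t. 0 \<le> t \<Longrightarrow> t \<le> 1 \<Longrightarrow> x + t *\<^sub>R w \<in> S \<and> f (x + t *\<^sub>R w) = 0"
  shows "f' w = 0"
proof -
  have lin: "linear f'" using f by (rule has_derivative_linear)
  let ?p = "\<lambda>t::real. x + t *\<^sub>R w"
  have p: "(?p has_derivative (\<lambda>t. t *\<^sub>R w)) (at 0 within {0..1})"
    by (auto intro!: derivative_eq_intros)
  have "(f has_derivative f') (at (?p 0) within ?p ` {0..1})"
    using f seg by (auto intro: has_derivative_subset)
  from has_derivative_in_compose[OF p this]
  have "((\<lambda>t. f (?p t)) has_vector_derivative f' w) (at 0 within cbox 0 1)"
    by (simp add: has_vector_derivative_def linear_scale[OF lin])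
  then have "((\<lambda>t. 0) has_vector_derivative f' w) (at 0 within cbox 0 (1::real))"
    by (rule has_vector_derivative_transform[rotated 2]) (use seg in auto)
  then show ?thesis
    by (rule vector_derivative_unique_within_closed_interval[rotated 2, OF _ has_vector_derivative_const]) auto
qed

lemma inner_matrix_cross3:
  fixes A :: "real^3^3"
  shows "(A *v v) \<bullet> cross3 (A *v a) (A *v b) = det A * (v \<bullet> cross3 a b)"
proof -
  have "(A *v v) \<bullet> y = v \<bullet> (transpose A *v y)" for y
    by (simp add: dot_lmul_matrix transpose_matrix_vector)
      (metis dot_lmul_matrix inner_commute transpose_matrix_vector transpose_transpose)
  then show ?thesis by (simp only: cross_matrix_mult inner_scaleR_right)
qed

lemma cross3_axis: "cross3 (axis (d + 1) 1) (axis (d + 2) 1) = axis d (1::real)"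
  using exhaust_3[of d] by (auto simp: cross3_def vec_eq_iff forall_3 axis_def vector_def)

context gll_mesh begin

definition facet_center :: "3 \<Rightarrow> real \<Rightarrow> real^3" where
  "facet_center d s = s *\<^sub>R axis d 1"

lemma ref_facet_mem: "\<xi> \<in> ref_facet d s \<longleftrightarrow> \<xi> \<in> K \<and> \<xi> $ d = s"
  by (auto simp: ref_facet_def)

lemma facet_center_mem: "s \<in> {-1, 1} \<Longrightarrow> facet_center d s \<in> ref_facet d s"
  by (auto simp: ref_facet_mem ref_cube_mem facet_center_def axis_def)

text \<open>Facet \<open>(d, s)\<close> of element \<open>m\<close> is facet \<open>(d', s')\<close>
  of element \<open>m'\<close>, and \<sigma> translates the reference coordinates. The condition on
  \<open>\<sigma> (axis d 1)\<close> says that the outward normal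
  \<open>s *\<^sub>R axis d 1\<close> goes to the outward normal
  \<open>s' *\<^sub>R axis d' 1\<close>.\<close>

definition glued ::
  "nat \<Rightarrow> 3 \<Rightarrow> real \<Rightarrow> nat \<Rightarrow> 3 \<Rightarrow> real \<Rightarrow> (real^3 \<Rightarrow> real^3) \<Rightarrow> bool" where
  "glued m d s m' d' s' \<sigma> \<longleftrightarrow> m < n \<and> m' < n \<and> m \<noteq> m' \<and> s \<in> {-1, 1} \<and> s' \<in> {-1, 1} \<and>
    orthogonal_transformation \<sigma> \<and> \<sigma> ` K = K \<and> \<sigma> (axis d 1) = (s * s') *\<^sub>R axis d' 1 \<and>
    (\<forall>\<xi>\<in>ref_facet d s. \<Phi> m' (\<sigma> \<xi>) = \<Phi> m \<xi>) \<and> elem m \<inter> elem m' = \<Phi> m ` ref_facet d s"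

text \<open>The midpoint of the facet centre and a point of the cube off the facet is interior to
  the cube. A proper face is convex and has no interior points of the cube, so it cannot contain
  both.\<close>

lemma proper_face_through_center:
  assumes F: "F face_of K" "F \<noteq> K" and s: "s \<in> {-1, 1}" and c: "facet_center d s \<in> F"
  shows "F \<subseteq> ref_facet d s"
proof
  fix y assume y: "y \<in> F"
  then have yK: "y \<in> K" using face_of_imp_subset[OF F(1)] by blast
  have "convex F" using F(1) by (rule face_of_imp_convex[OF _]) 
  then have mid: "(1/2) *\<^sub>R y + (1/2) *\<^sub>R facet_center d s \<in> F"
    using y c by (intro convexD) auto
  have "F \<inter> Ki = {}" using F by (simp add: face_of_disjoint_interior)
  show "y \<in> ref_facet d s"
  proof (rule ccontr)
    assume "y \<notin> ref_facet d s"
    then have ne: "y $ d \<noteq> s" using yK by (simp add: ref_facet_mem)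
    have "\<bar>((1/2) *\<^sub>R y + (1/2) *\<^sub>R facet_center d s) $ i\<bar> < 1" for i
    proof -
      have "\<bar>y $ i\<bar> \<le> 1" using yK by (simp add: ref_cube_mem)
      then show ?thesis using ne s by (cases "i = d") (auto simp: facet_center_def axis_def abs_if split: if_splits)
    qed
    then have "(1/2) *\<^sub>R y + (1/2) *\<^sub>R facet_center d s \<in> Ki" by (subst ref_cube_mem_interior) blast
    then show False using mid \<open>F \<inter> Ki = {}\<close> by blast
  qed
qed

text \<open>The image of an axis vector is again a boundary point of the cube, so one of its
  coordinates has modulus 1; since its norm is 1, the other two vanish.\<close>

lemma cube_symmetry_axis:
  assumes "orthogonal_transformation \<sigma>" "\<sigma> ` K = K"
  shows "\<exists>d' s'. s' \<in> {-1, 1::real} \<and> \<sigma> (axis d 1) = s' *\<^sub>R axis d' 1"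
proof -
  let ?v = "\<sigma> (axis d 1)"
  have lin: "linear \<sigma>" and inj: "inj \<sigma>"
    using assms(1) orthogonal_transformation_inj by (auto simp: orthogonal_transformation_def)
  have Ki: "\<sigma> ` Ki = Ki" using interior_injective_linear_image[OF lin inj, of K] assms(2) by simp
  have aK: "axis d 1 \<in> K" "axis d (1::real) \<notin> Ki"
    by (auto simp: ref_cube_mem ref_cube_mem_interior axis_def)
  have "?v \<in> K" using imageI[OF aK(1), of \<sigma>] unfolding assms(2) .
  moreover have "?v \<notin> Ki"
    using aK(2) inj_image_mem_iff[OF inj, of "axis d 1" Ki] unfolding Ki by simp
  ultimately obtain d' where d': "\<bar>?v $ d'\<bar> = 1"
    unfolding ref_cube_mem ref_cube_mem_interior by (metis less_eq_real_def)
  have "norm ?v = 1" using assms(1) by (simp add: orthogonal_transformation)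
  then have "(\<Sum>i\<in>UNIV. (?v $ i)\<^sup>2) = 1" by (simp add: norm_vec_def L2_set_def)
  then have "(\<Sum>i\<in>{d', d' + 1, d' + 2}. (?v $ i)\<^sup>2) = 1" by (simp only: UNIV_three[of d', symmetric])
  moreover have "(?v $ d')\<^sup>2 = 1" using d' by (simp add: power2_eq_1_iff abs_if split: if_splits)
  ultimately have "(?v $ (d' + 1))\<^sup>2 + (?v $ (d' + 2))\<^sup>2 = 0" by simp
  then have "?v $ (d' + 1) = 0" "?v $ (d' + 2) = 0" by (simp_all add: sum_power2_eq_zero_iff)
  then have "?v = (?v $ d') *\<^sub>R axis d' 1"
    by (simp add: vec_eq_iff all_three[of _ d'] axis_def)
  moreover have "?v $ d' \<in> {-1, 1}" using d' by auto
  ultimately show ?thesis by blast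
qed

text \<open>Conformity yields some proper face of the cube as the common part. It contains the
  facet, and a proper face through the facet centre is not larger than the facet.\<close>

lemma glued_exists:
  assumes "m < n" "m' < n" "m \<noteq> m'" "s \<in> {-1, 1}" "\<Phi> m ` ref_facet d s \<subseteq> elem m'"
  shows "\<exists>d' s' \<sigma>. glued m d s m' d' s' \<sigma>"
proof -
  obtain F \<sigma> where F: "F face_of K" "F \<noteq> K" "elem m \<inter> elem m' = \<Phi> m ` F"
    and \<sigma>: "orthogonal_transformation \<sigma>" "\<sigma> ` K = K" "\<And>\<xi>. \<xi> \<in> F \<Longrightarrow> \<Phi> m' (\<sigma> \<xi>) = \<Phi> m \<xi>"
    using conforming[OF assms(1-3)] unfolding elem_def by metis
  have sub: "ref_facet d s \<subseteq> F"
  proof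
    fix \<xi> assume x: "\<xi> \<in> ref_facet d s"
    then have "\<Phi> m \<xi> \<in> elem m'" using assms(5) imageI[OF x, of "\<Phi> m"] by (rule_tac subsetD)
    moreover have "\<Phi> m \<xi> \<in> elem m" using x unfolding elem_def ref_facet_mem by (intro imageI) simp
    ultimately have "\<Phi> m \<xi> \<in> elem m \<inter> elem m'" by (rule IntI[rotated])
    then obtain \<eta> where "\<eta> \<in> F" "\<Phi> m \<xi> = \<Phi> m \<eta>" unfolding F(3) by blast
    then show "\<xi> \<in> F"
      using x Phi_eq_iff[OF assms(1), of \<xi> \<eta>] face_of_imp_subset[OF F(1)] by (auto simp: ref_facet_mem)
  qed
  then have "facet_center d s \<in> F" using facet_center_mem[OF assms(4)] by blast
  then have FF: "F = ref_facet d s" using proper_face_through_center[OF F(1,2) assms(4)] sub by blast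
  obtain d' t where t: "t \<in> {-1, 1}" "\<sigma> (axis d 1) = t *\<^sub>R axis d' 1"
    using cube_symmetry_axis[OF \<sigma>(1,2)] by blast
  have "s * t \<in> {-1, 1}" "s * (s * t) = t" using t(1) assms(4) by auto
  then have "glued m d s m' d' (s * t) \<sigma>"
    unfolding glued_def using assms(1-4) \<sigma>(1,2) \<sigma>(3)[unfolded FF] F(3)[unfolded FF] t(2) by simp
  then show ?thesis by blast
qed

lemma glued_linear: "glued m d s m' d' s' \<sigma> \<Longrightarrow> linear \<sigma>"
  by (simp add: glued_def orthogonal_transformation_def)

lemma glued_sq: "glued m d s m' d' s' \<sigma> \<Longrightarrow> s * s = 1 \<and> s' * s' = 1"
  by (auto simp: glued_def)

lemma glued_nth:
  assumes "glued m d s m' d' s' \<sigma>" shows "\<sigma> x $ d' = s * s' * x $ d"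
proof -
  have "\<sigma> x \<bullet> \<sigma> (axis d 1) = x \<bullet> axis d 1"
    using assms unfolding glued_def orthogonal_transformation_def by blast
  then have "s * s' * \<sigma> x $ d' = x $ d" using assms by (simp add: glued_def inner_axis)
  moreover have "s = 1 \<or> s = -1" "s' = 1 \<or> s' = -1" using assms by (auto simp: glued_def)
  ultimately show ?thesis by (elim disjE) simp_all
qed

lemma glued_in_cube:
  assumes "glued m d s m' d' s' \<sigma>" shows "\<sigma> \<xi> \<in> K \<longleftrightarrow> \<xi> \<in> K"
proof -
  have "inj \<sigma>" using assms orthogonal_transformation_inj by (auto simp: glued_def)
  moreover have "\<sigma> ` K = K" using assms by (simp add: glued_def)
  ultimately show ?thesis by (metis inj_image_mem_iff)
qed

lemma glued_in_facet:
  assumes "glued m d s m' d' s' \<sigma>" shows "\<sigma> \<xi> \<in> ref_facet d' s' \<longleftrightarrow> \<xi> \<in> ref_facet d s"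
proof -
  have "s * s' * \<xi> $ d = s' \<longleftrightarrow> \<xi> $ d = s" using assms by (auto simp: glued_def)
  then show ?thesis unfolding ref_facet_mem glued_in_cube[OF assms] glued_nth[OF assms] by simp
qed

lemma glued_facet_image:
  assumes "glued m d s m' d' s' \<sigma>" shows "\<sigma> ` ref_facet d s = ref_facet d' s'"
proof
  have surj: "surj \<sigma>" using assms orthogonal_transformation_surj by (auto simp: glued_def)
  show "ref_facet d' s' \<subseteq> \<sigma> ` ref_facet d s"
  proof
    fix y assume y: "y \<in> ref_facet d' s'"
    obtain x where x: "y = \<sigma> x" using surj by (metis surjD)
    then show "y \<in> \<sigma> ` ref_facet d s" using y glued_in_facet[OF assms, of x] by simp
  qed
qed (use glued_in_facet[OF assms] in auto)

lemma glued_Phi: "glued m d s m' d' s' \<sigma> \<Longrightarrow> \<xi> \<in> ref_facet d s \<Longrightarrow> \<Phi> m' (\<sigma> \<xi>) = \<Phi> m \<xi>"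
  by (simp add: glued_def)

lemma glued_image_eq:
  assumes "glued m d s m' d' s' \<sigma>" shows "\<Phi> m' ` ref_facet d' s' = \<Phi> m ` ref_facet d s"
  unfolding glued_facet_image[OF assms, symmetric] image_image
  by (rule image_cong[OF refl]) (rule glued_Phi[OF assms])

text \<open>\<open>\<Phi> m\<close> and \<open>\<Phi> m'\<close> after \<sigma> agree on the facet,
  hence have the same derivatives in directions along it. In the transversal direction
  \<open>d\<close> nothing is claimed.\<close>

lemma glued_tangent:
  assumes g: "glued m d s m' d' s' \<sigma>" and \<xi>: "\<xi> \<in> ref_facet d s" and i: "i \<noteq> d"
  shows "jac m \<xi> *v axis i 1 = jac m' (\<sigma> \<xi>) *v \<sigma> (axis i 1)"
proof -
  have m: "m < n" "m' < n" "s \<in> {-1, 1}" using g by (auto simp: glued_def)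
  have \<xi>K: "\<xi> \<in> K" "\<sigma> \<xi> \<in> K" using \<xi> by (auto simp: ref_facet_mem glued_in_cube[OF g])
  have \<sigma>K: "\<sigma> ` K = K" using g by (simp add: glued_def)
  have lin: "linear \<sigma>" by (rule glued_linear[OF g])
  have "((\<lambda>\<eta>. \<Phi> m' (\<sigma> \<eta>)) has_derivative (\<lambda>h. jac m' (\<sigma> \<xi>) *v \<sigma> h)) (at \<xi> within K)"
  proof (rule has_derivative_in_compose[OF linear_imp_has_derivative[OF lin]])
    show "(\<Phi> m' has_derivative (*v) (jac m' (\<sigma> \<xi>))) (at (\<sigma> \<xi>) within \<sigma> ` K)"
      unfolding \<sigma>K by (rule C1_jac(1)[OF m(2) \<xi>K(2)])
  qed
  from has_derivative_diff[OF C1_jac(1)[OF m(1) \<xi>K(1)] this]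
  have D: "((\<lambda>\<eta>. \<Phi> m \<eta> - \<Phi> m' (\<sigma> \<eta>)) has_derivative (\<lambda>h. jac m \<xi> *v h - jac m' (\<sigma> \<xi>) *v \<sigma> h)) (at \<xi> within K)" .
  \<comment> \<open>The sign for which a segment of unit length along axis \<open>i\<close> stays in
    the facet, also when \<xi> lies on an edge.\<close>
  define r :: real where "r = (if \<xi> $ i \<le> 0 then 1 else -1)"
  have r: "r \<noteq> 0" by (simp add: r_def)
  have "(\<lambda>h. jac m \<xi> *v h - jac m' (\<sigma> \<xi>) *v \<sigma> h) (r *\<^sub>R axis i 1) = 0"
  proof (rule has_derivative_zero_direction[OF D])
    fix t :: real assume t: "0 \<le> t" "t \<le> 1"
    have "\<xi> + t *\<^sub>R r *\<^sub>R axis i 1 \<in> ref_facet d s"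
      unfolding ref_facet_mem ref_cube_mem
    proof (intro conjI allI)
      fix j
      have "\<bar>\<xi> $ j\<bar> \<le> 1" using \<xi>K by (simp add: ref_cube_mem)
      then show "\<bar>(\<xi> + t *\<^sub>R r *\<^sub>R axis i 1) $ j\<bar> \<le> 1" using t by (auto simp: axis_def r_def)
    qed (use \<xi> i in \<open>auto simp: ref_facet_mem axis_def\<close>)
    then show "\<xi> + t *\<^sub>R r *\<^sub>R axis i 1 \<in> K \<and>
        \<Phi> m (\<xi> + t *\<^sub>R r *\<^sub>R axis i 1) - \<Phi> m' (\<sigma> (\<xi> + t *\<^sub>R r *\<^sub>R axis i 1)) = 0"
      using glued_Phi[OF g] by (simp add: ref_facet_mem)
  qed
  then have "r *\<^sub>R (jac m \<xi> *v axis i 1 - jac m' (\<sigma> \<xi>) *v \<sigma> (axis i 1)) = 0"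
    by (simp add: linear_scale[OF lin] matrix_vector_mult_scaleR scaleR_diff_right)
  then show ?thesis using r by simp
qed

lemma area_vector_eq:
  "area_vector m d \<xi> = cross3 (jac m \<xi> *v axis (d + 1) 1) (jac m \<xi> *v axis (d + 2) 1)"
  by (simp add: area_vector_def matrix_vector_mult_basis)

text \<open>The area vector is a column of the cofactor matrix of the Jacobian. This is why the
  Piola transform preserves fluxes: after division by the determinant, the product with the area
  vector is the reference component.\<close>

lemma inner_area_vector: "(jac m \<xi> *v v) \<bullet> area_vector m d \<xi> = det (jac m \<xi>) * v $ d"
  unfolding area_vector_eq inner_matrix_cross3 cross3_axis by (simp add: inner_axis)

lemma glued_area_vector_eq:
  assumes g: "glued m d s m' d' s' \<sigma>" and \<xi>: "\<xi> \<in> ref_facet d s"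
  shows "area_vector m d \<xi> =
    cross3 (jac m' (\<sigma> \<xi>) *v \<sigma> (axis (d + 1) 1)) (jac m' (\<sigma> \<xi>) *v \<sigma> (axis (d + 2) 1))"
  unfolding area_vector_eq by (simp add: glued_tangent[OF g \<xi>])

text \<open>The area vector involves tangential derivatives only, so it can be computed from the
  neighbouring element. The cross product of vectors transformed by \<sigma> brings in
  \<open>det (matrix \<sigma>)\<close>, whose sign is settled in \<open>glued_det\<close>.\<close>

lemma glued_inner_area_vector:
  assumes g: "glued m d s m' d' s' \<sigma>" and \<xi>: "\<xi> \<in> ref_facet d s"
  shows "(jac m' (\<sigma> \<xi>) *v v) \<bullet> area_vector m d \<xi> =
    det (jac m' (\<sigma> \<xi>)) * (det (matrix \<sigma>) * (s * s' * v $ d'))"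
proof -
  have o: "orthogonal_transformation \<sigma>" using g by (simp add: glued_def)
  have "v \<bullet> cross3 (\<sigma> (axis (d + 1) 1)) (\<sigma> (axis (d + 2) 1)) = det (matrix \<sigma>) * (s * s' * v $ d')"
    unfolding cross_orthogonal_transformation[OF o] cross3_axis using g
    by (simp add: glued_def inner_axis)
  then show ?thesis unfolding glued_area_vector_eq[OF g \<xi>] inner_matrix_cross3 by simp
qed

text \<open>The hypotheses say that \<open>w\<close> is normal to the facet and points outwards: in
  reference coordinates it has a positive component \<kappa> along the outward normal of the cube.
  To first order, a short step along \<open>w\<close> therefore leaves the cube.\<close>

lemma elem_avoids_outer_direction:
  assumes m: "m < n" and s: "s \<in> {-1, 1}" and w: "w \<noteq> 0"
    and w0: "\<And>v. (jac m (facet_center d s) *v v) \<bullet> w = c * v $ d" and c: "c * s > 0"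
  shows "\<exists>\<delta>>0. \<forall>t. 0 < t \<longrightarrow> t < \<delta> \<longrightarrow> \<Phi> m (facet_center d s) + t *\<^sub>R w \<notin> elem m"
proof -
  let ?c = "facet_center d s" let ?A = "jac m ?c"
  have cK: "?c \<in> K" using facet_center_mem[OF s] by (simp add: ref_facet_mem)
  obtain B where B: "(inv_Phi m has_derivative B) (at (\<Phi> m ?c) within elem m)" "\<And>h. B (?A *v h) = h"
    using inv_Phi_derivative[OF m cK] by blast
  have "invertible ?A" using det_jac_pos[OF m cK] by (simp add: invertible_det_nz)
  then obtain A' where "?A ** A' = mat 1" unfolding invertible_def by blast
  then have Aw: "?A *v (A' *v w) = w" by (simp add: matrix_vector_mul_assoc)
  then have Bw: "B w = A' *v w" using B(2)[of "A' *v w"] by simp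
  define \<kappa> where "\<kappa> = s * B w $ d"
  have "w \<bullet> w = c * B w $ d" using w0[of "A' *v w"] unfolding Aw Bw .
  then have "w \<bullet> w = (c * s) * \<kappa>" using s by (auto simp: \<kappa>_def)
  moreover have "w \<bullet> w > 0" using w by simp
  ultimately have \<kappa>: "\<kappa> > 0" using c by (metis zero_less_mult_pos)
  \<comment> \<open>With this tolerance the linearization error of a step
    \<open>t *\<^sub>R w\<close> is at most \<open>t * \<kappa> / 2\<close>, half of the outward
    displacement \<open>t * \<kappa>\<close>.\<close>
  define e where "e = \<kappa> / (2 * norm w)"
  have "e > 0" using \<kappa> w by (simp add: e_def)
  then obtain \<delta> where \<delta>: "\<delta> > 0" and approx: "\<And>y. y \<in> elem m \<Longrightarrow> norm (y - \<Phi> m ?c) < \<delta> \<Longrightarrow>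
     norm (inv_Phi m y - inv_Phi m (\<Phi> m ?c) - B (y - \<Phi> m ?c)) \<le> e * norm (y - \<Phi> m ?c)"
    using B(1) unfolding has_derivative_within_alt by blast
  have lin: "linear B" using B(1) by (rule has_derivative_linear)
  show ?thesis
  proof (intro exI[of _ "\<delta> / norm w"] conjI allI impI notI)
    show "\<delta> / norm w > 0" using \<delta> w by simp
    fix t assume t: "0 < t" "t < \<delta> / norm w" and y: "\<Phi> m ?c + t *\<^sub>R w \<in> elem m"
    let ?z = "inv_Phi m (\<Phi> m ?c + t *\<^sub>R w)"
    have "norm (?z - ?c - t *\<^sub>R B w) \<le> e * norm (t *\<^sub>R w)"
      using approx[OF y] t w by (simp add: inv_Phi_Phi[OF m cK] linear_scale[OF lin] field_simps)
    also have "\<dots> = t * \<kappa> / 2" using t w by (simp add: e_def)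
    finally have "\<bar>(?z - ?c - t *\<^sub>R B w) $ d\<bar> \<le> t * \<kappa> / 2"
      using component_le_norm_cart[of "?z - ?c - t *\<^sub>R B w" d] by linarith
    then have "\<bar>s * (?z $ d - s - t * B w $ d)\<bar> \<le> t * \<kappa> / 2"
      using s by (auto simp: facet_center_def axis_def abs_mult)
    moreover have "s * (?z $ d - s - t * B w $ d) = s * ?z $ d - 1 - t * \<kappa>"
      using s by (auto simp: \<kappa>_def algebra_simps)
    moreover have "t * \<kappa> > 0" using t \<kappa> by simp
    ultimately have "s * ?z $ d > 1" by linarith
    moreover have "\<bar>?z $ d\<bar> \<le> 1" using inv_Phi_in[OF y] by (simp add: ref_cube_mem)
    ultimately show False using s by auto
  qed
qed

text \<open>Unfolding the second cube by reflection in the facet turns both elements into the image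
  of one open box under a continuous injective map, and such an image is open by invariance of
  domain.\<close>

lemma glued_local_nbhd:
  assumes g: "glued m d s m' d' s' \<sigma>" and \<xi>: "\<xi> \<in> ref_facet d s" "\<And>i. i \<noteq> d \<Longrightarrow> \<bar>\<xi> $ i\<bar> < 1"
  shows "\<exists>U. open U \<and> \<Phi> m \<xi> \<in> U \<and> U \<subseteq> elem m \<union> elem m'"
proof -
  have m: "m < n" "m' < n" "s \<in> {-1, 1}" using g by (auto simp: glued_def)
  have lin: "linear \<sigma>" by (rule glued_linear[OF g])
  have s2: "s * s = 1" using m(3) by auto
  have int: "elem m \<inter> elem m' = \<Phi> m ` ref_facet d s" using g by (simp add: glued_def)
  \<comment> \<open>\<rho> reflects in the plane of the facet. In the double box \<open>W\<close>
    the variable \<open>s * x $ d\<close> runs from -1 to 3: the first cube occupies the part up to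
    1, the mirror image of the second one the part from 1 on.\<close>
  define \<rho> where "\<rho> x = upd x d (2 * s - x $ d)" for x
  define W where "W = {x. \<forall>i. if i = d then -1 < s * x $ i \<and> s * x $ i < 3 else \<bar>x $ i\<bar> < (1::real)}"
  define L where "L = W \<inter> {x. s * x $ d \<le> 1}"
  define R where "R = W \<inter> {x. s * x $ d \<ge> 1}"
  define G where "G x = (if s * x $ d \<le> 1 then \<Phi> m x else \<Phi> m' (\<sigma> (\<rho> x)))" for x
  have cont\<rho>: "continuous_on S \<rho>" for S unfolding \<rho>_def by (intro continuous_intros)
  have LK: "x \<in> K" if "x \<in> L" for x
    unfolding ref_cube_mem
  proof
    fix i show "\<bar>x $ i\<bar> \<le> 1"
      using that m(3) unfolding L_def W_def by (cases "i = d") (auto dest: spec[of _ i] less_imp_le)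
  qed
  have s\<rho>: "s * \<rho> x $ d = 2 - s * x $ d" for x using s2 by (simp add: \<rho>_def algebra_simps)
  have RK: "\<rho> x \<in> K" if "x \<in> R" for x
    unfolding ref_cube_mem
  proof
    fix i show "\<bar>\<rho> x $ i\<bar> \<le> 1"
    proof (cases "i = d")
      case True
      then show ?thesis using that m(3) s\<rho>[of x] unfolding R_def W_def by (auto dest: spec[of _ d])
    next
      case False
      then show ?thesis using that unfolding R_def W_def \<rho>_def by (auto dest: spec[of _ i])
    qed
  qed
  have on_facet: "\<rho> x = x \<and> x \<in> ref_facet d s" if "x \<in> L" "s * x $ d = 1" for x
  proof -
    have "x $ d = s" using that(2) m(3) by auto
    then show ?thesis using LK[OF that(1)] by (auto simp: \<rho>_def ref_facet_mem vec_eq_iff)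
  qed
  have Weq: "W = L \<union> R" by (auto simp: L_def R_def)
  have GR: "G x = \<Phi> m' (\<sigma> (\<rho> x))" if "x \<in> R" for x
  proof (cases "s * x $ d = 1")
    case True
    then have "x \<in> L" using that by (auto simp: L_def R_def)
    then show ?thesis using on_facet[OF _ True] glued_Phi[OF g, of x] True by (simp add: G_def)
  qed (use that in \<open>auto simp: G_def R_def\<close>)
  have GL: "G x = \<Phi> m x" if "x \<in> L" for x using that by (simp add: G_def L_def)
  have "open W"
  proof -
    have "W = (\<Inter>i\<in>UNIV. {x. if i = d then -1 < s * x $ i \<and> s * x $ i < 3 else \<bar>x $ i\<bar> < (1::real)})"
      by (auto simp: W_def)
    moreover have op: "open {x. if i = d then -1 < s * x $ i \<and> s * x $ i < 3 else \<bar>x $ i\<bar> < (1::real)}" for i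
      by (cases "i = d") (auto intro!: open_Collect_conj open_Collect_less continuous_intros)
    have "open (\<Inter>i\<in>UNIV. {x. if i = d then -1 < s * x $ i \<and> s * x $ i < 3 else \<bar>x $ i\<bar> < (1::real)})"
      by (rule open_INT[OF finite ballI]) (rule op)
    ultimately show ?thesis by (simp only:)
  qed
  moreover have "continuous_on W G"
    unfolding Weq
  proof (rule continuous_on_Un_local)
    have "closedin (top_of_set W) L" unfolding L_def
      by (intro closedin_closed_Int closed_Collect_le continuous_intros)
    then show "closedin (top_of_set (L \<union> R)) L" by (simp only: Weq[symmetric])
    have "closedin (top_of_set W) R" unfolding R_def
      by (intro closedin_closed_Int closed_Collect_le continuous_intros)
    then show "closedin (top_of_set (L \<union> R)) R" by (simp only: Weq[symmetric])
    show "continuous_on L G"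
      by (rule continuous_on_eq[OF continuous_on_subset[OF Phi_continuous[OF m(1)]]]) (use LK GL in auto)
    have "continuous_on R (\<lambda>x. \<Phi> m' (\<sigma> (\<rho> x)))"
    proof (rule continuous_on_compose2[OF Phi_continuous[OF m(2)]])
      show "continuous_on R (\<lambda>x. \<sigma> (\<rho> x))"
        by (rule linear_continuous_on_compose[OF cont\<rho> lin])
    qed (use RK glued_in_cube[OF g] in auto)
    then show "continuous_on R G" by (rule continuous_on_eq) (simp add: GR)
  qed
  moreover have "inj_on G W"
  proof -
    \<comment> \<open>A value common to both halves lies in both elements, hence on the shared
      facet; so \<open>\<rho> y\<close> is on the facet, which forces
      \<open>s * y $ d = 1\<close>.\<close>
    have mixed: False if x: "x \<in> L" and y: "y \<in> R" "s * y $ d > 1" and eq: "\<Phi> m x = \<Phi> m' (\<sigma> (\<rho> y))" for x y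
    proof -
      have yK: "\<sigma> (\<rho> y) \<in> K" using RK[OF y(1)] by (simp add: glued_in_cube[OF g])
      then have "\<Phi> m' (\<sigma> (\<rho> y)) \<in> elem m \<inter> elem m'"
        using eq LK[OF x] unfolding elem_def by (metis IntI imageI)
      then obtain \<zeta> where \<zeta>: "\<zeta> \<in> ref_facet d s" "\<Phi> m' (\<sigma> (\<rho> y)) = \<Phi> m \<zeta>" unfolding int by blast
      then have "\<Phi> m' (\<sigma> (\<rho> y)) = \<Phi> m' (\<sigma> \<zeta>)" using glued_Phi[OF g] by simp
      then have "\<sigma> (\<rho> y) = \<sigma> \<zeta>"
        using Phi_eq_iff[OF m(2) yK, of "\<sigma> \<zeta>"] \<zeta>(1) glued_in_cube[OF g, of \<zeta>]
        by (simp add: ref_facet_mem)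
      then have "\<rho> y \<in> ref_facet d s" using \<zeta>(1) glued_in_facet[OF g] by metis
      then have "s * \<rho> y $ d = 1" using s2 by (simp add: ref_facet_mem)
      then show False using s\<rho>[of y] y(2) by simp
    qed
    have \<sigma>inj: "inj \<sigma>" using g orthogonal_transformation_inj by (auto simp: glued_def)
    have \<rho>\<rho>: "\<rho> (\<rho> x) = x" for x by (simp add: \<rho>_def vec_eq_iff)
    show ?thesis
    proof (rule inj_onI)
      fix x y assume xy: "x \<in> W" "y \<in> W" "G x = G y"
      consider "s * x $ d \<le> 1" "s * y $ d \<le> 1" | "s * x $ d \<le> 1" "s * y $ d > 1"
        | "s * x $ d > 1" "s * y $ d \<le> 1" | "s * x $ d > 1" "s * y $ d > 1" by linarith
      then show "x = y"
      proof cases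
        case 1
        then have "x \<in> L" "y \<in> L" using xy by (auto simp: L_def)
        then show ?thesis using xy(3) GL LK Phi_eq_iff[OF m(1)] by simp
      next
        case 2
        then have "x \<in> L" "y \<in> R" using xy by (auto simp: L_def R_def)
        then show ?thesis using mixed[of x y] xy(3) GL GR 2 by simp
      next
        case 3
        then have "y \<in> L" "x \<in> R" using xy by (auto simp: L_def R_def)
        then show ?thesis using mixed[of y x] xy(3) GL GR 3 by simp
      next
        case 4
        then have R: "x \<in> R" "y \<in> R" using xy by (auto simp: R_def)
        then have "\<sigma> (\<rho> x) = \<sigma> (\<rho> y)"
          using xy(3) GR RK Phi_eq_iff[OF m(2)] glued_in_cube[OF g] by simp
        then have "\<rho> (\<rho> x) = \<rho> (\<rho> y)" using \<sigma>inj by (simp add: inj_eq)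
        then show ?thesis unfolding \<rho>\<rho> .
      qed
    qed
  qed
  ultimately have "open (G ` W)" using invariance_of_domain by blast
  moreover have "\<Phi> m \<xi> \<in> G ` W"
  proof -
    have "s * \<xi> $ d = 1" using \<xi>(1) s2 by (simp add: ref_facet_mem)
    then have "\<xi> \<in> L" using \<xi>(2) by (auto simp: L_def W_def)
    then show ?thesis using GL Weq by (metis UnI1 imageI)
  qed
  moreover have "G ` W \<subseteq> elem m \<union> elem m'"
    unfolding Weq elem_def using GL GR LK RK glued_in_cube[OF g] by (auto intro!: imageI)
  ultimately show ?thesis by blast
qed

text \<open>The two elements lie on opposite sides of the common facet while both Jacobian determinants
  are positive, so the transition map reverses the orientation.\<close>
lemma glued_det:
  assumes g: "glued m d s m' d' s' \<sigma>"
  shows "det (matrix \<sigma>) = -1"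
proof (rule ccontr)
  assume "det (matrix \<sigma>) \<noteq> -1"
  moreover have o: "orthogonal_transformation \<sigma>" using g by (simp add: glued_def)
  ultimately have det: "det (matrix \<sigma>) = 1" using orthogonal_transformation_det[OF o] by linarith
  have m: "m < n" "m' < n" "s \<in> {-1, 1}" "s' \<in> {-1, 1}" using g by (auto simp: glued_def)
  let ?c = "facet_center d s" let ?c' = "facet_center d' s'"
  have c: "?c \<in> ref_facet d s" using facet_center_mem[OF m(3)] .
  have "\<sigma> ?c = s *\<^sub>R \<sigma> (axis d 1)" unfolding facet_center_def by (rule linear_scale[OF glued_linear[OF g]])
  also have "\<dots> = ?c'" using g m(3) by (auto simp: glued_def facet_center_def)
  finally have \<sigma>c: "\<sigma> ?c = ?c'" .
  have cK: "?c \<in> K" "?c' \<in> K" using facet_center_mem m by (auto simp: ref_facet_mem)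
  \<comment> \<open>An outward normal of element \<open>m\<close> at the facet centre. With
    determinant 1 it would also point out of element \<open>m'\<close>, and points just beyond the
    centre would belong to neither element, although the two elements cover a neighbourhood.\<close>
  define w where "w = s *\<^sub>R area_vector m d ?c"
  have w1: "(jac m ?c *v v) \<bullet> w = (s * det (jac m ?c)) * v $ d" for v
    by (simp add: w_def inner_area_vector)
  have w2: "(jac m' ?c' *v v) \<bullet> w = (s' * det (jac m' ?c')) * v $ d'" for v
    using glued_inner_area_vector[OF g c, of v] m(3) unfolding \<sigma>c det by (auto simp: w_def)
  have s2: "s * s = 1" "s' * s' = 1" using glued_sq[OF g] by auto
  have pos: "s * det (jac m ?c) * s > 0" "s' * det (jac m' ?c') * s' > 0"
    using det_jac_pos[OF m(1) cK(1)] det_jac_pos[OF m(2) cK(2)] m(3,4) by auto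
  have "w \<noteq> 0"
  proof
    assume "w = 0"
    then show False using w1[of "axis d 1"] pos(1) by (auto simp: axis_def)
  qed
  note out = elem_avoids_outer_direction[OF m(1) m(3) this w1 pos(1)]
    elem_avoids_outer_direction[OF m(2) m(4) this w2 pos(2)]
  obtain \<delta>1 where d1: "\<delta>1 > 0" "\<And>t. 0 < t \<Longrightarrow> t < \<delta>1 \<Longrightarrow> \<Phi> m ?c + t *\<^sub>R w \<notin> elem m"
    using out(1) by blast
  obtain \<delta>2 where d2: "\<delta>2 > 0" "\<And>t. 0 < t \<Longrightarrow> t < \<delta>2 \<Longrightarrow> \<Phi> m' ?c' + t *\<^sub>R w \<notin> elem m'"
    using out(2) by blast
  have same: "\<Phi> m' ?c' = \<Phi> m ?c" using glued_Phi[OF g c] \<sigma>c by simp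
  obtain U where U: "open U" "\<Phi> m ?c \<in> U" "U \<subseteq> elem m \<union> elem m'"
    using glued_local_nbhd[OF g c] by (auto simp: facet_center_def axis_def)
  obtain r where r: "r > 0" "ball (\<Phi> m ?c) r \<subseteq> U" using U by (meson openE)
  define M where "M = min (min \<delta>1 \<delta>2) (r / norm w)"
  have "M > 0" "M \<le> \<delta>1" "M \<le> \<delta>2" "M \<le> r / norm w"
    using d1(1) d2(1) r(1) \<open>w \<noteq> 0\<close> by (auto simp: M_def)
  moreover define t where "t = M / 2"
  ultimately have t: "0 < t" "t < \<delta>1" "t < \<delta>2" "t < r / norm w" by auto
  have "norm (t *\<^sub>R w) < r" using t \<open>w \<noteq> 0\<close> by (simp add: field_simps)
  then have "\<Phi> m ?c + t *\<^sub>R w \<in> ball (\<Phi> m ?c) r" by (simp add: dist_norm)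
  then show False using r(2) U(3) d1(2)[OF t(1,2)] d2(2)[OF t(1,3)] unfolding same by blast
qed

text \<open>The two glued elements cover a neighbourhood of the point, and the interior of a third
  element meets neither of them.\<close>

lemma facet_point_third_element:
  assumes g: "glued m d s m' d' s' \<sigma>" and \<xi>: "\<xi> \<in> ref_facet d s" "\<And>i. i \<noteq> d \<Longrightarrow> \<bar>\<xi> $ i\<bar> < 1"
    and m'': "m'' < n" "\<Phi> m \<xi> \<in> elem m''"
  shows "m'' = m \<or> m'' = m'"
proof (rule ccontr)
  assume ne: "\<not> ?thesis"
  obtain U where U: "open U" "\<Phi> m \<xi> \<in> U" "U \<subseteq> elem m \<union> elem m'"
    using glued_local_nbhd[OF g \<xi>] by blast
  have "\<Phi> m \<xi> \<in> closure (\<Phi> m'' ` Ki)" using closure_Phi_Ki m'' by blast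
  then have "U \<inter> \<Phi> m'' ` Ki \<noteq> {}" using U by (meson disjoint_iff open_Int_closure_eq_empty)
  moreover have "elem m \<inter> \<Phi> m'' ` Ki = {}" "elem m' \<inter> \<Phi> m'' ` Ki = {}"
    using elem_Int[of m m''] elem_Int[of m' m''] ne g m'' by (auto simp: glued_def)
  ultimately show False using U(3) by blast
qed

text \<open>A face of the cube containing a relatively interior point \<xi> of a facet contains the
  whole facet: the segment from any facet point \<open>a\<close> through \<xi> can be prolonged
  inside the cube, and a face containing an inner point of a segment contains its end
  points.\<close>

lemma facet_point_in_other_element:
  assumes m: "m < n" "m' < n" "m \<noteq> m'" and s: "s \<in> {-1, 1}"
    and \<xi>: "\<xi> \<in> ref_facet d s" "\<And>i. i \<noteq> d \<Longrightarrow> \<bar>\<xi> $ i\<bar> < 1"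
    and x: "\<Phi> m \<xi> \<in> elem m'"
  shows "\<Phi> m ` ref_facet d s \<subseteq> elem m'"
proof -
  obtain F \<sigma> where F: "F face_of K" "elem m \<inter> elem m' = \<Phi> m ` F"
    using conforming[OF m] unfolding elem_def by metis
  have \<xi>K: "\<xi> \<in> K" "\<xi> $ d = s" using \<xi>(1) by (auto simp: ref_facet_mem)
  then have "\<Phi> m \<xi> \<in> \<Phi> m ` F" using F(2) x unfolding elem_def by blast
  then have \<xi>F: "\<xi> \<in> F" using Phi_eq_iff[OF m(1) \<xi>K(1)] face_of_imp_subset[OF F(1)] by blast
  have "a \<in> F" if a: "a \<in> ref_facet d s" for a
  proof (cases "a = \<xi>")
    case False
    define \<mu> where "\<mu> = max \<bar>\<xi> $ (d + 1)\<bar> \<bar>\<xi> $ (d + 2)\<bar>"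
    \<comment> \<open>The coordinates of \<open>\<xi> - a\<close> are at most 2 in modulus, so the
      prolongation changes the in-plane coordinates by at most \<open>1 - \<mu>\<close>, the room
      left between \<mu> and 1.\<close>
    define \<delta> where "\<delta> = (1 - \<mu>) / 2"
    have \<mu>: "\<bar>\<xi> $ i\<bar> \<le> \<mu>" if "i \<noteq> d" for i
      using three_cases[of i d] that by (auto simp: \<mu>_def)
    have "\<mu> < 1" using \<xi>(2)[of "d + 1"] \<xi>(2)[of "d + 2"] by (simp add: \<mu>_def)
    then have \<delta>: "\<delta> > 0" by (simp add: \<delta>_def)
    define b where "b = \<xi> + \<delta> *\<^sub>R (\<xi> - a)"
    have "b \<in> K" unfolding ref_cube_mem
    proof
      fix i show "\<bar>b $ i\<bar> \<le> 1"
      proof (cases "i = d")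
        case True
        then show ?thesis using a \<xi>K s by (auto simp: b_def ref_facet_mem)
      next
        case False
        have "\<bar>a $ i\<bar> \<le> 1" "\<bar>\<xi> $ i\<bar> \<le> 1" using a \<xi>K by (auto simp: ref_facet_mem ref_cube_mem)
        then have "\<bar>\<xi> $ i - a $ i\<bar> \<le> 2" by linarith
        then have "\<bar>\<delta> * (\<xi> $ i - a $ i)\<bar> \<le> \<delta> * 2" using \<delta> by (simp add: abs_mult)
        then have "\<bar>b $ i\<bar> \<le> \<mu> + \<delta> * 2" using \<mu>[OF False] by (simp add: b_def)
        moreover have "\<delta> * 2 = 1 - \<mu>" by (simp add: \<delta>_def)
        ultimately show ?thesis by linarith
      qed
    qed
    moreover have "\<xi> \<in> open_segment a b"
    proof -
      define u where "u = 1 / (1 + \<delta>)"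
      have u: "0 < u" "u < 1" "u * (1 + \<delta>) = 1" using \<delta> by (auto simp: u_def)
      have "(1 - u) *\<^sub>R a + u *\<^sub>R b = (1 - u - u * \<delta>) *\<^sub>R a + (u * (1 + \<delta>)) *\<^sub>R \<xi>"
        by (simp add: b_def algebra_simps)
      also have "\<dots> = \<xi>" using u(3) by (simp add: algebra_simps)
      finally have "\<xi> = (1 - u) *\<^sub>R a + u *\<^sub>R b" by simp
      moreover have "a \<noteq> b"
      proof
        assume "a = b"
        then have "(1 + \<delta>) *\<^sub>R (\<xi> - a) = 0" by (simp add: b_def algebra_simps)
        then show False using \<delta> False by simp
      qed
      ultimately show ?thesis using u by (auto simp: in_segment)
    qed
    ultimately show ?thesis using face_ofD[OF F(1) _ _ _ \<xi>F, of a b] a by (auto simp: ref_facet_mem)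
  qed (use \<xi>F in simp)
  then show ?thesis using F(2) by blast
qed

text \<open>If such a point were in \<Omega>, taking away the other elements, which are closed,
  would leave an open set around it inside \<open>elem m\<close>. The point would then be interior
  to its element, which a facet point is not. As a consequence test functions vanish on unshared
  facets.\<close>

lemma unshared_facet_outside:
  assumes m: "m < n" and s: "s \<in> {-1, 1}"
    and un: "\<And>m'. m' < n \<Longrightarrow> m' \<noteq> m \<Longrightarrow> \<not> \<Phi> m ` ref_facet d s \<subseteq> elem m'"
    and \<xi>: "\<xi> \<in> ref_facet d s" "\<And>i. i \<noteq> d \<Longrightarrow> \<bar>\<xi> $ i\<bar> < 1"
  shows "\<Phi> m \<xi> \<notin> \<Omega>"
proof
  assume x: "\<Phi> m \<xi> \<in> \<Omega>"
  have no: "\<Phi> m \<xi> \<notin> elem m'" if "m' < n" "m' \<noteq> m" for m'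
    using facet_point_in_other_element[OF m that(1) _ s \<xi>] un[OF that] that(2) by blast
  define V where "V = \<Omega> - (\<Union>m'\<in>{..<n} - {m}. elem m')"
  have "open \<Omega>" using domain(2) by (simp add: lipschitz_domain_def)
  moreover have "closed (\<Union>m'\<in>{..<n} - {m}. elem m')"
    by (intro closed_UN) (auto intro: compact_imp_closed compact_elem)
  ultimately have "open V" unfolding V_def by (rule open_Diff)
  moreover have "\<Phi> m \<xi> \<in> V" using x no by (auto simp: V_def)
  moreover have "V \<subseteq> elem m"
  proof
    fix y assume y: "y \<in> V"
    then have "y \<in> closure \<Omega>" using closure_subset by (auto simp: V_def)
    then obtain m' where "m' < n" "y \<in> elem m'" unfolding cover elem_def by blast
    then show "y \<in> elem m" using y by (cases "m' = m") (auto simp: V_def)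
  qed
  ultimately have "\<Phi> m \<xi> \<in> interior (elem m)" by (meson interiorI)
  then obtain \<eta> where \<eta>: "\<eta> \<in> Ki" "\<Phi> m \<xi> = \<Phi> m \<eta>" unfolding interior_elem[OF m] by blast
  then have "\<xi> = \<eta>" using Phi_eq_iff[OF m] Ki_subset \<xi>(1) by (simp add: ref_facet_mem)
  then have "\<bar>\<xi> $ d\<bar> < 1" using \<eta>(1) by (simp add: ref_cube_mem_interior)
  then show False using \<xi>(1) s by (auto simp: ref_facet_mem)
qed

end

section \<open>Weak divergence of piecewise fields\<close>

lemma upd_derivative:
  "((\<lambda>t. upd \<xi> d t) has_derivative (\<lambda>h. h *\<^sub>R axis d 1)) (at t within S)"
proof -
  have "((\<lambda>t. upd \<xi> d 0 + t *\<^sub>R axis d 1) has_derivative (\<lambda>h. h *\<^sub>R axis d 1)) (at t within S)"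
    by (auto intro!: derivative_eq_intros)
  moreover have "(\<lambda>t. upd \<xi> d 0 + t *\<^sub>R axis d 1) = upd \<xi> d"
    by (simp add: fun_eq_iff vec_eq_iff axis_def)
  ultimately show ?thesis by simp
qed

context gll_mesh begin

lemma glued_sym:
  assumes g: "glued m d s m' d' s' \<sigma>"
  shows "glued m' d' s' m d s (inv \<sigma>)"
proof -
  have o: "orthogonal_transformation \<sigma>" and K: "\<sigma> ` K = K" using g by (auto simp: glued_def)
  have bij: "bij \<sigma>" using o by (simp add: orthogonal_transformation_bij)
  then have inv\<sigma>: "inv \<sigma> (\<sigma> x) = x" "\<sigma> (inv \<sigma> x) = x" for x
    by (simp_all add: bij_is_inj bij_is_surj surj_f_inv_f)
  have "orthogonal_transformation (inv \<sigma>)" using o by (rule orthogonal_transformation_inv)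
  moreover have "inv \<sigma> ` K = K" using K image_inv_f_f[OF bij_is_inj[OF bij], of K] by simp
  moreover have "inv \<sigma> (axis d' 1) = (s' * s) *\<^sub>R axis d 1"
  proof -
    have "\<sigma> ((s' * s) *\<^sub>R axis d 1) = (s' * s) *\<^sub>R (s * s') *\<^sub>R axis d' 1"
      using g linear_scale[OF glued_linear[OF g]] by (simp add: glued_def)
    also have "\<dots> = axis d' 1" using g by (auto simp: glued_def)
    finally show ?thesis using inv\<sigma>(1) by metis
  qed
  moreover have "\<Phi> m (inv \<sigma> \<xi>) = \<Phi> m' \<xi>" if "\<xi> \<in> ref_facet d' s'" for \<xi>
    using glued_Phi[OF g, of "inv \<sigma> \<xi>"] glued_in_facet[OF g, of "inv \<sigma> \<xi>"] that by (simp add: inv\<sigma>)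
  moreover have "elem m' \<inter> elem m = \<Phi> m' ` ref_facet d' s'"
    unfolding glued_image_eq[OF g] using g by (auto simp: glued_def)
  ultimately show ?thesis using g unfolding glued_def by auto
qed

text \<open>The facet centre lies in no third element, which determines the neighbour; injectivity
  of its map then determines the facet.\<close>

lemma glued_unique:
  assumes g1: "glued m d s m1 d1 s1 \<sigma>1" and g2: "glued m d s m2 d2 s2 \<sigma>2"
  shows "m1 = m2 \<and> d1 = d2 \<and> s1 = s2"
proof -
  let ?c = "facet_center d s"
  have m: "m < n" "m1 < n" "m2 < n" "m \<noteq> m2" and s: "s \<in> {-1, 1}" "s1 \<in> {-1, 1}" "s2 \<in> {-1, 1}"
    using g1 g2 by (auto simp: glued_def)
  have c: "?c \<in> ref_facet d s" using facet_center_mem[OF s(1)] .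
  have "elem m \<inter> elem m2 = \<Phi> m ` ref_facet d s" using g2 by (simp add: glued_def)
  then have "\<Phi> m ?c \<in> elem m2" using c by blast
  then have "m2 = m \<or> m2 = m1"
    by (intro facet_point_third_element[OF g1 c _ m(3)]) (auto simp: facet_center_def axis_def)
  then have mm: "m1 = m2" using m(4) by blast
  have "\<Phi> m1 ` ref_facet d1 s1 = \<Phi> m1 ` ref_facet d2 s2"
    using glued_image_eq[OF g1] glued_image_eq[OF g2] mm by simp
  then have "ref_facet d1 s1 = ref_facet d2 s2"
    using inj_on_image_eq_iff[OF Phi_inj[OF m(2)], of "ref_facet d1 s1" "ref_facet d2 s2"]
    by (auto simp: ref_facet_def)
  then have "facet_center d1 s1 \<in> ref_facet d2 s2" using facet_center_mem[OF s(2), of d1] by simp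
  then have "facet_center d1 s1 $ d2 = s2" by (simp add: ref_facet_mem)
  then have "d1 = d2 \<and> s1 = s2" using s by (auto simp: facet_center_def axis_def split: if_splits)
  then show ?thesis using mm by blast
qed

lemma glued_upd:
  assumes g: "glued m d s m' d' s' \<sigma>"
  shows "\<sigma> (upd x d s) = upd (\<sigma> x) d' s'"
proof -
  have "upd x d s = x + (s - x $ d) *\<^sub>R axis d 1" by (simp add: vec_eq_iff axis_def)
  then have "\<sigma> (upd x d s) = \<sigma> x + (s - x $ d) *\<^sub>R (s * s') *\<^sub>R axis d' 1"
    using g linear_add[OF glued_linear[OF g]] linear_scale[OF glued_linear[OF g]] by (simp add: glued_def)
  also have "\<dots> = upd (\<sigma> x) d' s'"
    using glued_nth[OF g, of x] glued_sq[OF g] by (auto simp: vec_eq_iff axis_def algebra_simps)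
  finally show ?thesis .
qed

text \<open>Both flat boxes are thickened to height 2. The thick boxes correspond under \<sigma>,
  whose determinant has modulus 1, and the common height cancels.\<close>

lemma glued_face_integral:
  fixes f :: "real^3 \<Rightarrow> real"
  assumes g: "glued m d s m' d' s' \<sigma>"
    and a: "a $ d = s" "b $ d = s" and a': "a' $ d' = s'" "b' $ d' = s'"
    and im: "\<sigma> ` cbox a b = cbox a' b'" and f: "continuous_on (cbox a' b') f"
  shows "integral (cbox (a' $ (d' + 1), a' $ (d' + 2)) (b' $ (d' + 1), b' $ (d' + 2))) (\<lambda>q. f (emb d' s' q))
    = integral (cbox (a $ (d + 1), a $ (d + 2)) (b $ (d + 1), b $ (d + 2))) (\<lambda>q. f (\<sigma> (emb d s q)))"
proof -
  have o: "orthogonal_transformation \<sigma>" using g by (simp add: glued_def)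
  have lin: "linear \<sigma>" and inj: "inj \<sigma>" and surj: "surj \<sigma>"
    using o orthogonal_transformation_inj orthogonal_transformation_surj by (auto simp: glued_linear[OF g])
  let ?P = "cbox (upd a d (-1)) (upd b d 1)" and ?P' = "cbox (upd a' d' (-1)) (upd b' d' 1)"
  have thick: "x \<in> cbox (upd e i (-1)) (upd e' i 1) \<longleftrightarrow> \<bar>x $ i\<bar> \<le> 1 \<and> upd x i r \<in> cbox e e'"
    if "e $ i = r" "e' $ i = r" for x e e' i r
    using that by (auto simp: mem_box_cart all_three[of _ i] abs_le_iff minus_le_iff)
  have mem: "\<sigma> x \<in> ?P' \<longleftrightarrow> x \<in> ?P" for x
  proof -
    have "\<sigma> x \<in> ?P' \<longleftrightarrow> \<bar>\<sigma> x $ d'\<bar> \<le> 1 \<and> upd (\<sigma> x) d' s' \<in> \<sigma> ` cbox a b"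
      unfolding im by (rule thick[OF a'])
    also have "\<dots> \<longleftrightarrow> \<bar>x $ d\<bar> \<le> 1 \<and> upd x d s \<in> cbox a b"
      unfolding glued_upd[OF g, symmetric] inj_image_mem_iff[OF inj] glued_nth[OF g]
      using g by (auto simp: glued_def abs_mult)
    also have "\<dots> \<longleftrightarrow> x \<in> ?P" by (rule thick[OF a, symmetric])
    finally show ?thesis .
  qed
  have imP: "\<sigma> ` ?P = ?P'"
  proof
    show "?P' \<subseteq> \<sigma> ` ?P"
    proof
      fix y assume y: "y \<in> ?P'"
      obtain x where x: "y = \<sigma> x" using surj by (metis surjD)
      then show "y \<in> \<sigma> ` ?P" using y mem[of x] by simp
    qed
  qed (use mem in auto)
  have cP': "continuous_on ?P' (\<lambda>y. f (upd y d' s'))"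
    by (rule continuous_on_compose2[OF f])
      (use thick[OF a'] in \<open>auto intro!: continuous_intros continuous_on_upd continuous_on_id\<close>)
  have cP: "continuous_on ?P (\<lambda>x. f (\<sigma> (upd x d s)))"
  proof -
    have "continuous_on ?P (\<lambda>x. f (upd (\<sigma> x) d' s'))"
      by (rule continuous_on_compose2[OF cP' linear_continuous_on_compose[OF continuous_on_id lin]])
        (use mem in auto)
    then show ?thesis by (simp add: glued_upd[OF g])
  qed
  have det: "\<bar>det (matrix \<sigma>)\<bar> = 1" using orthogonal_transformation_det[OF o] .
  have "integral (\<sigma> ` ?P) (\<lambda>y. f (upd y d' s')) = integral ?P (\<lambda>x. \<bar>det (matrix \<sigma>)\<bar> * f (upd (\<sigma> x) d' s'))"
  proof (rule change_of_variables_real(2))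
    show "(\<sigma> has_derivative \<sigma>) (at x within ?P)" for x by (rule linear_imp_has_derivative[OF lin])
    show "inj_on \<sigma> ?P" using inj by (rule inj_on_subset) simp
    show "(\<lambda>x. \<bar>det (matrix \<sigma>)\<bar> * f (upd (\<sigma> x) d' s')) absolutely_integrable_on ?P"
      unfolding det using cP by (simp add: glued_upd[OF g] absolutely_integrable_continuous)
  qed simp
  then have "integral ?P' (\<lambda>y. f (upd y d' s')) = integral ?P (\<lambda>x. f (\<sigma> (upd x d s)))"
    unfolding imP det by (simp add: glued_upd[OF g])
  moreover have "integral ?P' (\<lambda>y. f (upd y d' s')) =
      2 * integral (cbox (a' $ (d' + 1), a' $ (d' + 2)) (b' $ (d' + 1), b' $ (d' + 2))) (\<lambda>q. f (emb d' s' q))"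
    using integral_cbox_upd[OF cP'] by simp
  moreover have "integral ?P (\<lambda>x. f (\<sigma> (upd x d s))) =
      2 * integral (cbox (a $ (d + 1), a $ (d + 2)) (b $ (d + 1), b $ (d + 2))) (\<lambda>q. f (\<sigma> (emb d s q)))"
    using integral_cbox_upd[OF cP] by simp
  ultimately show ?thesis by simp
qed

abbreviation (input) "Q \<equiv> cbox (-1, -1) (1, 1) :: (real \<times> real) set"

lemma ref_facet_eq_cbox: "s \<in> {-1, 1} \<Longrightarrow> ref_facet d s = cbox (upd (vec (-1)) d s) (upd (vec 1) d s)"
  by (auto simp: ref_facet_mem ref_cube_def mem_box_cart all_three[of _ d])

lemma emb_in_facet: "s \<in> {-1, 1} \<Longrightarrow> q \<in> Q \<Longrightarrow> emb d s q \<in> ref_facet d s"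
  unfolding ref_facet_eq_cbox emb_in_cbox by simp

lemma glued_facet_integral:
  fixes f :: "real^3 \<Rightarrow> real"
  assumes g: "glued m d s m' d' s' \<sigma>" and f: "continuous_on (ref_facet d' s') f"
  shows "integral Q (\<lambda>q. f (emb d' s' q)) = integral Q (\<lambda>q. f (\<sigma> (emb d s q)))"
proof -
  have s: "s \<in> {-1, 1}" "s' \<in> {-1, 1}" using g by (auto simp: glued_def)
  show ?thesis
    using glued_face_integral[OF g, where a = "upd (vec (-1)) d s" and b = "upd (vec 1) d s"
        and a' = "upd (vec (-1)) d' s'" and b' = "upd (vec 1) d' s'" and f = f]
      glued_facet_image[OF g] f unfolding ref_facet_eq_cbox[OF s(1)] ref_facet_eq_cbox[OF s(2)]
    by simp
qed

text \<open>\<open>s * u m \<xi> $ d\<close> is the outward normal component on the facet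
  \<open>(d, s)\<close>. The condition is continuity of the normal trace expressed in reference
  coordinates: the two outward components cancel.\<close>

definition matched :: "(nat \<Rightarrow> real^3 \<Rightarrow> real^3) \<Rightarrow> bool" where
  "matched u \<longleftrightarrow> (\<forall>m d s m' d' s' \<sigma>. glued m d s m' d' s' \<sigma> \<longrightarrow>
    (\<forall>\<xi>\<in>ref_facet d s. s' * u m' (\<sigma> \<xi>) $ d' = - (s * u m \<xi> $ d)))"

text \<open>Integration by parts on the cube with the pulled back test function, so that the only
  derivatives of \<open>\<Phi> m\<close> are first ones. The field is not yet divided by the
  determinant, which the volume element cancels.\<close>

lemma element_divergence_theorem:
  assumes m: "m < n" and u: "u \<in> D_ref N" "partials u w" "\<And>d. w d \<in> S_ref N"
    and \<phi>: "\<And>x. GDERIV \<phi> x :> G x" "continuous_on UNIV G"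
  shows "integral K (\<lambda>\<xi>. (jac m \<xi> *v u \<xi>) \<bullet> G (\<Phi> m \<xi>)) + integral K (\<lambda>\<xi>. (\<Sum>d\<in>UNIV. w d \<xi>) * \<phi> (\<Phi> m \<xi>))
    = (\<Sum>d\<in>UNIV. \<Sum>s\<in>{-1, 1}. s * integral Q (\<lambda>q. u (emb d s q) $ d * \<phi> (\<Phi> m (emb d s q))))"
proof -
  define \<psi> where "\<psi> \<xi> = \<phi> (\<Phi> m \<xi>)" for \<xi>
  have \<phi>der: "(\<phi> has_derivative (\<lambda>h. G x \<bullet> h)) (at x within S)" for x S
    using \<phi>(1)[of x] unfolding gderiv_def by (auto intro: has_derivative_at_withinI simp: inner_commute)
  have cont\<phi>: "continuous_on UNIV \<phi>" by (rule has_derivative_continuous_on) (rule \<phi>der)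
  have cu: "continuous_on S u" for S by (rule continuous_on_D_ref[OF u(1)])
  have cw: "continuous_on S (w d)" for S d
    using u(3) unfolding S_ref_def by (rule continuous_on_tensor_poly)
  have c\<psi>: "continuous_on K \<psi>" unfolding \<psi>_def
    by (rule continuous_on_compose2[OF cont\<phi> Phi_continuous[OF m]]) simp
  have cG: "continuous_on K (\<lambda>\<xi>. G (\<Phi> m \<xi>))"
    by (rule continuous_on_compose2[OF \<phi>(2) Phi_continuous[OF m]]) simp
  have cJ: "continuous_on K (\<lambda>\<xi>. jac m \<xi> *v axis d 1)" for d
    unfolding matrix_vector_mult_basis column_def by (intro continuous_on_vec_lambda jac_entry_continuous m)
  \<comment> \<open>The derivative in direction \<open>d\<close> of
    \<open>u \<xi> $ d * \<psi> \<xi>\<close>; summed over \<open>d\<close>, its two terms are the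
    two integrands of the claim.\<close>
  define F' where "F' d \<xi> = w d \<xi> * \<psi> \<xi> + u \<xi> $ d * (G (\<Phi> m \<xi>) \<bullet> (jac m \<xi> *v axis d 1))" for d \<xi>
  have cF': "continuous_on K (F' d)" for d
    unfolding F'_def by (intro continuous_intros cw c\<psi> cu cG cJ)
  have main: "integral K (F' d) = (\<Sum>s\<in>{-1, 1}. s * integral Q (\<lambda>q. u (emb d s q) $ d * \<psi> (emb d s q)))" for d
  proof -
    have "integral K (F' d) = integral Q (\<lambda>q. u (emb d 1 q) $ d * \<psi> (emb d 1 q) - u (emb d (-1) q) $ d * \<psi> (emb d (-1) q))"
    proof -
      have "((\<lambda>t. u (upd \<xi> d t) $ d * \<psi> (upd \<xi> d t)) has_real_derivative F' d \<xi>) (at (\<xi> $ d) within {-1..1})"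
        if \<xi>: "\<xi> \<in> K" for \<xi>
      proof -
        have sub: "upd \<xi> d ` {-1..1} \<subseteq> K" using \<xi> by (auto simp: ref_cube_mem)
        have "((\<lambda>t. \<Phi> m (upd \<xi> d t)) has_derivative (\<lambda>h. jac m \<xi> *v (h *\<^sub>R axis d 1))) (at (\<xi> $ d) within {-1..1})"
          by (rule has_derivative_in_compose[OF upd_derivative])
            (use has_derivative_subset[OF C1_jac(1)[OF m \<xi>] sub] in simp)
        from has_derivative_in_compose[OF this \<phi>der]
        have "((\<lambda>t. \<psi> (upd \<xi> d t)) has_derivative (\<lambda>h. G (\<Phi> m \<xi>) \<bullet> (jac m \<xi> *v (h *\<^sub>R axis d 1)))) (at (\<xi> $ d) within {-1..1})"
          by (simp add: \<psi>_def)
        moreover have "(\<lambda>h. G (\<Phi> m \<xi>) \<bullet> (jac m \<xi> *v (h *\<^sub>R axis d 1))) = (*) (G (\<Phi> m \<xi>) \<bullet> (jac m \<xi> *v axis d 1))"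
          by (simp add: fun_eq_iff matrix_vector_mult_scaleR)
        ultimately have p: "((\<lambda>t. \<psi> (upd \<xi> d t)) has_real_derivative G (\<Phi> m \<xi>) \<bullet> (jac m \<xi> *v axis d 1)) (at (\<xi> $ d) within {-1..1})"
          unfolding has_field_derivative_def by (simp only:)
        have "((\<lambda>t. u (upd \<xi> d t) $ d) has_real_derivative w d \<xi>) (at (\<xi> $ d) within {-1..1})"
          using u(2) unfolding partials_def by (auto intro: has_field_derivative_at_within)
        from DERIV_mult[OF this p] show ?thesis by (simp add: F'_def mult.commute)
      qed
      then show ?thesis
        using integral_cbox_partial[of "vec (-1)" d "vec 1" "F' d" "\<lambda>\<xi>. u \<xi> $ d * \<psi> \<xi>"] cF'[of d]
        by (simp add: ref_cube_def)
    qed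
    also have "\<dots> = integral Q (\<lambda>q. u (emb d 1 q) $ d * \<psi> (emb d 1 q)) - integral Q (\<lambda>q. u (emb d (-1) q) $ d * \<psi> (emb d (-1) q))"
    proof (rule integral_diff)
      have "(\<lambda>q. u (emb d s q) $ d * \<psi> (emb d s q)) integrable_on Q" if "s \<in> {-1, 1}" for s
      proof (rule integrable_continuous)
        have "continuous_on Q (\<lambda>q. emb d s q)" by (intro continuous_intros)
        moreover have "emb d s ` Q \<subseteq> K" using emb_in_facet[OF that] by (auto simp: ref_facet_mem)
        ultimately show "continuous_on Q (\<lambda>q. u (emb d s q) $ d * \<psi> (emb d s q))"
          by (intro continuous_on_mult continuous_on_component continuous_on_compose2[OF cu[of K]]
              continuous_on_compose2[OF c\<psi>]) auto
      qed
      then show "(\<lambda>q. u (emb d 1 q) $ d * \<psi> (emb d 1 q)) integrable_on Q"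
        "(\<lambda>q. u (emb d (-1) q) $ d * \<psi> (emb d (-1) q)) integrable_on Q" by auto
    qed
    finally show ?thesis by simp
  qed
  have JG: "(jac m \<xi> *v u \<xi>) \<bullet> G (\<Phi> m \<xi>) = (\<Sum>d\<in>UNIV. u \<xi> $ d * (G (\<Phi> m \<xi>) \<bullet> (jac m \<xi> *v axis d 1)))" for \<xi>
  proof -
    have "jac m \<xi> *v u \<xi> = (\<Sum>d\<in>UNIV. u \<xi> $ d *\<^sub>R (jac m \<xi> *v axis d 1))"
      unfolding matrix_vector_mult_basis by (simp add: matrix_mult_sum scalar_mult_eq_scaleR)
    then show ?thesis by (simp add: inner_sum_right inner_commute[of _ "G _"])
  qed
  have int: "f integrable_on K" if "continuous_on K f" for f :: "real^3 \<Rightarrow> real"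
    using that unfolding ref_cube_def by (rule integrable_continuous)
  have "integral K (\<lambda>\<xi>. (jac m \<xi> *v u \<xi>) \<bullet> G (\<Phi> m \<xi>)) + integral K (\<lambda>\<xi>. (\<Sum>d\<in>UNIV. w d \<xi>) * \<psi> \<xi>)
      = integral K (\<lambda>\<xi>. (jac m \<xi> *v u \<xi>) \<bullet> G (\<Phi> m \<xi>) + (\<Sum>d\<in>UNIV. w d \<xi>) * \<psi> \<xi>)"
    by (rule integral_add[symmetric]; rule int)
      (unfold JG, (intro continuous_intros cw c\<psi> cu cG cJ)+)
  also have "\<dots> = integral K (\<lambda>\<xi>. \<Sum>d\<in>UNIV. F' d \<xi>)"
    by (rule integral_cong) (simp add: JG F'_def sum.distrib sum_distrib_right)
  also have "\<dots> = (\<Sum>d\<in>UNIV. integral K (F' d))"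
    by (rule integral_sum) (auto intro: int cF')
  finally show ?thesis unfolding main \<psi>_def .
qed

definition facet_flux :: "(nat \<Rightarrow> real^3 \<Rightarrow> real^3) \<Rightarrow> (real^3 \<Rightarrow> real) \<Rightarrow> nat \<times> 3 \<times> real \<Rightarrow> real" where
  "facet_flux u \<phi> = (\<lambda>(m, d, s). s * integral Q (\<lambda>q. u m (emb d s q) $ d * \<phi> (\<Phi> m (emb d s q))))"

lemma glued_facet_flux:
  assumes g: "glued m d s m' d' s' \<sigma>" and u: "matched u" "continuous_on K (u m')"
    and \<phi>: "continuous_on UNIV \<phi>"
  shows "facet_flux u \<phi> (m', d', s') = - facet_flux u \<phi> (m, d, s)"
proof -
  have s: "s \<in> {-1, 1}" and m': "m' < n" using g by (auto simp: glued_def)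
  have sub: "ref_facet d' s' \<subseteq> K" by (auto simp: ref_facet_mem)
  have "continuous_on (ref_facet d' s') (\<lambda>\<xi>. u m' \<xi> $ d' * \<phi> (\<Phi> m' \<xi>))"
    by (intro continuous_intros continuous_on_subset[OF u(2) sub]
        continuous_on_compose2[OF \<phi> continuous_on_subset[OF Phi_continuous[OF m'] sub]]) auto
  from glued_facet_integral[OF g this]
  have "facet_flux u \<phi> (m', d', s') = s' * integral Q (\<lambda>q. u m' (\<sigma> (emb d s q)) $ d' * \<phi> (\<Phi> m' (\<sigma> (emb d s q))))"
    by (simp add: facet_flux_def)
  also have "\<dots> = integral Q (\<lambda>q. s' * (u m' (\<sigma> (emb d s q)) $ d' * \<phi> (\<Phi> m' (\<sigma> (emb d s q)))))"
    by simp
  also have "\<dots> = integral Q (\<lambda>q. - s * (u m (emb d s q) $ d * \<phi> (\<Phi> m (emb d s q))))"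
  proof (rule integral_cong)
    fix q assume "q \<in> Q"
    then have e: "emb d s q \<in> ref_facet d s" by (rule emb_in_facet[OF s])
    have "s' * u m' (\<sigma> (emb d s q)) $ d' = - (s * u m (emb d s q) $ d)"
      using u(1) g e unfolding matched_def by blast
    then show "s' * (u m' (\<sigma> (emb d s q)) $ d' * \<phi> (\<Phi> m' (\<sigma> (emb d s q)))) =
        - s * (u m (emb d s q) $ d * \<phi> (\<Phi> m (emb d s q)))"
      unfolding glued_Phi[OF g e] by (metis mult.assoc mult_minus_left)
  qed
  also have "\<dots> = - facet_flux u \<phi> (m, d, s)" unfolding integral_mult_right by (simp add: facet_flux_def)
  finally show ?thesis .
qed

text \<open>The relatively interior points of an unshared facet lie outside \<Omega>, where \<phi>
  vanishes; the edges form a null set.\<close>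

lemma unshared_facet_flux:
  assumes m: "m < n" and s: "s \<in> {-1, 1}"
    and un: "\<And>m'. m' < n \<Longrightarrow> m' \<noteq> m \<Longrightarrow> \<not> \<Phi> m ` ref_facet d s \<subseteq> elem m'"
    and \<phi>: "\<And>x. x \<notin> \<Omega> \<Longrightarrow> \<phi> x = 0"
  shows "facet_flux u \<phi> (m, d, s) = 0"
proof -
  have "integral Q (\<lambda>q. u m (emb d s q) $ d * \<phi> (\<Phi> m (emb d s q))) = integral Q (\<lambda>_. 0)"
  proof (rule integral_spike[of "Q - box (-1, -1) (1, 1)"])
    show "negligible (Q - box (-1, -1) (1, 1))" by (rule negligible_frontier_interval)
    fix q assume "q \<in> Q - (Q - box (-1, -1) (1, 1))"
    then have q: "q \<in> Q" "q \<in> box (-1, -1) (1, 1)" by auto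
    have "\<bar>emb d s q $ i\<bar> < 1" if "i \<noteq> d" for i
      using three_cases[of i d] that q(2) by (cases q) (auto simp: mem_box Basis_prod_def abs_less_iff)
    then show "0 = u m (emb d s q) $ d * \<phi> (\<Phi> m (emb d s q))"
      using unshared_facet_outside[OF m s un emb_in_facet[OF s q(1)]] \<phi> by simp
  qed
  then show ?thesis by (simp add: facet_flux_def)
qed

definition facets :: "(nat \<times> 3 \<times> real) set" where
  "facets = {..<n} \<times> UNIV \<times> {-1, 1}"

definition is_partner :: "nat \<times> 3 \<times> real \<Rightarrow> nat \<times> 3 \<times> real \<Rightarrow> bool" where
  "is_partner = (\<lambda>(m, d, s) (m', d', s'). \<exists>\<sigma>. glued m d s m' d' s' \<sigma>)"

lemma is_partner_sym: "is_partner f g \<Longrightarrow> is_partner g f"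
  unfolding is_partner_def by (cases f; cases g) (auto dest: glued_sym)

lemma is_partner_unique: "is_partner f g \<Longrightarrow> is_partner f h \<Longrightarrow> g = h"
  unfolding is_partner_def using glued_unique by (cases f; cases g; cases h) fastforce

lemma is_partner_facets: "is_partner f g \<Longrightarrow> f \<in> facets \<and> g \<in> facets \<and> fst f \<noteq> fst g"
  unfolding is_partner_def facets_def glued_def by (cases f; cases g) auto

lemma unshared_facet:
  assumes "(m, d, s) \<in> facets" "\<nexists>f. is_partner (m, d, s) f" "m' < n" "m' \<noteq> m"
  shows "\<not> \<Phi> m ` ref_facet d s \<subseteq> elem m'"
  using glued_exists[of m m' s d] assms unfolding is_partner_def facets_def by fastforce

text \<open>Exchanging partners, and fixing the facets without one, is an involution of the facets
  that reverses the sign of the flux; on a fixed facet the flux is zero. So the sum equals its own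
  negative.\<close>

lemma sum_facet_flux:
  assumes u: "matched u" "\<And>m. m < n \<Longrightarrow> continuous_on K (u m)"
    and \<phi>: "continuous_on UNIV \<phi>" "\<And>x. x \<notin> \<Omega> \<Longrightarrow> \<phi> x = 0"
  shows "(\<Sum>f\<in>facets. facet_flux u \<phi> f) = 0"
proof -
  define p where "p f = (if \<exists>g. is_partner f g then SOME g. is_partner f g else f)" for f
  have p: "p f = g" if "is_partner f g" for f g
    using that is_partner_unique[OF that] unfolding p_def by (metis someI)
  have p0: "p f = f" if "\<nexists>g. is_partner f g" for f using that unfolding p_def by auto
  have pp: "p (p f) = f" for f
    by (cases "\<exists>g. is_partner f g") (use p p0 is_partner_sym in metis)+
  have pin: "p f \<in> facets" if "f \<in> facets" for f
    by (cases "\<exists>g. is_partner f g") (use p p0 is_partner_facets that in metis)+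
  have flip: "facet_flux u \<phi> (p f) = - facet_flux u \<phi> f" if f: "f \<in> facets" for f
  proof (cases "\<exists>g. is_partner f g")
    case True
    then obtain g where g: "is_partner f g" by blast
    obtain m d s m' d' s' where fg: "f = (m, d, s)" "g = (m', d', s')" by (metis prod.exhaust)
    then obtain \<sigma> where \<sigma>: "glued m d s m' d' s' \<sigma>" using g by (auto simp: is_partner_def)
    then have "m' < n" by (simp add: glued_def)
    then show ?thesis using glued_facet_flux[OF \<sigma> u(1) u(2) \<phi>(1)] p[OF g] fg by simp
  next
    case False
    obtain m d s where fm: "f = (m, d, s)" by (metis prod.exhaust)
    have "facet_flux u \<phi> (m, d, s) = 0"
    proof (rule unshared_facet_flux[OF _ _ _ \<phi>(2)])
      show "m < n" "s \<in> {-1, 1}" using f fm by (auto simp: facets_def)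
      show "\<not> \<Phi> m ` ref_facet d s \<subseteq> elem m'" if "m' < n" "m' \<noteq> m" for m'
        by (rule unshared_facet[OF _ _ that]) (use f fm False in auto)
    qed
    then show ?thesis using p0[OF False] fm by simp
  qed
  have "(\<Sum>f\<in>facets. facet_flux u \<phi> f) = (\<Sum>f\<in>facets. facet_flux u \<phi> (p f))"
    by (rule sum.reindex_bij_witness[of _ p p]) (use pp pin in auto)
  also have "\<dots> = - (\<Sum>f\<in>facets. facet_flux u \<phi> f)" by (simp add: flip sum_negf)
  finally show ?thesis by simp
qed

text \<open>Pulled back to the cubes, the volume element cancels the determinants in
  \<open>q\<close> and \<open>g\<close>, and the sum of the element identities leaves only facet
  fluxes.\<close>

lemma piecewise_has_divergence:
  assumes u: "\<And>m. m < n \<Longrightarrow> u m \<in> D_ref N" "matched u"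
    and w: "\<And>m. m < n \<Longrightarrow> partials (u m) (w m)" "\<And>m d. m < n \<Longrightarrow> w m d \<in> S_ref N"
    and q: "\<And>m \<xi>. m < n \<Longrightarrow> \<xi> \<in> Ki \<Longrightarrow> q (\<Phi> m \<xi>) = (1 / det (jac m \<xi>)) *\<^sub>R (jac m \<xi> *v u m \<xi>)"
    and g: "\<And>m \<xi>. m < n \<Longrightarrow> \<xi> \<in> Ki \<Longrightarrow> g (\<Phi> m \<xi>) = (\<Sum>d\<in>UNIV. w m d \<xi>) / det (jac m \<xi>)"
  shows "has_divergence \<Omega> q g"
proof -
  have cu: "continuous_on K (u m)" if "m < n" for m using continuous_on_D_ref u(1) that by blast
  have cw: "continuous_on K (w m d)" if "m < n" for m d
    using w(2)[OF that] unfolding S_ref_def by (rule continuous_on_tensor_poly)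
  have nz: "det (jac m \<xi>) \<noteq> 0" if "m < n" "\<xi> \<in> K" for m \<xi> using det_jac_pos[OF that] by simp
  define hq where "hq m \<xi> = (1 / det (jac m \<xi>)) *\<^sub>R (jac m \<xi> *v u m \<xi>)" for m \<xi>
  define hg where "hg m \<xi> = (\<Sum>d\<in>UNIV. w m d \<xi>) / det (jac m \<xi>)" for m \<xi>
  have chq: "continuous_on K (hq m)" if m: "m < n" for m
  proof -
    have "continuous_on K (\<lambda>\<xi>. jac m \<xi> *v u m \<xi>)"
      unfolding matrix_vector_mult_def
      by (intro continuous_on_vec_lambda continuous_intros jac_entry_continuous m cu)
    then show ?thesis unfolding hq_def
      by (intro continuous_intros det_jac_continuous m) (use nz m in auto)
  qed
  have chg: "continuous_on K (hg m)" if m: "m < n" for m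
    unfolding hg_def by (intro continuous_intros det_jac_continuous cw m) (use nz m in auto)
  have L2q: "L2_on \<Omega> q" by (rule piecewise_L2_on[OF chq]) (use q in \<open>auto simp: hq_def\<close>)
  have L2g: "L2_on \<Omega> g" by (rule piecewise_L2_on[OF chg]) (use g in \<open>auto simp: hg_def\<close>)
  have "integral \<Omega> (\<lambda>x. q x \<bullet> G x) = - integral \<Omega> (\<lambda>x. g x * \<phi> x)"
    if \<phi>: "\<And>x. GDERIV \<phi> x :> G x" "continuous_on UNIV G"
      and C: "C \<subseteq> \<Omega>" "\<And>x. x \<notin> C \<Longrightarrow> \<phi> x = 0" for \<phi> G C
  proof -
    have c\<phi>: "continuous_on UNIV \<phi>"
      by (rule has_derivative_continuous_on) (use \<phi>(1) in \<open>auto simp: gderiv_def\<close>)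
    have "integral \<Omega> (\<lambda>x. q x \<bullet> G x) =
        (\<Sum>m<n. integral K (\<lambda>\<xi>. det (jac m \<xi>) * (hq m \<xi> \<bullet> G (\<Phi> m \<xi>))))"
      by (rule piecewise_integral(2))
        (auto simp: q hq_def[symmetric] intro!: continuous_intros chq
          continuous_on_compose2[OF \<phi>(2) Phi_continuous])
    also have "\<dots> = (\<Sum>m<n. integral K (\<lambda>\<xi>. (jac m \<xi> *v u m \<xi>) \<bullet> G (\<Phi> m \<xi>)))"
      by (intro sum.cong refl integral_cong) (use nz in \<open>auto simp: hq_def\<close>)
    finally have iq: "integral \<Omega> (\<lambda>x. q x \<bullet> G x) = \<dots>" .
    have "integral \<Omega> (\<lambda>x. g x * \<phi> x) = (\<Sum>m<n. integral K (\<lambda>\<xi>. det (jac m \<xi>) * (hg m \<xi> * \<phi> (\<Phi> m \<xi>))))"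
      by (rule piecewise_integral(2))
        (auto simp: g hg_def[symmetric] intro!: continuous_intros chg
          continuous_on_compose2[OF c\<phi> Phi_continuous])
    also have "\<dots> = (\<Sum>m<n. integral K (\<lambda>\<xi>. (\<Sum>d\<in>UNIV. w m d \<xi>) * \<phi> (\<Phi> m \<xi>)))"
      by (intro sum.cong refl integral_cong) (use nz in \<open>auto simp: hg_def\<close>)
    finally have ig: "integral \<Omega> (\<lambda>x. g x * \<phi> x) = \<dots>" .
    have "integral \<Omega> (\<lambda>x. q x \<bullet> G x) + integral \<Omega> (\<lambda>x. g x * \<phi> x) =
        (\<Sum>m<n. \<Sum>d\<in>UNIV. \<Sum>s\<in>{-1, 1}. facet_flux u \<phi> (m, d, s))"
      unfolding iq ig sum.distrib[symmetric] facet_flux_def prod.case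
      by (intro sum.cong refl element_divergence_theorem[OF _ u(1) w(1) w(2) \<phi>]) auto
    also have "\<dots> = (\<Sum>f\<in>facets. facet_flux u \<phi> f)"
      unfolding facets_def by (simp only: sum.cartesian_product case_prod_unfold prod.collapse)
    also have "\<dots> = 0" by (rule sum_facet_flux[OF u(2) cu c\<phi>]) (use C in auto)
    finally show ?thesis by simp
  qed
  then show ?thesis unfolding has_divergence_def using L2q L2g by blast
qed

end

section \<open>Surjectivity of the divergence\<close>

context gll_mesh begin

text \<open>A facet without partner is an outlet. The inductive form allows a flow to be built along
  the chain by rule induction.\<close>

inductive drains :: "nat \<Rightarrow> bool" where
  outer: "(m, p) \<in> facets \<Longrightarrow> \<nexists>f. is_partner (m, p) f \<Longrightarrow> drains m"
| step: "is_partner (m, p) (m', p') \<Longrightarrow> drains m' \<Longrightarrow> drains m"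

definition cube_edges :: "(real^3) set" where
  "cube_edges = {\<xi> \<in> K. \<exists>d. \<bar>\<xi> $ (d + 1)\<bar> = 1 \<and> \<bar>\<xi> $ (d + 2)\<bar> = 1}"

lemma cube_edges_cases:
  assumes "\<xi> \<in> K" "\<xi> \<notin> cube_edges"
  shows "\<xi> \<in> Ki \<or> (\<exists>d. \<bar>\<xi> $ d\<bar> = 1 \<and> (\<forall>i. i \<noteq> d \<longrightarrow> \<bar>\<xi> $ i\<bar> < 1))"
proof (cases "\<exists>d. \<bar>\<xi> $ d\<bar> = 1")
  case True
  then obtain d where d: "\<bar>\<xi> $ d\<bar> = 1" by blast
  have ne: "\<not> (\<bar>\<xi> $ (e + 1)\<bar> = 1 \<and> \<bar>\<xi> $ (e + 2)\<bar> = 1)" for e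
    using assms unfolding cube_edges_def by blast
  have e: "d + 1 + 2 = d" "d + 2 + 1 = d" "d + 2 + 2 = d + 1" "d + 1 + 1 = d + 2"
    using exhaust_3[of d] by (elim disjE; simp)+
  have "\<bar>\<xi> $ (d + 1)\<bar> \<noteq> 1" using ne[of "d + 2"] d unfolding e by blast
  moreover have "\<bar>\<xi> $ (d + 2)\<bar> \<noteq> 1" using ne[of "d + 1"] d unfolding e by blast
  moreover have "\<bar>\<xi> $ i\<bar> \<le> 1" for i using assms(1) by (simp add: ref_cube_mem)
  ultimately have "\<bar>\<xi> $ i\<bar> < 1" if "i \<noteq> d" for i
    using three_cases[of i d] that by (metis less_le)
  then show ?thesis using d by blast
next
  case False
  then have "\<bar>\<xi> $ i\<bar> < 1" for i using assms(1) by (simp add: ref_cube_mem less_le)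
  then show ?thesis by (simp add: ref_cube_mem_interior)
qed

text \<open>The lines in direction \<open>v\<close> through an edge form a set with two parameters,
  one along the edge and one along the line. It is the differentiable image of a piece of a plane,
  hence null in space.\<close>

lemma negligible_edge_cylinder:
  assumes m: "m < n"
  shows "negligible {y. \<exists>\<xi>\<in>cube_edges. \<exists>t. y = \<Phi> m \<xi> + t *\<^sub>R v}"
proof -
  \<comment> \<open>The edge runs in direction \<open>d\<close> through the vertex \<open>c\<close>.
    Coordinate \<open>d\<close> is the parameter along the edge, \<open>d + 1\<close> that along the
    line; on \<open>D d\<close> the coordinate \<open>d + 2\<close> is zero, which makes the domain
    negligible without changing the dimension.\<close>
  define g where "g d c \<eta> = \<Phi> m (upd c d (\<eta> $ d)) + \<eta> $ (d + 1) *\<^sub>R v" for d :: 3 and c \<eta> :: "real^3"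
  define D where "D d = {\<eta> :: real^3. \<eta> $ (d + 2) = 0 \<and> \<bar>\<eta> $ d\<bar> \<le> 1}" for d
  define V where "V = {c :: real^3. \<forall>i. c $ i \<in> {-1, 1}}"
  have finV: "finite V"
  proof -
    have "V = vec_lambda ` (PiE UNIV (\<lambda>_. {-1, 1}))"
    proof safe
      fix c assume "c \<in> V"
      then have "($) c \<in> PiE UNIV (\<lambda>_. {-1, 1})" by (auto simp: V_def)
      then show "c \<in> vec_lambda ` (PiE UNIV (\<lambda>_. {-1, 1}))" by (metis image_eqI vec_nth_inverse)
    qed (auto simp: V_def PiE_iff)
    then show ?thesis by (simp add: finite_PiE)
  qed
  have neg: "negligible (g d c ` D d)" if c: "c \<in> V" for d c
  proof (rule negligible_differentiable_image_negligible)
    have "negligible {\<eta> :: real^3. \<eta> $ (d + 2) = 0}" by (rule negligible_standard_hyperplane_cart)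
    then show "negligible (D d)" by (rule negligible_subset) (auto simp: D_def)
    show "g d c differentiable_on D d"
      unfolding differentiable_on_def
    proof
      fix \<eta> assume \<eta>: "\<eta> \<in> D d"
      have cK: "upd c d t \<in> K" if "\<bar>t\<bar> \<le> 1" for t
        unfolding ref_cube_mem
      proof
        fix i show "\<bar>upd c d t $ i\<bar> \<le> 1" using c that unfolding V_def by (cases "i = d") (auto dest: spec[of _ i])
      qed
      have nth: "((\<lambda>\<eta>. \<eta> $ d) has_derivative (\<lambda>h. h $ d)) (at \<eta> within D d)"
        by (rule bounded_linear.has_derivative[OF bounded_linear_vec_nth has_derivative_ident])
      have "((\<lambda>\<eta>. upd c d (\<eta> $ d)) has_derivative (\<lambda>h. (h $ d) *\<^sub>R axis d 1)) (at \<eta> within D d)"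
        by (rule has_derivative_in_compose[OF nth upd_derivative])
      then have "(\<lambda>\<eta>. upd c d (\<eta> $ d)) differentiable (at \<eta> within D d)"
        unfolding differentiable_def by blast
      moreover have "\<Phi> m differentiable (at (upd c d (\<eta> $ d)) within (\<lambda>\<eta>. upd c d (\<eta> $ d)) ` D d)"
        unfolding differentiable_def
        using has_derivative_subset[OF C1_jac(1)[OF m cK[of "\<eta> $ d"]], of "(\<lambda>\<eta>. upd c d (\<eta> $ d)) ` D d"] \<eta> cK
        unfolding D_def by blast
      ultimately have "(\<lambda>\<eta>. \<Phi> m (upd c d (\<eta> $ d))) differentiable (at \<eta> within D d)"
        using differentiable_chain_within[of "\<lambda>\<eta>. upd c d (\<eta> $ d)" \<eta> "D d" "\<Phi> m"] by (simp add: o_def)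
      moreover have "(\<lambda>\<eta>. \<eta> $ (d + 1) *\<^sub>R v) differentiable (at \<eta> within D d)"
        unfolding differentiable_def by (rule exI) (rule derivative_eq_intros bounded_linear.has_derivative[OF bounded_linear_vec_nth] has_derivative_ident refl)+
      ultimately show "g d c differentiable (at \<eta> within D d)"
        unfolding g_def by (rule differentiable_add)
    qed
  qed simp
  show ?thesis
  proof (rule negligible_subset)
    show "negligible (\<Union>(d, c) \<in> UNIV \<times> V. g d c ` D d)"
      by (rule negligible_Union) (use finV neg in auto)
    show "{y. \<exists>\<xi>\<in>cube_edges. \<exists>t. y = \<Phi> m \<xi> + t *\<^sub>R v} \<subseteq> (\<Union>(d, c) \<in> UNIV \<times> V. g d c ` D d)"
    proof safe
      fix \<xi> t assume \<xi>: "\<xi> \<in> cube_edges"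
      then obtain d where d: "\<bar>\<xi> $ (d + 1)\<bar> = 1" "\<bar>\<xi> $ (d + 2)\<bar> = 1" "\<xi> \<in> K"
        unfolding cube_edges_def by blast
      define c where "c = upd \<xi> d 1"
      have "\<bar>c $ i\<bar> = 1" for i using three_cases[of i d] d by (auto simp: c_def)
      then have "c \<in> V" by (auto simp: V_def abs_if split: if_splits) (metis minus_minus)+
      define \<eta> where "\<eta> = emb d (\<xi> $ d) (t, 0)"
      have "\<eta> \<in> D d" using d(3) by (simp add: D_def \<eta>_def ref_cube_mem)
      moreover have "\<Phi> m \<xi> + t *\<^sub>R v = g d c \<eta>" by (simp add: g_def c_def \<eta>_def)
      ultimately show "\<Phi> m \<xi> + t *\<^sub>R v \<in> (\<Union>(d, c) \<in> UNIV \<times> V. g d c ` D d)"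
        using \<open>c \<in> V\<close> by blast
    qed
  qed
qed

text \<open>Otherwise the union of the elements that do not drain would have its whole boundary on the
  element edges; but almost every line in a fixed direction avoids the edges.\<close>
lemma all_drain:
  assumes "m\<^sub>0 < n" shows "drains m\<^sub>0"
proof (rule ccontr)
  assume "\<not> drains m\<^sub>0"
  define C where "C = {m. m < n \<and> \<not> drains m}"
  define U where "U = (\<Union>m\<in>C. elem m)"
  have finC: "finite C" by (simp add: C_def)
  have Cn: "m < n" if "m \<in> C" for m using that by (simp add: C_def)
  have "m\<^sub>0 \<in> C" using assms \<open>\<not> drains m\<^sub>0\<close> by (simp add: C_def)
  have compU: "compact U" unfolding U_def by (rule compact_UN[OF finC]) (rule compact_elem[OF Cn])
  \<comment> \<open>Every facet of an element that does not drain has a partner, and the partner's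
    element does not drain either. So a relatively interior facet point has a neighbourhood inside
    \<open>U\<close>.\<close>
  have nb: "\<Phi> m \<xi> \<in> interior U" if m: "m \<in> C" and \<xi>: "\<xi> \<in> K" "\<xi> \<notin> cube_edges" for m \<xi>
    using cube_edges_cases[OF \<xi>]
  proof
    assume "\<xi> \<in> Ki"
    then have "\<Phi> m \<xi> \<in> interior (elem m)" unfolding interior_elem[OF Cn[OF m]] by (rule imageI)
    moreover have "elem m \<subseteq> U" using m unfolding U_def by blast
    ultimately show ?thesis using interior_mono by blast
  next
    assume "\<exists>d. \<bar>\<xi> $ d\<bar> = 1 \<and> (\<forall>i. i \<noteq> d \<longrightarrow> \<bar>\<xi> $ i\<bar> < 1)"
    then obtain d where d: "\<bar>\<xi> $ d\<bar> = 1" "\<And>i. i \<noteq> d \<Longrightarrow> \<bar>\<xi> $ i\<bar> < 1" by blast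
    define s where "s = \<xi> $ d"
    have s: "s \<in> {-1, 1}" using d(1) unfolding s_def by (auto simp: abs_if split: if_splits)
    have f: "(m, d, s) \<in> facets" using Cn[OF m] s by (simp add: facets_def)
    have nd: "\<not> drains m" using m by (simp add: C_def)
    then obtain g where "is_partner (m, d, s) g" using outer[OF f] by blast
    moreover obtain m' d' s' where "g = (m', d', s')" by (metis prod.exhaust)
    ultimately have p: "is_partner (m, d, s) (m', d', s')" by simp
    then have "\<not> drains m'" using step nd by blast
    then have "m' \<in> C" using is_partner_facets[OF p] by (simp add: C_def facets_def)
    obtain \<sigma> where g: "glued m d s m' d' s' \<sigma>" using p by (auto simp: is_partner_def)
    have "\<xi> \<in> ref_facet d s" using \<xi>(1) by (simp add: ref_facet_mem s_def)
    then obtain V where "open V" "\<Phi> m \<xi> \<in> V" "V \<subseteq> elem m \<union> elem m'"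
      using glued_local_nbhd[OF g] d(2) by blast
    moreover have "elem m \<union> elem m' \<subseteq> U" using m \<open>m' \<in> C\<close> unfolding U_def by blast
    ultimately show ?thesis by (meson interiorI subset_trans)
  qed
  define v :: "real^3" where "v = axis 1 1"
  have nv: "norm v = 1" by (simp add: v_def)
  define Z where "Z = (\<Union>m\<in>C. {y. \<exists>\<xi>\<in>cube_edges. \<exists>t. y = \<Phi> m \<xi> + t *\<^sub>R v})"
  have negZ: "negligible Z" unfolding Z_def
    by (rule negligible_Union) (use finC negligible_edge_cylinder Cn in auto)
  have "0 \<in> Ki" by (simp add: ref_cube_mem_interior)
  then have "\<Phi> m\<^sub>0 ` Ki \<noteq> {}" by blast
  then have "\<not> negligible (\<Phi> m\<^sub>0 ` Ki)" by (rule open_not_negligible[OF open_Phi_Ki[OF assms]])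
  then have "\<not> \<Phi> m\<^sub>0 ` Ki \<subseteq> Z" using negZ negligible_subset by blast
  then obtain y where y: "y \<in> \<Phi> m\<^sub>0 ` Ki" "y \<notin> Z" by blast
  have yU: "y \<in> U" using y(1) \<open>m\<^sub>0 \<in> C\<close> interior_subset unfolding U_def elem_def by blast
  obtain B where B: "\<And>x. x \<in> U \<Longrightarrow> norm x \<le> B" using compact_imp_bounded[OF compU] bounded_iff by metis
  \<comment> \<open>Long enough for the norm of \<open>y + T *\<^sub>R v\<close> to exceed the bound
    \<open>B\<close> for \<open>U\<close>.\<close>
  define T where "T = B + norm y + 1"
  have "B \<ge> 0" using B[OF yU] norm_ge_zero[of y] by linarith
  have "norm (y + T *\<^sub>R v) \<ge> norm (T *\<^sub>R v) - norm y"
    using norm_triangle_ineq4[of "y + T *\<^sub>R v" y] by simp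
  then have "norm (y + T *\<^sub>R v) > B" using nv \<open>B \<ge> 0\<close> by (simp add: T_def)
  then have out: "y + T *\<^sub>R v \<notin> U" using B by fastforce
  let ?S = "closed_segment y (y + T *\<^sub>R v)"
  \<comment> \<open>The segment has to leave \<open>U\<close> and can do so only at a point of an
    edge; but then \<open>y\<close> is on a line through an edge, that is, in
    \<open>Z\<close>.\<close>
  have "?S \<inter> frontier U \<noteq> {}"
    by (rule connected_Int_frontier) (use yU out in auto)
  then obtain z where z: "z \<in> ?S" "z \<in> frontier U" by blast
  obtain r where r: "z = y + r *\<^sub>R v"
  proof -
    from z(1) obtain u where "z = (1 - u) *\<^sub>R y + u *\<^sub>R (y + T *\<^sub>R v)" unfolding in_segment by blast
    then have "z = y + (u * T) *\<^sub>R v" by (simp add: algebra_simps)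
    then show ?thesis by (rule that)
  qed
  have "z \<in> U" "z \<notin> interior U"
    using z(2) compact_imp_closed[OF compU] by (auto simp: frontier_def)
  then obtain m \<xi> where m: "m \<in> C" "\<xi> \<in> K" "z = \<Phi> m \<xi>" unfolding U_def elem_def by blast
  then have "\<xi> \<in> cube_edges" using nb[OF m(1,2)] \<open>z \<notin> interior U\<close> by blast
  moreover have "y = \<Phi> m \<xi> + (- r) *\<^sub>R v" using r m(3) by simp
  ultimately have "y \<in> Z" using m(1) unfolding Z_def by blast
  then show False using y(2) by blast
qed

text \<open>\<open>a (m, d, s)\<close> stands for an outward value on the facet
  \<open>(d, s)\<close> of element \<open>m\<close>: what leaves an element enters its neighbour.
  Facets without partner are unconstrained.\<close>

definition is_flow :: "(nat \<times> 3 \<times> real \<Rightarrow> real) \<Rightarrow> bool" where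
  "is_flow a \<longleftrightarrow> (\<forall>f g. is_partner f g \<longrightarrow> a g = - a f)"

definition excess :: "(nat \<times> 3 \<times> real \<Rightarrow> real) \<Rightarrow> nat \<Rightarrow> real" where
  "excess a m = (\<Sum>p\<in>UNIV \<times> {-1, 1}. a (m, p))"

lemma excess_indicator:
  assumes "f \<in> facets"
  shows "excess (\<lambda>h. if h = f then 1 else 0) m = (if m = fst f then 1 else 0)"
proof -
  obtain m' p where f: "f = (m', p)" by (metis prod.exhaust)
  have p: "p \<in> UNIV \<times> {-1, 1}" using assms by (auto simp: f facets_def)
  have "excess (\<lambda>h. if h = f then 1 else 0) m = (\<Sum>q\<in>UNIV \<times> {-1, 1}. if q = p then (if m = m' then 1 else 0) else 0)"
    unfolding excess_def f by (rule sum.cong) auto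
  also have "\<dots> = (if m = m' then 1 else 0)" using p by (subst sum.delta) auto
  finally show ?thesis by (simp add: f)
qed

text \<open>At an outlet the unit leaves directly. Otherwise one unit is pushed through the shared
  facet, which moves the excess to the next element, and then follows the flow already found
  there.\<close>

lemma unit_flow:
  assumes "drains m"
  shows "\<exists>a. is_flow a \<and> (\<forall>m'. excess a m' = (if m' = m then 1 else 0))"
  using assms
proof (induction rule: drains.induct)
  case (outer m p)
  have "is_flow (\<lambda>h. if h = (m, p) then 1 else 0)"
    unfolding is_flow_def
  proof (intro allI impI)
    fix f g assume "is_partner f g"
    then have "f \<noteq> (m, p)" "g \<noteq> (m, p)" using outer(2) is_partner_sym by blast+
    then show "(if g = (m, p) then 1 else 0) = - (if f = (m, p) then 1 else 0 :: real)" by simp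
  qed
  then show ?case using excess_indicator[OF outer(1)] by (intro exI) auto
next
  case (step m p m' p')
  then obtain a where a: "is_flow a" "\<And>k. excess a k = (if k = m' then 1 else 0)" by blast
  let ?f = "(m, p)" and ?g = "(m', p')"
  have fg: "?f \<in> facets" "?g \<in> facets" "m \<noteq> m'" using is_partner_facets[OF step(1)] by auto
  define b where "b h = a h + (if h = ?f then 1 else 0) - (if h = ?g then 1 else 0)" for h
  have "is_flow b"
    unfolding is_flow_def
  proof (intro allI impI)
    fix h k assume hk: "is_partner h k"
    have "k = ?f \<longleftrightarrow> h = ?g"
      using hk step(1) is_partner_sym is_partner_unique by metis
    moreover have "k = ?g \<longleftrightarrow> h = ?f"
      using hk step(1) is_partner_sym is_partner_unique by metis
    moreover have "a k = - a h" using a(1) hk unfolding is_flow_def by blast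
    ultimately show "b k = - b h" by (simp add: b_def)
  qed
  moreover have "excess b k = (if k = m then 1 else 0)" for k
  proof -
    have "excess b k = excess a k + excess (\<lambda>h. if h = ?f then 1 else 0) k - excess (\<lambda>h. if h = ?g then 1 else 0) k"
      unfolding excess_def b_def by (simp only: sum.distrib sum_subtractf)
    then show ?thesis unfolding excess_indicator[OF fg(1)] excess_indicator[OF fg(2)] a(2) using fg(3) by simp
  qed
  ultimately show ?case by blast
qed

lemma flow_exists: "\<exists>a. is_flow a \<and> (\<forall>m<n. excess a m = c m)"
proof -
  obtain a where a: "\<And>k. k < n \<Longrightarrow> is_flow (a k)"
    "\<And>k m. k < n \<Longrightarrow> excess (a k) m = (if m = k then 1 else 0)"
    using unit_flow[OF all_drain] by metis
  define b where "b f = (\<Sum>k<n. c k * a k f)" for f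
  have "is_flow b"
    unfolding is_flow_def
  proof (intro allI impI)
    fix f g assume "is_partner f g"
    then have "a k g = - a k f" if "k < n" for k using a(1)[OF that] unfolding is_flow_def by blast
    then show "b g = - b f" unfolding b_def sum_negf[symmetric] by (intro sum.cong) auto
  qed
  moreover have "excess b m = c m" if "m < n" for m
  proof -
    have "excess b m = (\<Sum>k<n. c k * excess (a k) m)"
      unfolding excess_def b_def by (subst sum.swap) (simp only: sum_distrib_left)
    also have "\<dots> = (\<Sum>k<n. if k = m then c m else 0)" by (rule sum.cong) (auto simp: a(2))
    finally show ?thesis using that by simp
  qed
  ultimately show ?thesis by blast
qed

lemma matched_field_exists:
  assumes g: "\<And>m. m < n \<Longrightarrow> g m \<in> S_ref N"
  shows "\<exists>u w. matched u \<and> (\<forall>m<n. u m \<in> D_ref N \<and> partials (u m) (w m) \<and>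
    (\<forall>d. w m d \<in> S_ref N) \<and> (\<forall>\<xi>. (\<Sum>d\<in>UNIV. w m d \<xi>) = g m \<xi>))"
proof -
  define R where "R a m u w \<longleftrightarrow> u \<in> D_ref N \<and> partials u w \<and> (\<forall>\<xi>. (\<Sum>d\<in>UNIV. w d \<xi>) = g m \<xi>) \<and>
      (\<forall>\<xi> d. \<bar>\<xi> $ d\<bar> = 1 \<longrightarrow> u \<xi> $ d = a d (\<xi> $ d))" for a m u w
  define S where "S m c \<longleftrightarrow> (\<forall>a. (\<Sum>d\<in>UNIV. (a d 1 - a d (-1)) / 2) = c \<longrightarrow> (\<exists>u w. R a m u w))" for m c
  have "\<exists>c. S m c" if "m < n" for m
    using facet_constant_field[OF N_pos g[OF that]] unfolding S_def R_def by (simp only: Bex_def ex_simps)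
  then obtain c where c: "\<And>m. m < n \<Longrightarrow> S m (c m)" by metis
  \<comment> \<open>\<open>b\<close> will hold outward values, so the component in direction
    \<open>d\<close> on the facet \<open>(d, s)\<close> is \<open>s * b (m, d, s)\<close>. Half the
    difference of these components at \<open>s = 1\<close> and \<open>s = -1\<close> is half the sum
    of the outward values; hence the factor 2.\<close>
  obtain b where b: "is_flow b" "\<And>m. m < n \<Longrightarrow> excess b m = 2 * c m"
    using flow_exists[of "\<lambda>m. 2 * c m"] by blast
  have "(\<Sum>d\<in>UNIV. (1 * b (m, d, 1) - (-1) * b (m, d, -1)) / 2) = c m" if "m < n" for m
  proof -
    have "excess b m = (\<Sum>d\<in>UNIV. \<Sum>s\<in>{-1, 1}. b (m, d, s))"
      unfolding excess_def by (simp only: sum.cartesian_product case_prod_unfold prod.collapse)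
    then have "(\<Sum>d\<in>UNIV. b (m, d, 1) + b (m, d, -1)) = 2 * c m" using b(2)[OF that] by (simp add: add.commute)
    then show ?thesis by (simp add: sum_divide_distrib[symmetric])
  qed
  note balance = this
  have "\<exists>u w. R (\<lambda>d s. s * b (m, d, s)) m u w" if m: "m < n" for m
    using mp[OF spec[OF c[OF m, unfolded S_def], of "\<lambda>d s. s * b (m, d, s)"] balance[OF m]] .
  then obtain u w where "\<And>m. m < n \<Longrightarrow> R (\<lambda>d s. s * b (m, d, s)) m (u m) (w m)" by metis
  then have uw: "\<And>m. m < n \<Longrightarrow> u m \<in> D_ref N" "\<And>m. m < n \<Longrightarrow> partials (u m) (w m)"
    "\<And>m \<xi>. m < n \<Longrightarrow> (\<Sum>d\<in>UNIV. w m d \<xi>) = g m \<xi>"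
    "\<And>m \<xi> d. m < n \<Longrightarrow> \<bar>\<xi> $ d\<bar> = 1 \<Longrightarrow> u m \<xi> $ d = \<xi> $ d * b (m, d, \<xi> $ d)"
    unfolding R_def by blast+
  have "w m d \<in> S_ref N" if m: "m < n" for m d
  proof -
    obtain w' where w': "\<And>d. w' d \<in> S_ref N" "partials (u m) w'" using D_ref_partials[OF uw(1)[OF m]] by blast
    then have "w m d = w' d" using partials_unique[OF uw(2)[OF m] w'(2)] by blast
    then show ?thesis using w'(1) by simp
  qed
  moreover have "matched u"
    unfolding matched_def
  proof (intro allI impI ballI)
    fix m d s m' d' s' \<sigma> \<xi>
    assume gl: "glued m d s m' d' s' \<sigma>" and \<xi>: "\<xi> \<in> ref_facet d s"
    have s: "s \<in> {-1, 1}" "s' \<in> {-1, 1}" "m < n" "m' < n" using gl by (auto simp: glued_def)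
    have x: "\<xi> $ d = s" "\<sigma> \<xi> $ d' = s'" using \<xi> glued_in_facet[OF gl, of \<xi>] by (auto simp: ref_facet_mem)
    have "u m \<xi> $ d = s * b (m, d, s)" using uw(4)[OF s(3), of \<xi> d] x(1) s(1) by auto
    moreover have "u m' (\<sigma> \<xi>) $ d' = s' * b (m', d', s')" using uw(4)[OF s(4), of "\<sigma> \<xi>" d'] x(2) s(2) by auto
    moreover have "b (m', d', s') = - b (m, d, s)"
      using b(1) gl unfolding is_flow_def is_partner_def by blast
    ultimately show "s' * u m' (\<sigma> \<xi>) $ d' = - (s * u m \<xi> $ d)" using s(1,2) by auto
  qed
  ultimately show ?thesis using uw by blast
qed

section \<open>Normal traces of Piola transformed fields\<close>

lemma piecewise_exists: "\<exists>q :: real^3 \<Rightarrow> 'b::real_vector. \<forall>m<n. \<forall>\<xi>\<in>Ki. q (\<Phi> m \<xi>) = h m \<xi>"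
proof -
  define q where "q x = (\<Sum>m<n. if x \<in> \<Phi> m ` Ki then h m (inv_Phi m x) else 0)" for x
  have "q (\<Phi> m \<xi>) = h m \<xi>" if m: "m < n" and \<xi>: "\<xi> \<in> Ki" for m \<xi>
  proof -
    have "q (\<Phi> m \<xi>) = (\<Sum>k<n. if k = m then h m \<xi> else 0)"
      unfolding q_def
    proof (rule sum.cong[OF refl])
      fix k assume k: "k \<in> {..<n}"
      show "(if \<Phi> m \<xi> \<in> \<Phi> k ` Ki then h k (inv_Phi k (\<Phi> m \<xi>)) else 0) = (if k = m then h m \<xi> else 0)"
      proof (cases "k = m")
        case True
        then show ?thesis using \<xi> m Ki_subset[OF \<xi>] by simp
      next
        case False
        have "\<Phi> m \<xi> \<in> elem m" using Ki_subset[OF \<xi>] by (simp add: elem_def)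
        then have "\<Phi> m \<xi> \<notin> \<Phi> k ` Ki" using elem_Int[of m k] m k False by blast
        then show ?thesis using False by simp
      qed
    qed
    then show ?thesis using m by simp
  qed
  then show ?thesis by blast
qed

text \<open>\<open>h\<close> after \<open>inv_Phi m\<close> extends \<open>q\<close> continuously
  from the open element to the closed one, and each point of the element is a limit point of the
  interior, so the limit is unique.\<close>

lemma elem_trace_eq:
  assumes m: "m < n" and h: "continuous_on K h" and q: "\<And>\<xi>. \<xi> \<in> Ki \<Longrightarrow> q (\<Phi> m \<xi>) = h \<xi>"
    and \<xi>: "\<xi> \<in> K"
  shows "elem_trace m q (\<Phi> m \<xi>) = h \<xi>"
proof -
  let ?x = "\<Phi> m \<xi>"
  have xe: "?x \<in> elem m" using \<xi> by (simp add: elem_def)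
  have "continuous_on (elem m) (\<lambda>y. h (inv_Phi m y))"
    by (rule continuous_on_compose2[OF h inv_Phi_continuous[OF m]]) (auto intro: inv_Phi_in)
  then have "((\<lambda>y. h (inv_Phi m y)) \<longlongrightarrow> h (inv_Phi m ?x)) (at ?x within elem m)"
    using xe by (simp add: continuous_on)
  then have "((\<lambda>y. h (inv_Phi m y)) \<longlongrightarrow> h \<xi>) (at ?x within interior (elem m))"
    unfolding inv_Phi_Phi[OF m \<xi>] by (rule tendsto_within_subset[OF _ interior_subset])
  moreover have "(q \<longlongrightarrow> h \<xi>) (at ?x within interior (elem m)) \<longleftrightarrow>
      ((\<lambda>y. h (inv_Phi m y)) \<longlongrightarrow> h \<xi>) (at ?x within interior (elem m))"
  proof (rule Lim_cong_within[OF refl refl refl])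
    fix y assume "y \<in> interior (elem m)"
    then obtain \<eta> where "\<eta> \<in> Ki" "y = \<Phi> m \<eta>" unfolding interior_elem[OF m] by blast
    then show "q y = h (inv_Phi m y)" using q m Ki_subset by simp
  qed
  ultimately have "(q \<longlongrightarrow> h \<xi>) (at ?x within interior (elem m))" by blast
  moreover have "\<not> trivial_limit (at ?x within interior (elem m))"
  proof -
    have "?x islimpt closure (\<Phi> m ` Ki)"
      by (rule islimpt_closure_open[OF open_Phi_Ki[OF m] refl]) (use closure_Phi_Ki[OF m] xe in blast)
    then have "?x islimpt interior (elem m)" unfolding limpt_of_closure interior_elem[OF m] .
    then show ?thesis by (simp add: trivial_limit_within)
  qed
  ultimately show ?thesis unfolding elem_trace_def by (rule tendsto_Lim[rotated])
qed

definition piola :: "(nat \<Rightarrow> real^3 \<Rightarrow> real^3) \<Rightarrow> nat \<Rightarrow> real^3 \<Rightarrow> real^3" where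
  "piola u m \<xi> = (1 / det (jac m \<xi>)) *\<^sub>R (jac m \<xi> *v u m \<xi>)"

lemma piola_continuous:
  assumes "m < n" "u m \<in> D_ref N" shows "continuous_on K (piola u m)"
proof -
  have "continuous_on K (\<lambda>\<xi>. jac m \<xi> *v u m \<xi>)"
    unfolding matrix_vector_mult_def
    by (intro continuous_on_vec_lambda continuous_intros jac_entry_continuous assms(1)
        continuous_on_D_ref[OF assms(2)])
  moreover have "det (jac m \<xi>) \<noteq> 0" if "\<xi> \<in> K" for \<xi> using det_jac_pos[OF assms(1) that] by simp
  ultimately show ?thesis unfolding piola_def[abs_def]
    by (intro continuous_intros det_jac_continuous assms(1)) auto
qed

lemma piola_inner_area_vector:
  assumes "m < n" "\<xi> \<in> K" shows "piola u m \<xi> \<bullet> area_vector m d \<xi> = u m \<xi> $ d"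
  using det_jac_pos[OF assms] by (simp add: piola_def inner_area_vector)

lemma piola_inner_area_vector_glued:
  assumes g: "glued m d s m' d' s' \<sigma>" and \<xi>: "\<xi> \<in> ref_facet d s"
  shows "piola u m' (\<sigma> \<xi>) \<bullet> area_vector m d \<xi> = - (s * s' * u m' (\<sigma> \<xi>) $ d')"
proof -
  have "m' < n" "\<sigma> \<xi> \<in> K" using g \<xi> by (auto simp: glued_def ref_facet_mem glued_in_cube[OF g])
  then have "det (jac m' (\<sigma> \<xi>)) > 0" by (rule det_jac_pos)
  then show ?thesis by (simp add: piola_def glued_inner_area_vector[OF g \<xi>] glued_det[OF g])
qed

text \<open>Both traces are tested against the area vector of the side \<open>m\<close>. From that
  side the result is the reference component itself, from the other side the reference component
  with factor \<open>- (s * s')\<close>, by \<open>glued_det\<close>.\<close>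

lemma matched_iff_traces:
  assumes u: "\<And>m. m < n \<Longrightarrow> u m \<in> D_ref N"
    and q: "\<And>m \<xi>. m < n \<Longrightarrow> \<xi> \<in> Ki \<Longrightarrow> q (\<Phi> m \<xi>) = piola u m \<xi>"
    and g: "glued m d s m' d' s' \<sigma>" and \<xi>: "\<xi> \<in> ref_facet d s"
  shows "s' * u m' (\<sigma> \<xi>) $ d' = - (s * u m \<xi> $ d) \<longleftrightarrow>
    elem_trace m q (\<Phi> m \<xi>) \<bullet> area_vector m d \<xi> = elem_trace m' q (\<Phi> m \<xi>) \<bullet> area_vector m d \<xi>"
proof -
  have m: "m < n" "m' < n" "s \<in> {-1, 1}" "s' \<in> {-1, 1}" using g by (auto simp: glued_def)
  have \<xi>K: "\<xi> \<in> K" "\<sigma> \<xi> \<in> K" using \<xi> by (auto simp: ref_facet_mem glued_in_cube[OF g])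
  have "elem_trace m q (\<Phi> m \<xi>) = piola u m \<xi>"
    by (rule elem_trace_eq[OF m(1) piola_continuous[where u = u, OF m(1) u[OF m(1)]] q[OF m(1)] \<xi>K(1)])
  moreover have "elem_trace m' q (\<Phi> m' (\<sigma> \<xi>)) = piola u m' (\<sigma> \<xi>)"
    by (rule elem_trace_eq[OF m(2) piola_continuous[where u = u, OF m(2) u[OF m(2)]] q[OF m(2)] \<xi>K(2)])
  ultimately show ?thesis
    using m(3,4) unfolding glued_Phi[OF g \<xi>]
    by (auto simp: piola_inner_area_vector[OF m(1) \<xi>K(1)] piola_inner_area_vector_glued[OF g \<xi>])
qed

lemma D_spaceE:
  assumes "q \<in> D_space"
  obtains u where "\<And>m. m < n \<Longrightarrow> u m \<in> D_ref N"
    "\<And>m \<xi>. m < n \<Longrightarrow> \<xi> \<in> Ki \<Longrightarrow> q (\<Phi> m \<xi>) = piola u m \<xi>" "matched u"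
proof -
  have "\<forall>m<n. \<exists>u\<in>D_ref N. \<forall>\<xi>\<in>Ki. q (\<Phi> m \<xi>) = (1 / det (jac m \<xi>)) *\<^sub>R (jac m \<xi> *v u \<xi>)"
    using assms unfolding D_space_def by blast
  then obtain u where u: "\<And>m. m < n \<Longrightarrow> u m \<in> D_ref N"
    "\<And>m \<xi>. m < n \<Longrightarrow> \<xi> \<in> Ki \<Longrightarrow> q (\<Phi> m \<xi>) = piola u m \<xi>" unfolding piola_def by metis
  have tr: "elem_trace m q (\<Phi> m \<xi>) \<bullet> area_vector m d \<xi> = elem_trace m' q (\<Phi> m \<xi>) \<bullet> area_vector m d \<xi>"
    if "m < n" "m' < n" "s \<in> {-1, 1}" "m \<noteq> m'" "\<Phi> m ` ref_facet d s \<subseteq> elem m'" "\<xi> \<in> ref_facet d s"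
    for m m' d s \<xi>
    using assms that unfolding D_space_def by blast
  have "matched u" unfolding matched_def
  proof (intro allI impI ballI)
    fix m d s m' d' s' \<sigma> \<xi>
    assume gl: "glued m d s m' d' s' \<sigma>" and \<xi>: "\<xi> \<in> ref_facet d s"
    have "\<Phi> m ` ref_facet d s \<subseteq> elem m'" using gl unfolding glued_def by blast
    then have "elem_trace m q (\<Phi> m \<xi>) \<bullet> area_vector m d \<xi> = elem_trace m' q (\<Phi> m \<xi>) \<bullet> area_vector m d \<xi>"
      using tr[of m m' s d \<xi>] gl \<xi> unfolding glued_def by blast
    then show "s' * u m' (\<sigma> \<xi>) $ d' = - (s * u m \<xi> $ d)"
      by (subst matched_iff_traces[where u = u and q = q, OF _ _ gl \<xi>]) (rule u; assumption | assumption)+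
  qed
  then show ?thesis using that u by blast
qed

lemma D_spaceI:
  assumes u: "\<And>m. m < n \<Longrightarrow> u m \<in> D_ref N" "matched u"
    and q: "\<And>m \<xi>. m < n \<Longrightarrow> \<xi> \<in> Ki \<Longrightarrow> q (\<Phi> m \<xi>) = piola u m \<xi>" and div: "has_divergence \<Omega> q g"
  shows "q \<in> D_space"
  unfolding D_space_def
proof (intro CollectI conjI allI impI ballI)
  show "q \<in> Hdiv \<Omega>" using div unfolding Hdiv_def by blast
  show "\<exists>u\<in>D_ref N. \<forall>\<xi>\<in>Ki. q (\<Phi> m \<xi>) = (1 / det (jac m \<xi>)) *\<^sub>R (jac m \<xi> *v u \<xi>)" if "m < n" for m
    by (rule bexI[OF _ u(1)[OF that]]) (use q[OF that] in \<open>auto simp: piola_def\<close>)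
  fix m m' d s \<xi>
  assume m: "m < n" "m' < n" "s \<in> {-1, 1::real}" "m \<noteq> m' \<and> \<Phi> m ` ref_facet d s \<subseteq> elem m'"
    and \<xi>: "\<xi> \<in> ref_facet d s"
  obtain d' s' \<sigma> where g: "glued m d s m' d' s' \<sigma>"
    using glued_exists[OF m(1,2) conjunct1[OF m(4)] m(3) conjunct2[OF m(4)]] by blast
  have "s' * u m' (\<sigma> \<xi>) $ d' = - (s * u m \<xi> $ d)" using u(2) g \<xi> unfolding matched_def by blast
  then show "elem_trace m q (\<Phi> m \<xi>) \<bullet> area_vector m d \<xi> = elem_trace m' q (\<Phi> m \<xi>) \<bullet> area_vector m d \<xi>"
    by (subst matched_iff_traces[where u = u and q = q, OF _ _ g \<xi>, symmetric]) (rule u(1) q; assumption | assumption)+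
qed

lemma divergence_surjective:
  assumes p: "p \<in> S_space"
  shows "\<exists>q\<in>D_space. has_divergence \<Omega> q p"
proof -
  have "\<forall>m<n. \<exists>g\<in>S_ref N. \<forall>\<xi>\<in>Ki. p (\<Phi> m \<xi>) = g \<xi> / det (jac m \<xi>)"
    using p unfolding S_space_def by blast
  then obtain g where g: "\<And>m. m < n \<Longrightarrow> g m \<in> S_ref N"
    "\<And>m \<xi>. m < n \<Longrightarrow> \<xi> \<in> Ki \<Longrightarrow> p (\<Phi> m \<xi>) = g m \<xi> / det (jac m \<xi>)" by metis
  obtain u w where u: "matched u" "\<And>m. m < n \<Longrightarrow> u m \<in> D_ref N" "\<And>m. m < n \<Longrightarrow> partials (u m) (w m)"
    "\<And>m d. m < n \<Longrightarrow> w m d \<in> S_ref N" "\<And>m \<xi>. m < n \<Longrightarrow> (\<Sum>d\<in>UNIV. w m d \<xi>) = g m \<xi>"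
    using matched_field_exists[of g] g(1) by metis
  obtain q where q: "\<And>m \<xi>. m < n \<Longrightarrow> \<xi> \<in> Ki \<Longrightarrow> q (\<Phi> m \<xi>) = piola u m \<xi>"
    using piecewise_exists[of "piola u"] by blast
  have "has_divergence \<Omega> q p"
    by (rule piecewise_has_divergence[OF u(2,1,3,4)]) (auto simp: q piola_def g(2) u(5))
  then show ?thesis using D_spaceI[OF u(2,1) q] by blast
qed

end

section \<open>The basis of the small volumes\<close>

lemma has_real_derivative_max_square:
  "((\<lambda>s::real. (max 0 s)\<^sup>2) has_real_derivative 2 * max 0 s) (at s)"
proof -
  consider "s > 0" | "s < 0" | "s = 0" by linarith
  then show ?thesis
  proof cases
    case 1
    have "((\<lambda>s::real. s\<^sup>2) has_real_derivative 2 * s) (at s)" by (auto intro!: derivative_eq_intros)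
    then have "((\<lambda>s::real. (max 0 s)\<^sup>2) has_real_derivative 2 * s) (at s)"
      by (rule has_field_derivative_transform_within_open[of _ _ _ "{0<..}"]) (use 1 in auto)
    then show ?thesis using 1 by simp
  next
    case 2
    have "((\<lambda>s::real. 0::real) has_real_derivative 0) (at s)" by simp
    then have "((\<lambda>s::real. (max 0 s)\<^sup>2) has_real_derivative 0) (at s)"
      by (rule has_field_derivative_transform_within_open[of _ _ _ "{..<0}"]) (use 2 in auto)
    then show ?thesis using 2 by simp
  next
    case 3
    have "((\<lambda>h::real. ((max 0 (0 + h))\<^sup>2 - (max 0 0)\<^sup>2) / h) \<longlongrightarrow> 0) (at 0)"
    proof (rule Lim_null_comparison)
      show "\<forall>\<^sub>F h in at (0::real). norm (((max 0 (0 + h))\<^sup>2 - (max 0 0)\<^sup>2) / h) \<le> \<bar>h\<bar>"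
        by (rule always_eventually) (auto simp: max_def power2_eq_square)
      show "((\<lambda>h::real. \<bar>h\<bar>) \<longlongrightarrow> 0) (at 0)" by (rule tendsto_rabs_zero) (rule tendsto_ident_at)
    qed
    then show ?thesis using 3 by (simp add: DERIV_def)
  qed
qed

text \<open>A paraboloid cut off at zero, living on the ball with centre \<open>c\<close> and radius
  \<open>r\<close>. Squaring makes the gradient continuous across the sphere, as required of the
  test functions in \<open>has_divergence\<close>.\<close>

definition bump :: "real^3 \<Rightarrow> real \<Rightarrow> real^3 \<Rightarrow> real" where
  "bump c r x = (max 0 (r\<^sup>2 - (x - c) \<bullet> (x - c)))\<^sup>2"

lemma bump_gderiv: "GDERIV (bump c r) x :> (- 4 * max 0 (r\<^sup>2 - (x - c) \<bullet> (x - c))) *\<^sub>R (x - c)"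
proof -
  let ?s = "r\<^sup>2 - (x - c) \<bullet> (x - c)"
  have inner: "((\<lambda>x. r\<^sup>2 - (x - c) \<bullet> (x - c)) has_derivative (\<lambda>h. - (2 * (h \<bullet> (x - c))))) (at x)"
    by (auto intro!: derivative_eq_intros simp: inner_commute)
  have "((\<lambda>s. (max 0 s)\<^sup>2) has_derivative (*) (2 * max 0 ?s)) (at ?s)"
    using has_real_derivative_max_square unfolding has_field_derivative_def .
  from has_derivative_compose[OF inner this]
  have "(bump c r has_derivative (\<lambda>h. 2 * max 0 ?s * - (2 * (h \<bullet> (x - c))))) (at x)"
    unfolding bump_def[abs_def] .
  then show ?thesis unfolding gderiv_def by (simp add: algebra_simps)
qed

lemma bump_nonneg: "bump c r x \<ge> 0"
  by (simp add: bump_def)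

lemma bump_zero: "x \<notin> cball c r \<Longrightarrow> r > 0 \<Longrightarrow> bump c r x = 0"
proof -
  assume x: "x \<notin> cball c r" and r: "r > 0"
  then have "r < norm (x - c)" by (simp add: dist_norm norm_minus_commute)
  then have "r\<^sup>2 < (norm (x - c))\<^sup>2" using r by (simp add: power_strict_mono)
  then show ?thesis by (simp add: bump_def power2_norm_eq_inner)
qed

lemma bump_center: "r > 0 \<Longrightarrow> bump c r c > 0"
  by (simp add: bump_def)

lemma has_divergenceD:
  assumes "has_divergence \<Omega> u g" "\<And>x. GDERIV \<phi> x :> G x" "continuous_on UNIV G"
    "compact C" "C \<subseteq> \<Omega>" "\<And>x. x \<notin> C \<Longrightarrow> \<phi> x = 0"
  shows "integral \<Omega> (\<lambda>x. u x \<bullet> G x) = - integral \<Omega> (\<lambda>x. g x * \<phi> x)"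
proof -
  have "(\<forall>x. GDERIV \<phi> x :> G x) \<and> continuous_on UNIV G \<and> compact C \<and> C \<subseteq> \<Omega> \<and>
      (\<forall>x. x \<notin> C \<longrightarrow> \<phi> x = 0) \<longrightarrow> integral \<Omega> (\<lambda>x. u x \<bullet> G x) = - integral \<Omega> (\<lambda>x. g x * \<phi> x)"
    using assms(1) unfolding has_divergence_def by (elim conjE) (erule allE[of _ \<phi>], erule allE[of _ G], erule allE[of _ C])
  then show ?thesis using assms(2-6) by simp
qed

context gll_mesh begin

definition vol :: "nat \<Rightarrow> nat^3 \<Rightarrow> (real^3) set" where
  "vol m k = \<Phi> m ` vol_box N k"

lemma small_volumes_eq: "small_volumes = (\<lambda>(m, k). vol m k) ` ({..<n} \<times> vol_index N)"
  unfolding small_volumes_def vol_index_def vol_def by auto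

lemma finite_small_volumes: "finite small_volumes"
  unfolding small_volumes_eq by (intro finite_imageI finite_cartesian_product finite_lessThan finite_vol_index)

lemma vol_in_small_volumes: "m < n \<Longrightarrow> k \<in> vol_index N \<Longrightarrow> vol m k \<in> small_volumes"
  unfolding small_volumes_eq by auto

lemma gll_inj: "i \<le> N \<Longrightarrow> j \<le> N \<Longrightarrow> gll N i = gll N j \<Longrightarrow> i = j"
  using inj_gll[OF N_pos] by (auto dest: inj_onD)

text \<open>Degrees of freedom are indexed by sets, so different labels must give different sets.
  The centre of a grid box is interior to the cube, which determines the element; the corners then
  determine the index.\<close>

lemma vol_eqD:
  assumes m: "m < n" "m' < n" and k: "k \<in> vol_index N" "k' \<in> vol_index N" and eq: "vol m k = vol m' k'"
  shows "m = m' \<and> k = k'"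
proof -
  have lt: "gll N (k $ i) < gll N (k $ i + 1)" for i
    using gll_strict_mono[OF N_pos, of "k $ i" "k $ i + 1"] k(1) by (simp add: vol_index_def Suc_le_eq)
  define c :: "real^3" where "c = (\<chi> i. (gll N (k $ i) + gll N (k $ i + 1)) / 2)"
  have cb: "gll N (k $ i) < c $ i" "c $ i < gll N (k $ i + 1)" for i
    using lt[of i] by (simp_all add: c_def)
  have c: "c \<in> vol_box N k" unfolding vol_box_def mem_box_cart using cb by (auto intro: less_imp_le)
  have r: "-1 \<le> gll N (k $ i)" "gll N (k $ i + 1) \<le> 1" for i
    using gll_range[OF N_pos, of "k $ i"] gll_range[OF N_pos, of "k $ i + 1"] k(1)
    by (auto simp: vol_index_def Suc_le_eq less_imp_le)
  have "\<bar>c $ i\<bar> < 1" for i unfolding abs_less_iff using cb[of i] r[of i] by linarith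
  then have "c \<in> Ki" by (simp add: ref_cube_mem_interior)
  moreover have "\<Phi> m c \<in> elem m'"
    using imageI[OF c, of "\<Phi> m"] eq vol_box_subset[OF N_pos k(2)] unfolding vol_def elem_def by blast
  ultimately have mm: "m = m'" using elem_Int[OF m(2,1)] by blast
  have "vol_box N k = vol_box N k'"
    using eq inj_on_image_eq_iff[OF Phi_inj[OF m(2)] vol_box_subset[OF N_pos k(1)] vol_box_subset[OF N_pos k(2)]]
    unfolding vol_def mm by simp
  then have "(\<chi> i. gll N (k $ i)) = ((\<chi> i. gll N (k' $ i)) :: real^3)"
    using c unfolding vol_box_def eq_cbox by auto
  then have "gll N (k $ i) = gll N (k' $ i)" for i by (simp add: vec_eq_iff)
  then have "k = k'" using gll_inj k by (simp add: vec_eq_iff vol_index_def less_imp_le)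
  then show ?thesis using mm by blast
qed

definition S_pieces :: "(real^3 \<Rightarrow> real) \<Rightarrow> (nat \<Rightarrow> real^3 \<Rightarrow> real) \<Rightarrow> bool" where
  "S_pieces f g \<longleftrightarrow> (\<forall>m<n. g m \<in> S_ref N \<and> (\<forall>\<xi>\<in>Ki. f (\<Phi> m \<xi>) = g m \<xi> / det (jac m \<xi>)))"

lemma S_piecesD:
  assumes "S_pieces f g" "m < n"
  shows "g m \<in> S_ref N" "\<xi> \<in> Ki \<Longrightarrow> f (\<Phi> m \<xi>) = g m \<xi> / det (jac m \<xi>)"
  using assms unfolding S_pieces_def by blast+

lemma S_ref_continuous: "g \<in> S_ref N \<Longrightarrow> continuous_on S g"
  unfolding S_ref_def by (rule continuous_on_tensor_poly)

lemma S_pieces_continuous: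
  assumes "S_pieces f g" "m < n" shows "continuous_on K (\<lambda>\<xi>. g m \<xi> / det (jac m \<xi>))"
  by (intro continuous_intros S_ref_continuous[OF S_piecesD(1)[OF assms]] det_jac_continuous assms(2))
    (use det_jac_pos[OF assms(2)] in fastforce)

lemma S_spaceE:
  assumes "f \<in> S_space" obtains g where "S_pieces f g"
proof -
  have "\<forall>m<n. \<exists>g\<in>S_ref N. \<forall>\<xi>\<in>Ki. f (\<Phi> m \<xi>) = g \<xi> / det (jac m \<xi>)"
    using assms unfolding S_space_def by blast
  then obtain g where "\<And>m. m < n \<Longrightarrow> g m \<in> S_ref N"
    "\<And>m \<xi>. m < n \<Longrightarrow> \<xi> \<in> Ki \<Longrightarrow> f (\<Phi> m \<xi>) = g m \<xi> / det (jac m \<xi>)" by metis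
  then have "S_pieces f g" unfolding S_pieces_def by blast
  then show ?thesis by (rule that)
qed

lemma S_spaceI:
  assumes "S_pieces f g" shows "f \<in> S_space"
proof -
  have "L2_on \<Omega> f"
    by (rule piecewise_L2_on[OF S_pieces_continuous[OF assms]]) (auto simp: S_piecesD(2)[OF assms])
  then show ?thesis using assms unfolding S_space_def S_pieces_def by blast
qed

text \<open>The volume element cancels the denominator in the elements of \<open>S_space\<close>, so
  a degree of freedom is a box integral of the reference polynomial and does not involve the
  geometry.\<close>

lemma N3_vol:
  assumes f: "S_pieces f g" and m: "m < n" and k: "k \<in> vol_index N"
  shows "N3 f (vol m k) = integral (vol_box N k) (g m)"
proof -
  have "N3 f (vol m k) = integral (vol_box N k) (\<lambda>\<xi>. det (jac m \<xi>) * (g m \<xi> / det (jac m \<xi>)))"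
    unfolding N3_def vol_def
    by (rule Phi_change_of_variables(2)[OF m vol_box_subset[OF N_pos k] _ S_pieces_continuous[OF f m]])
      (auto simp: vol_box_def S_piecesD(2)[OF f m])
  also have "\<dots> = integral (vol_box N k) (g m)"
  proof (rule integral_cong)
    fix \<xi> assume "\<xi> \<in> vol_box N k"
    then have "det (jac m \<xi>) > 0" using vol_box_subset[OF N_pos k] det_jac_pos[OF m] by blast
    then show "det (jac m \<xi>) * (g m \<xi> / det (jac m \<xi>)) = g m \<xi>" by simp
  qed
  finally show ?thesis .
qed

lemma integral_sum_S_ref:
  assumes "finite A" "\<And>a. a \<in> A \<Longrightarrow> h a \<in> S_ref N"
  shows "integral (vol_box N k) (\<lambda>\<xi>. \<Sum>a\<in>A. c a * h a \<xi>) = (\<Sum>a\<in>A. c a * integral (vol_box N k) (h a))"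
proof -
  have "(\<lambda>\<xi>. c a * h a \<xi>) integrable_on vol_box N k" if "a \<in> A" for a
    unfolding vol_box_def by (intro integrable_continuous continuous_intros S_ref_continuous assms that)
  then show ?thesis using assms(1) by (simp add: integral_sum)
qed

lemma S_ref_lincomb: "(\<And>a. a \<in> A \<Longrightarrow> h a \<in> S_ref N) \<Longrightarrow> (\<lambda>\<xi>. \<Sum>a\<in>A. c a * h a \<xi>) \<in> S_ref N"
  unfolding S_ref_def by (intro tensor_poly_sum tensor_poly_scale)

text \<open>Gives content to the choice in \<open>Psi3\<close>. The basis function of a small volume
  is the transformed \<open>vol_poly\<close> on its own element and zero on the other open
  elements.\<close>

lemma basis3_exists: "\<exists>B. is_basis3 B"
proof -
  \<comment> \<open>The indicator selects the index of \<open>v\<close> within element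
    \<open>m\<close>; if \<open>v\<close> belongs to another element, no term survives.\<close>
  define gB where "gB v m \<xi> = (\<Sum>k\<in>vol_index N. (if vol m k = v then 1 else 0) * vol_poly N k \<xi>)" for v m \<xi>
  have gB: "gB v m \<in> S_ref N" for v m
    unfolding gB_def[abs_def] by (rule S_ref_lincomb) (rule vol_poly_S_ref)
  have "\<forall>v. \<exists>f. \<forall>m<n. \<forall>\<xi>\<in>Ki. f (\<Phi> m \<xi>) = gB v m \<xi> / det (jac m \<xi>)"
    by (intro allI piecewise_exists)
  then obtain B where B: "\<And>v m \<xi>. m < n \<Longrightarrow> \<xi> \<in> Ki \<Longrightarrow> B v (\<Phi> m \<xi>) = gB v m \<xi> / det (jac m \<xi>)" by metis
  have SB: "S_pieces (B v) (gB v)" for v unfolding S_pieces_def using gB B by blast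
  have NB: "N3 (B v) w = (if w = v then 1 else 0)" if w: "w \<in> small_volumes" for v w
  proof -
    obtain m l where ml: "m < n" "l \<in> vol_index N" "w = vol m l" using w unfolding small_volumes_eq by auto
    have "N3 (B v) w = integral (vol_box N l) (gB v m)" unfolding ml(3) by (rule N3_vol[OF SB ml(1,2)])
    also have "\<dots> = (\<Sum>k\<in>vol_index N. (if vol m k = v then 1 else 0) * integral (vol_box N l) (vol_poly N k))"
      unfolding gB_def[abs_def] by (rule integral_sum_S_ref[OF finite_vol_index vol_poly_S_ref])
    also have "\<dots> = (\<Sum>k\<in>vol_index N. if k = l then (if vol m l = v then 1 else 0) else 0)"
      by (rule sum.cong[OF refl]) (auto simp: integral_vol_poly[OF N_pos _ ml(2)])
    also have "\<dots> = (if w = v then 1 else 0)" using ml(2,3) finite_vol_index by simp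
    finally show ?thesis .
  qed
  have "AE x in lebesgue_on \<Omega>. f x = (\<Sum>v\<in>small_volumes. B v x * N3 f v)" if fS: "f \<in> S_space" for f
  proof -
    obtain g where f: "S_pieces f g" using S_spaceE[OF fS] by blast
    have eq: "f (\<Phi> m \<xi>) = (\<Sum>v\<in>small_volumes. B v (\<Phi> m \<xi>) * N3 f v)" if m: "m < n" and \<xi>: "\<xi> \<in> Ki" for m \<xi>
    proof -
      have "(\<Sum>v\<in>small_volumes. gB v m \<xi> * N3 f v) =
          (\<Sum>v\<in>small_volumes. \<Sum>k\<in>vol_index N. if vol m k = v then vol_poly N k \<xi> * N3 f (vol m k) else 0)"
        unfolding gB_def sum_distrib_right by (intro sum.cong refl) auto
      also have "\<dots> = (\<Sum>k\<in>vol_index N. \<Sum>v\<in>small_volumes. if vol m k = v then vol_poly N k \<xi> * N3 f (vol m k) else 0)"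
        by (rule sum.swap)
      also have "\<dots> = (\<Sum>k\<in>vol_index N. integral (vol_box N k) (g m) * vol_poly N k \<xi>)"
      proof (rule sum.cong[OF refl])
        fix k assume k: "k \<in> vol_index N"
        show "(\<Sum>v\<in>small_volumes. if vol m k = v then vol_poly N k \<xi> * N3 f (vol m k) else 0) =
            integral (vol_box N k) (g m) * vol_poly N k \<xi>"
          using finite_small_volumes vol_in_small_volumes[OF m k] by (simp add: N3_vol[OF f m k])
      qed
      also have "\<dots> = g m \<xi>" by (rule S_ref_expansion[OF N_pos S_piecesD(1)[OF f m], symmetric])
      finally have "g m \<xi> = (\<Sum>v\<in>small_volumes. gB v m \<xi> * N3 f v)" by simp
      then show ?thesis using \<xi> m by (simp add: B S_piecesD(2)[OF f m] sum_divide_distrib)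
    qed
    have "\<Omega> \<in> sets lebesgue" using domain(2) by (simp add: lipschitz_domain_def borel_open)
    moreover have "AE x in lebesgue. x \<in> \<Omega> \<longrightarrow> f x = (\<Sum>v\<in>small_volumes. B v x * N3 f v)"
    proof (rule AE_I')
      show "\<Omega> - (\<Union>m<n. \<Phi> m ` Ki) \<in> null_sets lebesgue"
        using negligible_Omega_diff by (simp add: negligible_iff_null_sets)
      show "{x \<in> space lebesgue. \<not> (x \<in> \<Omega> \<longrightarrow> f x = (\<Sum>v\<in>small_volumes. B v x * N3 f v))}
          \<subseteq> \<Omega> - (\<Union>m<n. \<Phi> m ` Ki)"
      proof
        fix x assume x: "x \<in> {x \<in> space lebesgue. \<not> (x \<in> \<Omega> \<longrightarrow> f x = (\<Sum>v\<in>small_volumes. B v x * N3 f v))}"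
        have "x \<notin> \<Phi> m ` Ki" if "m < n" for m
        proof
          assume "x \<in> \<Phi> m ` Ki"
          then obtain \<xi> where "\<xi> \<in> Ki" "x = \<Phi> m \<xi>" by blast
          then show False using x eq[OF that] by simp
        qed
        then show "x \<in> \<Omega> - (\<Union>m<n. \<Phi> m ` Ki)" using x by simp
      qed
    qed
    ultimately show ?thesis by (simp add: AE_restrict_space_iff)
  qed
  then have "is_basis3 B" unfolding is_basis3_def using S_spaceI[OF SB] NB by blast
  then show ?thesis by blast
qed

lemma is_basis3_Psi3: "is_basis3 Psi3"
  unfolding Psi3_def using basis3_exists by (rule someI_ex)

text \<open>What is known about the chosen \<open>Psi3\<close> is its duality to the small volumes.
  By \<open>N3_vol\<close> this becomes a statement about box integrals of reference polynomials,
  where the coefficients can be read off.\<close>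

lemma Psi3_combination:
  "\<exists>g. S_pieces (\<lambda>x. \<Sum>v\<in>small_volumes. Psi3 v x * c v) g \<and>
    (\<forall>m<n. \<forall>k\<in>vol_index N. integral (vol_box N k) (g m) = c (vol m k))"
proof -
  have "\<forall>v\<in>small_volumes. \<exists>h. S_pieces (Psi3 v) h"
    using is_basis3_Psi3 S_spaceE unfolding is_basis3_def by metis
  then obtain h where h: "\<And>v. v \<in> small_volumes \<Longrightarrow> S_pieces (Psi3 v) (h v)" by metis
  define g where "g m \<xi> = (\<Sum>v\<in>small_volumes. c v * h v m \<xi>)" for m \<xi>
  have "S_pieces (\<lambda>x. \<Sum>v\<in>small_volumes. Psi3 v x * c v) g"
    unfolding S_pieces_def
  proof (intro allI impI conjI ballI)
    fix m assume m: "m < n"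
    show "g m \<in> S_ref N" unfolding g_def[abs_def] by (rule S_ref_lincomb) (rule S_piecesD(1)[OF h m])
    fix \<xi> assume \<xi>: "\<xi> \<in> Ki"
    show "(\<Sum>v\<in>small_volumes. Psi3 v (\<Phi> m \<xi>) * c v) = g m \<xi> / det (jac m \<xi>)"
      unfolding g_def sum_divide_distrib
      by (intro sum.cong refl) (simp add: S_piecesD(2)[OF h m \<xi>])
  qed
  moreover have "integral (vol_box N k) (g m) = c (vol m k)" if m: "m < n" and k: "k \<in> vol_index N" for m k
  proof -
    have "integral (vol_box N k) (g m) = (\<Sum>v\<in>small_volumes. c v * integral (vol_box N k) (h v m))"
      unfolding g_def[abs_def]
      by (rule integral_sum_S_ref[OF finite_small_volumes]) (rule S_piecesD(1)[OF h m])
    also have "\<dots> = (\<Sum>v\<in>small_volumes. if v = vol m k then c (vol m k) else 0)"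
    proof (rule sum.cong[OF refl])
      fix v assume v: "v \<in> small_volumes"
      have "integral (vol_box N k) (h v m) = N3 (Psi3 v) (vol m k)" by (rule N3_vol[OF h[OF v] m k, symmetric])
      also have "\<dots> = (if vol m k = v then 1 else 0)"
        using is_basis3_Psi3 v vol_in_small_volumes[OF m k] unfolding is_basis3_def by blast
      finally show "c v * integral (vol_box N k) (h v m) = (if v = vol m k then c (vol m k) else 0)" by auto
    qed
    also have "\<dots> = c (vol m k)" using finite_small_volumes vol_in_small_volumes[OF m k] by simp
    finally show ?thesis .
  qed
  ultimately show ?thesis by blast
qed

text \<open>If \<open>g1 m\<close> exceeded \<open>g2 m\<close> at \<xi>, it would do so on a ball
  around \<open>\<Phi> m \<xi>\<close> inside the open element. A bump on this ball has the same
  integral against both divergences, yet the difference of the integrands is continuous, nonnegative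
  and positive at \<xi>.\<close>

lemma divergence_pieces_not_less:
  assumes d1: "has_divergence \<Omega> u f1" and d2: "has_divergence \<Omega> u f2"
    and f1: "S_pieces f1 g1" and f2: "S_pieces f2 g2" and m: "m < n" and \<xi>: "\<xi> \<in> Ki"
  shows "\<not> g2 m \<xi> < g1 m \<xi>"
proof
  assume less: "g2 m \<xi> < g1 m \<xi>"
  let ?h = "\<lambda>\<eta>. g1 m \<eta> - g2 m \<eta>"
  let ?V = "\<Phi> m ` Ki" and ?x = "\<Phi> m \<xi>"
  have ch: "continuous_on K ?h"
    by (intro continuous_intros S_ref_continuous S_piecesD(1)[OF f1 m] S_piecesD(1)[OF f2 m])
  have "continuous_on ?V (\<lambda>x. ?h (inv_Phi m x))"
    by (rule continuous_on_compose2[OF ch continuous_on_subset[OF inv_Phi_continuous[OF m]]])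
      (use Ki_subset m in \<open>auto simp: elem_def\<close>)
  then have "open (?V \<inter> (\<lambda>x. ?h (inv_Phi m x)) -` {0<..})"
    by (rule continuous_open_preimage[OF _ open_Phi_Ki[OF m]]) simp
  moreover have "?x \<in> ?V \<inter> (\<lambda>x. ?h (inv_Phi m x)) -` {0<..}"
    using \<xi> less inv_Phi_Phi[OF m Ki_subset[OF \<xi>]] by simp
  ultimately obtain r where r: "r > 0" "cball ?x r \<subseteq> ?V \<inter> (\<lambda>x. ?h (inv_Phi m x)) -` {0<..}"
    using open_contains_cball by meson
  let ?\<phi> = "bump ?x r"
  have c\<phi>: "continuous_on UNIV ?\<phi>"
    unfolding bump_def[abs_def] by (intro continuous_intros)
  have \<phi>0: "?\<phi> y = 0" if "y \<notin> cball ?x r" for y using bump_zero[OF that r(1)] .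
  have test: "integral \<Omega> (\<lambda>x. u x \<bullet> ((- 4 * max 0 (r\<^sup>2 - (x - ?x) \<bullet> (x - ?x))) *\<^sub>R (x - ?x))) = - integral \<Omega> (\<lambda>x. f x * ?\<phi> x)"
    if "has_divergence \<Omega> u f" for f
  proof -
    have "continuous_on UNIV (\<lambda>x. (- 4 * max 0 (r\<^sup>2 - (x - ?x) \<bullet> (x - ?x))) *\<^sub>R (x - ?x))"
      by (intro continuous_intros)
    moreover have "cball ?x r \<subseteq> \<Omega>" using r(2) Phi_Ki_subset_Omega[OF m] by blast
    ultimately show ?thesis
      by (intro has_divergenceD[OF that bump_gderiv _ compact_cball] \<phi>0)
  qed
  have piece: "integral \<Omega> (\<lambda>x. f x * ?\<phi> x) = (\<Sum>k<n. integral K (\<lambda>\<eta>. g k \<eta> * ?\<phi> (\<Phi> k \<eta>)))"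
    if f: "S_pieces f g" for f g
  proof -
    have "integral \<Omega> (\<lambda>x. f x * ?\<phi> x) =
        (\<Sum>k<n. integral K (\<lambda>\<eta>. det (jac k \<eta>) * (g k \<eta> / det (jac k \<eta>) * ?\<phi> (\<Phi> k \<eta>))))"
    proof (rule piecewise_integral(2)[of "\<lambda>k \<eta>. g k \<eta> / det (jac k \<eta>) * ?\<phi> (\<Phi> k \<eta>)"])
      show "continuous_on K (\<lambda>\<eta>. g k \<eta> / det (jac k \<eta>) * ?\<phi> (\<Phi> k \<eta>))" if "k < n" for k
        by (intro continuous_on_mult S_pieces_continuous[OF f that]
            continuous_on_compose2[OF c\<phi> Phi_continuous[OF that]]) simp
    qed (simp add: S_piecesD(2)[OF f])
    also have "\<dots> = (\<Sum>k<n. integral K (\<lambda>\<eta>. g k \<eta> * ?\<phi> (\<Phi> k \<eta>)))"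
    proof (intro sum.cong refl integral_cong)
      fix k \<eta> assume "k \<in> {..<n}" "\<eta> \<in> K"
      then have "det (jac k \<eta>) > 0" using det_jac_pos by simp
      then show "det (jac k \<eta>) * (g k \<eta> / det (jac k \<eta>) * ?\<phi> (\<Phi> k \<eta>)) = g k \<eta> * ?\<phi> (\<Phi> k \<eta>)" by simp
    qed
    finally show ?thesis .
  qed
  have only: "(\<Sum>k<n. integral K (\<lambda>\<eta>. g k \<eta> * ?\<phi> (\<Phi> k \<eta>))) = integral K (\<lambda>\<eta>. g m \<eta> * ?\<phi> (\<Phi> m \<eta>))" for g
  proof -
    have z: "integral K (\<lambda>\<eta>. g k \<eta> * ?\<phi> (\<Phi> k \<eta>)) = 0" if "k < n" "k \<noteq> m" for k
    proof -
      have "g k \<eta> * ?\<phi> (\<Phi> k \<eta>) = 0" if "\<eta> \<in> K" for \<eta>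
      proof -
        have "\<Phi> k \<eta> \<in> elem k" using that by (simp add: elem_def)
        then have "\<Phi> k \<eta> \<notin> ?V" using elem_Int[OF \<open>k < n\<close> m \<open>k \<noteq> m\<close>] by blast
        then have "\<Phi> k \<eta> \<notin> cball ?x r" using r(2) by blast
        then show ?thesis using \<phi>0[of "\<Phi> k \<eta>"] by simp
      qed
      then have "integral K (\<lambda>\<eta>. g k \<eta> * ?\<phi> (\<Phi> k \<eta>)) = integral K (\<lambda>_. 0)" by (rule integral_cong)
      then show ?thesis by simp
    qed
    have "(\<Sum>k<n. integral K (\<lambda>\<eta>. g k \<eta> * ?\<phi> (\<Phi> k \<eta>))) =
        (\<Sum>k<n. if k = m then integral K (\<lambda>\<eta>. g m \<eta> * ?\<phi> (\<Phi> m \<eta>)) else 0)"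
      by (rule sum.cong[OF refl]) (use z in auto)
    then show ?thesis using m by simp
  qed
  have c\<phi>m: "continuous_on K (\<lambda>\<eta>. ?\<phi> (\<Phi> m \<eta>))"
    by (rule continuous_on_compose2[OF c\<phi> Phi_continuous[OF m]]) simp
  have eq: "integral K (\<lambda>\<eta>. g1 m \<eta> * ?\<phi> (\<Phi> m \<eta>)) = integral K (\<lambda>\<eta>. g2 m \<eta> * ?\<phi> (\<Phi> m \<eta>))"
    using test[OF d1] test[OF d2] piece[OF f1] piece[OF f2] only[of g1] only[of g2] by simp
  have int: "(\<lambda>\<eta>. g m \<eta> * ?\<phi> (\<Phi> m \<eta>)) integrable_on K" if "S_pieces f g" for f g
    unfolding ref_cube_def
    by (rule integrable_continuous, fold ref_cube_def)
      (intro continuous_on_mult c\<phi>m S_ref_continuous S_piecesD(1)[OF that m])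
  have chp: "continuous_on K (\<lambda>\<eta>. ?h \<eta> * ?\<phi> (\<Phi> m \<eta>))" by (intro continuous_on_mult ch c\<phi>m)
  have "integral K (\<lambda>\<eta>. ?h \<eta> * ?\<phi> (\<Phi> m \<eta>)) = 0"
    using eq integral_diff[OF int[OF f1] int[OF f2]] by (simp add: left_diff_distrib)
  moreover have "0 \<le> ?h \<eta> * ?\<phi> (\<Phi> m \<eta>)" if "\<eta> \<in> K" for \<eta>
  proof (cases "\<Phi> m \<eta> \<in> cball ?x r")
    case True
    then have "0 < ?h (inv_Phi m (\<Phi> m \<eta>))" using r(2) by blast
    then show ?thesis using bump_nonneg[of ?x r] inv_Phi_Phi[OF m that] by simp
  qed (simp add: \<phi>0)
  moreover have "box (vec (-1)) (vec 1 :: real^3) \<noteq> {}"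
  proof -
    have "(0 :: real^3) \<in> box (vec (-1)) (vec 1)" by (simp add: mem_box_cart)
    then show ?thesis by blast
  qed
  ultimately have "\<forall>\<eta>\<in>K. ?h \<eta> * ?\<phi> (\<Phi> m \<eta>) = 0"
    using integral_cbox_eq_0_iff[of "vec (-1)" "vec 1" "\<lambda>\<eta>. ?h \<eta> * ?\<phi> (\<Phi> m \<eta>)"] chp
    unfolding ref_cube_def by simp
  then have "?h \<xi> * ?\<phi> ?x = 0" using Ki_subset[OF \<xi>] by blast
  then show False using less bump_center[OF r(1), of ?x] by simp
qed

lemma divergence_pieces_unique:
  assumes "has_divergence \<Omega> u f1" "has_divergence \<Omega> u f2" "S_pieces f1 g1" "S_pieces f2 g2"
    and v: "v \<in> small_volumes"
  shows "N3 f1 v = N3 f2 v"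
proof -
  obtain m k where mk: "m < n" "k \<in> vol_index N" "v = vol m k" using v unfolding small_volumes_eq by auto
  have eq: "g1 m \<xi> = g2 m \<xi>" if "\<xi> \<in> Ki" for \<xi>
    using divergence_pieces_not_less[OF assms(1-4) mk(1) that]
      divergence_pieces_not_less[OF assms(2,1,4,3) mk(1) that] by linarith
  have "integral (vol_box N k) (g1 m) = integral (vol_box N k) (g2 m)"
  proof (rule integral_spike[OF negligible_ref_cube_boundary])
    fix \<xi> assume "\<xi> \<in> vol_box N k - (K - Ki)"
    then show "g2 m \<xi> = g1 m \<xi>" using eq vol_box_subset[OF N_pos mk(2)] by auto
  qed
  then show ?thesis unfolding mk(3) N3_vol[OF assms(3) mk(1,2)] N3_vol[OF assms(4) mk(1,2)] .
qed

end

section \<open>Fluxes and the incidence matrix\<close>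

context gll_mesh begin

definition face_lower :: "nat^3 \<Rightarrow> real^3" where
  "face_lower k = (\<chi> i. gll N (k $ i))"

definition face_upper :: "3 \<Rightarrow> nat^3 \<Rightarrow> real^3" where
  "face_upper d k = (\<chi> i. gll N (if i = d then k $ i else k $ i + 1))"

lemma face_box_eq: "face_box N d k = cbox (face_lower k) (face_upper d k)"
  by (simp add: face_box_def face_lower_def face_upper_def)

lemma is_local_faceD:
  assumes "is_local_face (m, d, k)"
  shows "m < n" "k $ d \<le> N" "i \<noteq> d \<Longrightarrow> k $ i < N" "k $ i \<le> N"
proof -
  show m: "m < n" "k $ d \<le> N" "\<And>i. i \<noteq> d \<Longrightarrow> k $ i < N"
    using assms unfolding is_local_face_def by auto
  show "k $ i \<le> N" using m(2) m(3)[of i] by (cases "i = d") auto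
qed

lemma face_lower_less:
  assumes "is_local_face (m, d, k)" "i \<noteq> d" shows "face_lower k $ i < face_upper d k $ i"
  using gll_strict_mono[OF N_pos, of "k $ i" "k $ i + 1"] is_local_faceD(3)[OF assms] assms(2)
  by (simp add: face_lower_def face_upper_def)

lemma face_range:
  assumes "is_local_face (m, d, k)"
  shows "-1 \<le> face_lower k $ i" "face_upper d k $ i \<le> 1" "face_lower k $ i \<le> face_upper d k $ i"
proof -
  show "-1 \<le> face_lower k $ i"
    using gll_range(1)[OF N_pos is_local_faceD(4)[OF assms]] by (simp add: face_lower_def)
  show "face_upper d k $ i \<le> 1"
    using gll_range(2)[OF N_pos is_local_faceD(2)[OF assms]]
      gll_range(2)[OF N_pos, of "k $ i + 1"] is_local_faceD(3)[OF assms, of i]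
    by (cases "i = d") (auto simp: face_upper_def Suc_le_eq)
  show "face_lower k $ i \<le> face_upper d k $ i"
    using face_lower_less[OF assms, of i] by (cases "i = d") (auto simp: face_lower_def face_upper_def)
qed

lemma face_box_subset:
  assumes "is_local_face (m, d, k)" shows "face_box N d k \<subseteq> K"
proof
  fix \<xi> assume \<xi>: "\<xi> \<in> face_box N d k"
  have "\<bar>\<xi> $ i\<bar> \<le> 1" for i
    unfolding abs_le_iff using \<xi> face_range[OF assms, of i]
    unfolding face_box_eq mem_box_cart by (metis minus_le_iff order_trans)
  then show "\<xi> \<in> K" by (simp add: ref_cube_mem)
qed

lemma face_corners:
  assumes "is_local_face (m, d, k)"
  shows "face_lower k \<in> face_box N d k" "face_upper d k \<in> face_box N d k"
  using face_range[OF assms] by (auto simp: face_box_eq mem_box_cart)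

lemma face_box_nth: "\<xi> \<in> face_box N d k \<Longrightarrow> \<xi> $ d = gll N (k $ d)"
proof -
  assume "\<xi> \<in> face_box N d k"
  then have "face_lower k $ d \<le> \<xi> $ d" "\<xi> $ d \<le> face_upper d k $ d"
    unfolding face_box_eq mem_box_cart by blast+
  then show ?thesis by (simp add: face_lower_def face_upper_def)
qed

text \<open>The corners determine the indices, and \<open>d\<close> is the one direction in which
  the box is flat.\<close>

lemma face_box_eqD:
  assumes f: "is_local_face (m, d, k)" "is_local_face (m, d', k')" and eq: "face_box N d k = face_box N d' k'"
  shows "d = d' \<and> k = k'"
proof -
  have ne: "face_box N d k \<noteq> {}" using face_corners[OF f(1)] by blast
  then have "face_lower k = face_lower k'" "face_upper d k = face_upper d' k'"
    using eq unfolding face_box_eq eq_cbox by auto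
  then have "gll N (k $ i) = gll N (k' $ i)" "face_upper d k $ i = face_upper d' k' $ i" for i
    by (simp_all add: face_lower_def vec_eq_iff)
  note e = this
  have kk: "k = k'" using gll_inj[OF is_local_faceD(4)[OF f(1)] is_local_faceD(4)[OF f(2)] e(1)]
    by (simp add: vec_eq_iff)
  have "d = d'"
  proof (rule ccontr)
    assume "d \<noteq> d'"
    then have "face_lower k $ d < face_upper d' k $ d"
      using face_lower_less[OF f(2)] kk by simp
    then show False using e(2)[of d] kk by (simp add: face_lower_def face_upper_def)
  qed
  then show ?thesis using kk by blast
qed

lemma face_set_eq: "face_set (m, d, k) = \<Phi> m ` face_box N d k"
  by (simp add: face_set_def)

lemma face_set_eqD:
  assumes f: "is_local_face (m, d, k)" "is_local_face (m, d', k')"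
    and eq: "face_set (m, d, k) = face_set (m, d', k')"
  shows "d = d' \<and> k = k'"
proof -
  have "face_box N d k = face_box N d' k'"
    using eq inj_on_image_eq_iff[OF Phi_inj[OF is_local_faceD(1)[OF f(1)]] face_box_subset[OF f(1)] face_box_subset[OF f(2)]]
    by (simp add: face_set_eq)
  then show ?thesis by (rule face_box_eqD[OF f])
qed

text \<open>The flux through a labelled small face in the direction of increasing coordinate
  \<open>d\<close>. It depends on the element through which the face is seen, and not on
  \<nu>.\<close>

definition local_flux :: "(nat \<Rightarrow> real^3 \<Rightarrow> real^3) \<Rightarrow> nat \<times> 3 \<times> (nat^3) \<Rightarrow> real" where
  "local_flux u = (\<lambda>(m, d, k).
    integral (cbox (gll N (k $ (d + 1)), gll N (k $ (d + 2))) (gll N (k $ (d + 1) + 1), gll N (k $ (d + 2) + 1)))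
      (\<lambda>q. u m (emb d (gll N (k $ d)) q) $ d))"

lemma local_flux_eq:
  "local_flux u (m, d, k) =
    integral (cbox (face_lower k $ (d + 1), face_lower k $ (d + 2)) (face_upper d k $ (d + 1), face_upper d k $ (d + 2)))
      (\<lambda>q. u m (emb d (gll N (k $ d)) q) $ d)"
  by (simp add: local_flux_def face_lower_def face_upper_def)

lemma emb_in_face_box:
  "emb d (gll N (k $ d)) q \<in> face_box N d k \<longleftrightarrow>
    q \<in> cbox (gll N (k $ (d + 1)), gll N (k $ (d + 2))) (gll N (k $ (d + 1) + 1), gll N (k $ (d + 2) + 1))"
  unfolding face_box_eq emb_in_cbox by (simp add: face_lower_def face_upper_def)

text \<open>Since the Jacobian is invertible, it suffices to compare inner products with its images;
  there \<open>glued_det\<close> supplies the sign. Multiplied by \<open>s\<close> and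
  \<open>s'\<close>, the two vectors become opposite outward normals.\<close>

lemma glued_area_vector:
  assumes g: "glued m d s m' d' s' \<sigma>" and \<xi>: "\<xi> \<in> ref_facet d s"
  shows "area_vector m d \<xi> = - (s * s') *\<^sub>R area_vector m' d' (\<sigma> \<xi>)"
proof -
  let ?A = "jac m' (\<sigma> \<xi>)" and ?z = "area_vector m d \<xi> + (s * s') *\<^sub>R area_vector m' d' (\<sigma> \<xi>)"
  have "m' < n" "\<sigma> \<xi> \<in> K" using g \<xi> by (auto simp: glued_def ref_facet_mem glued_in_cube[OF g])
  then have "det ?A > 0" by (rule det_jac_pos)
  then have "invertible ?A" by (simp add: invertible_det_nz)
  then obtain A' where "?A ** A' = mat 1" unfolding invertible_def by blast
  then have z: "?A *v (A' *v ?z) = ?z" by (simp add: matrix_vector_mul_assoc)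
  have "(?A *v v) \<bullet> ?z = 0" for v
    by (simp add: inner_add_right glued_inner_area_vector[OF g \<xi>] glued_det[OF g] inner_area_vector)
  then have "?z \<bullet> ?z = 0" using z by metis
  then have "?z = 0" by simp
  then show ?thesis by (simp add: eq_neg_iff_add_eq_0)
qed

text \<open>The face centre lies in a second element, so it is not interior to the cube, although
  its in-plane coordinates are strictly between -1 and 1. Hence the face lies in a facet of the
  cube, and this facet is shared.\<close>

lemma shared_small_face:
  assumes f: "is_local_face (m, d, k)" and f': "is_local_face (m', d', k')"
    and eq: "face_set (m, d, k) = face_set (m', d', k')" and ne: "m \<noteq> m'"
  shows "\<exists>\<sigma>. glued m d (gll N (k $ d)) m' d' (gll N (k' $ d')) \<sigma> \<and>
    \<sigma> ` face_box N d k = face_box N d' k' \<and> face_box N d k \<subseteq> ref_facet d (gll N (k $ d))"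
proof -
  have m: "m < n" "m' < n" using is_local_faceD(1) f f' by blast+
  define s where "s = gll N (k $ d)"
  define c where "c = (1/2) *\<^sub>R face_lower k + (1/2) *\<^sub>R face_upper d k"
  have c: "c \<in> face_box N d k"
    unfolding c_def face_box_eq by (rule convexD[OF convex_box(1)]) (use face_corners[OF f] in \<open>auto simp: face_box_eq\<close>)
  then have cK: "c \<in> K" using face_box_subset[OF f] by blast
  have cs: "c $ d = s" unfolding s_def by (rule face_box_nth[OF c])
  have ci: "\<bar>c $ i\<bar> < 1" if "i \<noteq> d" for i
    unfolding abs_less_iff using face_lower_less[OF f that] face_range[OF f, of i] by (simp add: c_def)
  have "\<Phi> m c \<in> face_set (m, d, k)" using c unfolding face_set_eq by (rule imageI)
  then have "\<Phi> m c \<in> face_set (m', d', k')" unfolding eq .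
  then have ce: "\<Phi> m c \<in> elem m'" using face_box_subset[OF f'] unfolding face_set_eq elem_def by blast
  then have "\<Phi> m c \<notin> \<Phi> m ` Ki" using elem_Int[OF m(2,1)] ne by blast
  then have "c \<notin> Ki" by blast
  then obtain i where i: "\<not> \<bar>c $ i\<bar> < 1" unfolding ref_cube_mem_interior by blast
  then have "i = d" using ci by blast
  then have "\<bar>s\<bar> = 1" using i cK cs by (auto simp: ref_cube_mem not_less intro: antisym)
  then have s: "s \<in> {-1, 1}" by auto
  have cf: "c \<in> ref_facet d s" using cK cs by (simp add: ref_facet_mem)
  have "\<Phi> m ` ref_facet d s \<subseteq> elem m'"
    by (rule facet_point_in_other_element[OF m ne s cf ci ce])
  then obtain d'' s'' \<sigma> where g: "glued m d s m' d'' s'' \<sigma>" using glued_exists[OF m ne s] by blast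
  have sub: "face_box N d k \<subseteq> ref_facet d s"
    using face_box_subset[OF f] face_box_nth unfolding s_def by (auto simp: ref_facet_mem)
  have im: "\<sigma> ` face_box N d k = face_box N d' k'"
  proof -
    have "\<Phi> m' ` (\<sigma> ` face_box N d k) = \<Phi> m ` face_box N d k"
      unfolding image_image by (rule image_cong[OF refl]) (use glued_Phi[OF g] sub in blast)
    also have "\<dots> = \<Phi> m' ` face_box N d' k'" using eq by (simp add: face_set_eq)
    finally have "\<Phi> m' ` (\<sigma> ` face_box N d k) = \<Phi> m' ` face_box N d' k'" .
    moreover have "\<sigma> ` face_box N d k \<subseteq> K" using face_box_subset[OF f] glued_in_cube[OF g] by blast
    ultimately show ?thesis using inj_on_image_eq_iff[OF Phi_inj[OF m(2)] _ face_box_subset[OF f']] by blast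
  qed
  have "\<sigma> ` face_box N d k \<subseteq> ref_facet d'' s''" using sub glued_in_facet[OF g] by blast
  then have fb': "face_box N d' k' \<subseteq> ref_facet d'' s''" unfolding im .
  then have corner: "face_lower k' $ d'' = s''" "face_upper d' k' $ d'' = s''"
    using face_corners[OF f'] by (auto simp: ref_facet_mem)
  \<comment> \<open>The second copy of the face lies in the facet \<open>(d'', s'')\<close>, so it
    is flat in direction \<open>d''\<close>; a face box is flat only in its own direction.\<close>
  have dd: "d'' = d'" using face_lower_less[OF f', of d''] corner by fastforce
  have ss: "s'' = gll N (k' $ d')" using corner(1) dd by (simp add: face_lower_def)
  show ?thesis using g im sub unfolding dd ss s_def by blast
qed

lemma glued_local_flux:
  assumes f': "is_local_face (m', d', k')"
    and g: "glued m d (gll N (k $ d)) m' d' (gll N (k' $ d')) \<sigma>"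
    and im: "\<sigma> ` face_box N d k = face_box N d' k'" and sub: "face_box N d k \<subseteq> ref_facet d (gll N (k $ d))"
    and u: "matched u" "u m' \<in> D_ref N"
  shows "local_flux u (m', d', k') = - (gll N (k $ d) * gll N (k' $ d')) * local_flux u (m, d, k)"
proof -
  let ?s = "gll N (k $ d)" and ?s' = "gll N (k' $ d')"
  let ?Q = "cbox (face_lower k $ (d + 1), face_lower k $ (d + 2)) (face_upper d k $ (d + 1), face_upper d k $ (d + 2))"
  have "local_flux u (m', d', k') = integral ?Q (\<lambda>q. u m' (\<sigma> (emb d ?s q)) $ d')"
    unfolding local_flux_eq
    by (rule glued_face_integral[OF g _ _ _ _ im[unfolded face_box_eq]])
      (auto simp: face_lower_def face_upper_def intro!: continuous_intros continuous_on_D_ref[OF u(2)])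
  also have "\<dots> = integral ?Q (\<lambda>q. - (?s * ?s') * u m (emb d ?s q) $ d)"
  proof (rule integral_cong)
    fix q assume "q \<in> ?Q"
    then have "emb d ?s q \<in> face_box N d k" unfolding emb_in_face_box by (simp add: face_lower_def face_upper_def)
    then have "?s' * u m' (\<sigma> (emb d ?s q)) $ d' = - (?s * u m (emb d ?s q) $ d)"
      using u(1) g sub unfolding matched_def by blast
    then have "?s' * (?s' * u m' (\<sigma> (emb d ?s q)) $ d') = ?s' * - (?s * u m (emb d ?s q) $ d)" by simp
    moreover have "?s' * ?s' = 1" using glued_sq[OF g] by blast
    ultimately show "u m' (\<sigma> (emb d ?s q)) $ d' = - (?s * ?s') * u m (emb d ?s q) $ d"
      by (metis (no_types, opaque_lifting) mult.assoc mult.commute mult_1 mult_minus_left mult_minus_right)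
  qed
  also have "\<dots> = - (?s * ?s') * local_flux u (m, d, k)" unfolding integral_mult_right local_flux_eq ..
  finally show ?thesis .
qed

end

section \<open>Orientation of the small faces\<close>

context oriented_gll_mesh begin

text \<open>\<nu> and the area vector are both orthogonal to the tangential columns of the Jacobian,
  hence parallel. Their ratio, normalized to 1 or -1, is continuous on the connected face and
  therefore constant.\<close>

lemma normal_sign:
  assumes f: "is_local_face (m, d, k)"
  shows "\<exists>r\<in>{-1, 1}. \<forall>\<xi>\<in>face_box N d k.
    norm (area_vector m d \<xi>) *\<^sub>R \<nu> (face_set (m, d, k)) (\<Phi> m \<xi>) = r *\<^sub>R area_vector m d \<xi>"
proof -
  let ?s = "face_set (m, d, k)" let ?B = "face_box N d k"
  have m: "m < n" by (rule is_local_faceD(1)[OF f])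
  have sf: "?s \<in> small_faces" unfolding small_faces_def using f by blast
  have BK: "?B \<subseteq> K" by (rule face_box_subset[OF f])
  have xs: "\<Phi> m \<xi> \<in> ?s" if "\<xi> \<in> ?B" for \<xi> using that unfolding face_set_eq by (rule imageI)
  let ?a = "area_vector m d" let ?\<nu> = "\<lambda>\<xi>. \<nu> ?s (\<Phi> m \<xi>)"
  have a0: "?a \<xi> \<noteq> 0" if "\<xi> \<in> ?B" for \<xi>
  proof
    assume "?a \<xi> = 0"
    then have "det (jac m \<xi>) * axis d 1 $ d = 0" using inner_area_vector[of m \<xi> "axis d 1" d] by simp
    then show False using det_jac_pos[OF m, of \<xi>] BK that by (auto simp: axis_def)
  qed
  define c where "c \<xi> = (?\<nu> \<xi> \<bullet> ?a \<xi>) / norm (?a \<xi>)" for \<xi>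
  have par: "norm (?a \<xi>) *\<^sub>R ?\<nu> \<xi> = c \<xi> *\<^sub>R ?a \<xi>" and c1: "c \<xi> \<in> {-1, 1}" if \<xi>: "\<xi> \<in> ?B" for \<xi>
  proof -
    let ?A = "jac m \<xi>" 
    \<comment> \<open>Chosen such that \<open>?\<nu> \<xi> - t *\<^sub>R ?a \<xi>\<close> is
      orthogonal to column \<open>d\<close> as well, thus to all columns.\<close>
    define t where "t = (?\<nu> \<xi> \<bullet> (?A *v axis d 1)) / det ?A"
    have det: "det ?A > 0" using det_jac_pos[OF m] BK \<xi> by blast
    then have "invertible ?A" by (simp add: invertible_det_nz)
    then obtain A' where "?A ** A' = mat 1" unfolding invertible_def by blast
    then have z: "?A *v (A' *v x) = x" for x by (simp add: matrix_vector_mul_assoc)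
    have col: "(?\<nu> \<xi> - t *\<^sub>R ?a \<xi>) \<bullet> (?A *v axis i 1) = 0" for i
    proof (cases "i = d")
      case True
      have "?a \<xi> \<bullet> (?A *v axis d 1) = det ?A"
        using inner_area_vector[of m \<xi> "axis d 1" d] by (simp add: inner_commute)
      then show ?thesis using det unfolding True by (simp add: inner_diff_left t_def)
    next
      case False
      have "?\<nu> \<xi> \<bullet> (?A *v axis i 1) = 0"
        using normal_orthogonal[OF f \<xi> False] by (simp add: matrix_vector_mult_basis)
      moreover have "?a \<xi> \<bullet> (?A *v axis i 1) = 0"
        using inner_area_vector[of m \<xi> "axis i 1" d] False by (simp add: inner_commute axis_def)
      ultimately show ?thesis by (simp add: inner_diff_left)
    qed
    have lin: "(?\<nu> \<xi> - t *\<^sub>R ?a \<xi>) \<bullet> (?A *v x) = 0" for x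
    proof -
      have "?A *v x = (\<Sum>i\<in>UNIV. x $ i *\<^sub>R (?A *v axis i 1))"
        unfolding matrix_vector_mult_basis by (simp add: matrix_mult_sum scalar_mult_eq_scaleR)
      then show ?thesis by (simp add: inner_sum_right col)
    qed
    have "(?\<nu> \<xi> - t *\<^sub>R ?a \<xi>) \<bullet> (?\<nu> \<xi> - t *\<^sub>R ?a \<xi>) = 0"
      using lin[of "A' *v (?\<nu> \<xi> - t *\<^sub>R ?a \<xi>)"] unfolding z .
    then have \<nu>t: "?\<nu> \<xi> = t *\<^sub>R ?a \<xi>" by simp
    have na: "norm (?a \<xi>) > 0" using a0[OF \<xi>] by simp
    have "c \<xi> = t * (?a \<xi> \<bullet> ?a \<xi>) / norm (?a \<xi>)" unfolding c_def \<nu>t by simp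
    also have "\<dots> = t * norm (?a \<xi>)" using na by (simp add: dot_square_norm power2_eq_square)
    finally have ct: "c \<xi> = t * norm (?a \<xi>)" .
    show "norm (?a \<xi>) *\<^sub>R ?\<nu> \<xi> = c \<xi> *\<^sub>R ?a \<xi>" unfolding \<nu>t ct by (simp add: mult.commute)
    have "norm (?\<nu> \<xi>) = 1" by (rule normal_unit[OF sf xs[OF \<xi>]])
    then have "\<bar>t\<bar> * norm (?a \<xi>) = 1" unfolding \<nu>t by simp
    then have "\<bar>c \<xi>\<bar> = 1" unfolding ct by (simp add: abs_mult)
    then show "c \<xi> \<in> {-1, 1}" by auto
  qed
  have contB: "continuous_on ?B (\<Phi> m)" by (rule continuous_on_subset[OF Phi_continuous[OF m] BK])
  have "continuous_on ?B ?\<nu>"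
    by (rule continuous_on_compose2[OF normal_continuous[OF sf] contB]) (use xs in blast)
  moreover have "continuous_on ?B ?a"
  proof -
    have comp: "continuous_on ?B (\<lambda>\<xi>. jac m \<xi> $ i $ j)" for i j
      by (rule continuous_on_subset[OF jac_entry_continuous[OF m] BK])
    have "continuous_on ?B (\<lambda>\<xi>. column i (jac m \<xi>))" for i
      unfolding column_def by (intro continuous_on_vec_lambda comp)
    then have "continuous_on ?B (\<lambda>\<xi>. ?a \<xi> $ i)" for i
      unfolding area_vector_def cross3_def
      using exhaust_3[of i] by (elim disjE) (auto intro!: continuous_intros)
    then have "continuous_on ?B (\<lambda>\<xi>. \<chi> i. ?a \<xi> $ i)" by (rule continuous_on_vec_lambda)
    then show ?thesis by simp
  qed
  ultimately have contc: "continuous_on ?B c"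
    unfolding c_def by (intro continuous_intros) (use a0 in auto)
  have "connected (c ` ?B)"
    by (rule connected_continuous_image[OF contc]) (simp add: face_box_eq convex_connected)
  moreover have "finite (c ` ?B)" by (rule finite_subset[of _ "{-1, 1}"]) (use c1 in auto)
  ultimately obtain r where "c ` ?B = {r}"
    using connected_finite_iff_sing[of "c ` ?B"] face_corners(1)[OF f] by blast
  then have cr: "c \<xi> = r" if "\<xi> \<in> ?B" for \<xi> using that by blast
  have "r \<in> {-1, 1}" using c1[OF face_corners(1)[OF f]] cr[OF face_corners(1)[OF f]] by simp
  moreover have "\<forall>\<xi>\<in>?B. norm (?a \<xi>) *\<^sub>R ?\<nu> \<xi> = r *\<^sub>R ?a \<xi>" using par cr by auto
  ultimately show ?thesis by blast
qed

definition face_sign :: "nat \<times> 3 \<times> (nat^3) \<Rightarrow> real" where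
  "face_sign = (\<lambda>(m, d, k). SOME r. r \<in> {-1, 1} \<and> (\<forall>\<xi>\<in>face_box N d k.
    norm (area_vector m d \<xi>) *\<^sub>R \<nu> (face_set (m, d, k)) (\<Phi> m \<xi>) = r *\<^sub>R area_vector m d \<xi>))"

lemma face_sign:
  assumes "is_local_face (m, d, k)"
  shows "face_sign (m, d, k) \<in> {-1, 1}"
    "\<xi> \<in> face_box N d k \<Longrightarrow> norm (area_vector m d \<xi>) *\<^sub>R \<nu> (face_set (m, d, k)) (\<Phi> m \<xi>) =
      face_sign (m, d, k) *\<^sub>R area_vector m d \<xi>"
proof -
  have "face_sign (m, d, k) \<in> {-1, 1} \<and> (\<forall>\<xi>\<in>face_box N d k.
    norm (area_vector m d \<xi>) *\<^sub>R \<nu> (face_set (m, d, k)) (\<Phi> m \<xi>) = face_sign (m, d, k) *\<^sub>R area_vector m d \<xi>)"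
    unfolding face_sign_def prod.case by (rule someI_ex) (use normal_sign[OF assms] in blast)
  then show "face_sign (m, d, k) \<in> {-1, 1}"
    "\<xi> \<in> face_box N d k \<Longrightarrow> norm (area_vector m d \<xi>) *\<^sub>R \<nu> (face_set (m, d, k)) (\<Phi> m \<xi>) =
      face_sign (m, d, k) *\<^sub>R area_vector m d \<xi>" by blast+
qed

text \<open>Seen from the other element, the local flux and the sign of \<nu> relative to the area
  vector both change by the same factor \<open>- (s * s')\<close>, so their product is unchanged.
  Comparing the signs at one corner is enough.\<close>

lemma signed_flux_well_defined:
  assumes f: "is_local_face f" and f': "is_local_face f'" and eq: "face_set f = face_set f'"
    and u: "matched u" "\<And>m. m < n \<Longrightarrow> u m \<in> D_ref N"
  shows "face_sign f * local_flux u f = face_sign f' * local_flux u f'"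
proof -
  obtain m d k m' d' k' where ff: "f = (m, d, k)" "f' = (m', d', k')" by (metis prod.exhaust)
  note f = f[unfolded ff] and f' = f'[unfolded ff] and eq = eq[unfolded ff]
  show ?thesis
  proof (cases "m = m'")
    case True
    then have "f = f'" using face_set_eqD[OF f] f' eq ff by blast
    then show ?thesis by simp
  next
    case False
    let ?s = "gll N (k $ d)" and ?s' = "gll N (k' $ d')"
    obtain \<sigma> where g: "glued m d ?s m' d' ?s' \<sigma>" and im: "\<sigma> ` face_box N d k = face_box N d' k'"
      and sub: "face_box N d k \<subseteq> ref_facet d ?s" using shared_small_face[OF f f' eq False] by blast
    have m': "m' < n" by (rule is_local_faceD(1)[OF f'])
    let ?l = "- (?s * ?s')"
    have l: "?l * ?l = 1" using g by (auto simp: glued_def)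
    have flux: "local_flux u (m', d', k') = ?l * local_flux u (m, d, k)"
      using glued_local_flux[OF f' g im sub u(1) u(2)[OF m']] by simp
    let ?\<xi> = "face_lower k"
    have \<xi>: "?\<xi> \<in> face_box N d k" by (rule face_corners(1)[OF f])
    then have \<xi>f: "?\<xi> \<in> ref_facet d ?s" using sub by blast
    have \<xi>': "\<sigma> ?\<xi> \<in> face_box N d' k'" using \<xi> im by blast
    let ?a = "area_vector m d ?\<xi>" and ?a' = "area_vector m' d' (\<sigma> ?\<xi>)"
    have aa: "?a = ?l *\<^sub>R ?a'" by (rule glued_area_vector[OF g \<xi>f])
    have "\<bar>?l\<bar> = 1" using g by (auto simp: glued_def)
    then have na: "norm ?a = norm ?a'" unfolding aa by simp
    have "face_sign (m, d, k) *\<^sub>R ?a = norm ?a *\<^sub>R \<nu> (face_set (m, d, k)) (\<Phi> m ?\<xi>)"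
      by (rule face_sign(2)[OF f \<xi>, symmetric])
    also have "\<dots> = norm ?a' *\<^sub>R \<nu> (face_set (m', d', k')) (\<Phi> m' (\<sigma> ?\<xi>))"
      unfolding na eq glued_Phi[OF g \<xi>f] ..
    also have "\<dots> = face_sign (m', d', k') *\<^sub>R ?a'" by (rule face_sign(2)[OF f' \<xi>'])
    finally have "(face_sign (m, d, k) * ?l - face_sign (m', d', k')) *\<^sub>R ?a' = 0"
      unfolding aa by (simp add: scaleR_left_diff_distrib)
    moreover have "?a' \<noteq> 0"
    proof
      assume "?a' = 0"
      then have "det (jac m' (\<sigma> ?\<xi>)) * axis d' 1 $ d' = 0"
        using inner_area_vector[of m' "\<sigma> ?\<xi>" "axis d' 1" d'] by simp
      then show False using det_jac_pos[OF m', of "\<sigma> ?\<xi>"] face_box_subset[OF f'] \<xi>' by (auto simp: axis_def)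
    qed
    ultimately have "face_sign (m', d', k') = face_sign (m, d, k) * ?l" by simp
    then have "face_sign (m', d', k') * local_flux u (m', d', k') = (?l * ?l) * (face_sign (m, d, k) * local_flux u (m, d, k))"
      unfolding flux by (simp add: mult_ac)
    then show ?thesis unfolding ff l by simp
  qed
qed

lemma N2_local_face:
  assumes f: "is_local_face f"
    and u: "matched u" "\<And>m. m < n \<Longrightarrow> u m \<in> D_ref N"
    and q: "\<And>m \<xi>. m < n \<Longrightarrow> \<xi> \<in> Ki \<Longrightarrow> q (\<Phi> m \<xi>) = piola u m \<xi>"
  shows "N2 q (face_set f) = face_sign f * local_flux u f"
proof -
  define h where "h = (SOME h. is_local_face h \<and> face_set h = face_set f)"
  have h: "is_local_face h \<and> face_set h = face_set f"
    unfolding h_def by (rule someI[of _ f]) (use f in simp)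
  obtain m d k where hm: "h = (m, d, k)" by (metis prod.exhaust)
  have lf: "is_local_face (m, d, k)" and fs: "face_set (m, d, k) = face_set f" using h hm by auto
  have m: "m < n" by (rule is_local_faceD(1)[OF lf])
  let ?Q = "cbox (gll N (k $ (d + 1)), gll N (k $ (d + 2))) (gll N (k $ (d + 1) + 1), gll N (k $ (d + 2) + 1))"
  have N2: "N2 q (face_set f) = integral ?Q (\<lambda>(\<eta>, \<zeta>).
      (elem_trace m q (\<Phi> m (emb d (gll N (k $ d)) (\<eta>, \<zeta>))) \<bullet> \<nu> (face_set f) (\<Phi> m (emb d (gll N (k $ d)) (\<eta>, \<zeta>))))
        * norm (area_vector m d (emb d (gll N (k $ d)) (\<eta>, \<zeta>))))"
    unfolding N2_def h_def[symmetric] hm Let_def prod.case emb_def fst_conv snd_conv ..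
  also have "\<dots> = integral ?Q (\<lambda>p. face_sign (m, d, k) * u m (emb d (gll N (k $ d)) p) $ d)"
  proof (rule integral_cong)
    fix p assume p: "p \<in> ?Q"
    let ?\<xi> = "emb d (gll N (k $ d)) p"
    have \<xi>: "?\<xi> \<in> face_box N d k" using p by (simp add: emb_in_face_box)
    then have \<xi>K: "?\<xi> \<in> K" using face_box_subset[OF lf] by blast
    have tr: "elem_trace m q (\<Phi> m ?\<xi>) = piola u m ?\<xi>"
      by (rule elem_trace_eq[OF m piola_continuous[where u = u, OF m u(2)[OF m]] q[OF m] \<xi>K])
    have "(elem_trace m q (\<Phi> m ?\<xi>) \<bullet> \<nu> (face_set f) (\<Phi> m ?\<xi>)) * norm (area_vector m d ?\<xi>) =
        piola u m ?\<xi> \<bullet> (norm (area_vector m d ?\<xi>) *\<^sub>R \<nu> (face_set (m, d, k)) (\<Phi> m ?\<xi>))"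
      unfolding tr fs by simp
    also have "\<dots> = face_sign (m, d, k) * u m ?\<xi> $ d"
      unfolding face_sign(2)[OF lf \<xi>] by (simp add: piola_inner_area_vector[OF m \<xi>K])
    finally show "(case p of (\<eta>, \<zeta>) \<Rightarrow>
        (elem_trace m q (\<Phi> m (emb d (gll N (k $ d)) (\<eta>, \<zeta>))) \<bullet> \<nu> (face_set f) (\<Phi> m (emb d (gll N (k $ d)) (\<eta>, \<zeta>))))
        * norm (area_vector m d (emb d (gll N (k $ d)) (\<eta>, \<zeta>)))) = face_sign (m, d, k) * u m ?\<xi> $ d"
      by (simp add: case_prod_unfold)
  qed
  also have "\<dots> = face_sign h * local_flux u h"
    unfolding hm local_flux_def prod.case by (rule integral_mult_right)
  \<comment> \<open>\<open>N2\<close> works with an arbitrary label \<open>h\<close> of the face;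
    the signed flux is the same for every label.\<close>
  also have "\<dots> = face_sign f * local_flux u f"
    by (rule signed_flux_well_defined[OF _ f _ u]) (use h in auto)
  finally show ?thesis .
qed

section \<open>The incidence matrix\<close>

definition next_index :: "nat^3 \<Rightarrow> 3 \<Rightarrow> nat^3" where
  "next_index k d = (\<chi> i. if i = d then k $ i + 1 else k $ i)"

lemma vol_local_faces:
  assumes "m < n" "k \<in> vol_index N"
  shows "is_local_face (m, d, k)" "is_local_face (m, d, next_index k d)"
  using assms by (auto simp: is_local_face_def vol_index_def next_index_def less_imp_le Suc_le_eq)

lemma vol_divergence:
  assumes m: "m < n" and k: "k \<in> vol_index N" and u: "u m \<in> D_ref N" "partials (u m) w" "\<And>d. w d \<in> S_ref N"
  shows "integral (vol_box N k) (\<lambda>\<xi>. \<Sum>d\<in>UNIV. w d \<xi>) =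
    (\<Sum>d\<in>UNIV. local_flux u (m, d, next_index k d) - local_flux u (m, d, k))"
proof -
  let ?a = "(\<chi> i. gll N (k $ i)) :: real^3" and ?b = "(\<chi> i. gll N (k $ i + 1)) :: real^3"
  have cw: "continuous_on S (w d)" for S d by (rule S_ref_continuous[OF u(3)])
  have le: "?a $ i \<le> ?b $ i" for i
    using gll_strict_mono[OF N_pos, of "k $ i" "k $ i + 1"] k by (simp add: vol_index_def Suc_le_eq less_imp_le)
  have one: "integral (vol_box N k) (w d) = local_flux u (m, d, next_index k d) - local_flux u (m, d, k)" for d
  proof -
    let ?Q = "cbox (?a $ (d + 1), ?a $ (d + 2)) (?b $ (d + 1), ?b $ (d + 2))"
    have int: "(\<lambda>q. u m (emb d t q) $ d) integrable_on ?Q" for t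
      by (intro integrable_continuous continuous_on_component
          continuous_on_compose2[OF continuous_on_D_ref[OF u(1), of UNIV]] continuous_intros) auto
    have "integral (vol_box N k) (w d) =
        integral ?Q (\<lambda>q. u m (emb d (?b $ d) q) $ d - u m (emb d (?a $ d) q) $ d)"
      unfolding vol_box_def
      by (rule integral_cbox_partial[OF le cw])
        (use u(2) in \<open>auto simp: partials_def intro: has_field_derivative_at_within\<close>)
    also have "\<dots> = integral ?Q (\<lambda>q. u m (emb d (?b $ d) q) $ d) - integral ?Q (\<lambda>q. u m (emb d (?a $ d) q) $ d)"
      by (rule integral_diff[OF int int])
    also have "\<dots> = local_flux u (m, d, next_index k d) - local_flux u (m, d, k)"
      by (simp add: local_flux_def next_index_def)
    finally show ?thesis .
  qed
  have "integral (vol_box N k) (\<lambda>\<xi>. \<Sum>d\<in>UNIV. w d \<xi>) = (\<Sum>d\<in>UNIV. integral (vol_box N k) (w d))"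
    by (rule integral_sum) (auto simp: vol_box_def intro: integrable_continuous cw)
  then show ?thesis by (simp add: one)
qed

lemma finite_small_faces: "finite small_faces"
proof -
  have "{k :: nat^3. \<forall>i. k $ i \<le> N} \<subseteq> vol_index (Suc N)" by (auto simp: vol_index_def less_Suc_eq_le)
  then have fin: "finite {k :: nat^3. \<forall>i. k $ i \<le> N}" by (rule finite_subset[OF _ finite_vol_index])
  have "Collect is_local_face \<subseteq> {..<n} \<times> UNIV \<times> {k. \<forall>i. k $ i \<le> N}"
  proof
    fix f assume "f \<in> Collect is_local_face"
    moreover obtain m d k where "f = (m, d, k)" by (metis prod.exhaust)
    ultimately show "f \<in> {..<n} \<times> UNIV \<times> {k. \<forall>i. k $ i \<le> N}"
      using is_local_faceD(1,4)[of m d k] by simp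
  qed
  moreover have "finite ({..<n} \<times> (UNIV :: 3 set) \<times> {k :: nat^3. \<forall>i. k $ i \<le> N})" using fin by simp
  ultimately have "finite (Collect is_local_face)" by (rule finite_subset)
  then show ?thesis unfolding small_faces_def by (rule finite_imageI)
qed

text \<open>The outward normal of a small volume points in direction \<open>d\<close> on the upper
  face and against it on the lower one, whence the minus sign.\<close>

definition vol_face_sign :: "nat \<Rightarrow> nat^3 \<Rightarrow> (real^3) set \<Rightarrow> 3 \<Rightarrow> real" where
  "vol_face_sign m k s d =
    (if s = face_set (m, d, next_index k d) then face_sign (m, d, next_index k d) else 0)
    - (if s = face_set (m, d, k) then face_sign (m, d, k) else 0)"

text \<open>The arguments are sets, so the label of \<open>v\<close> is recovered by summing over
  all labels; by \<open>vol_eqD\<close> exactly one contributes for a small volume.\<close>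

definition incidence :: "(real^3) set \<Rightarrow> (real^3) set \<Rightarrow> real" where
  "incidence v s = (\<Sum>(m, k)\<in>{..<n} \<times> vol_index N. if vol m k = v then \<Sum>d\<in>UNIV. vol_face_sign m k s d else 0)"

lemma incidence_vol:
  assumes "m < n" "k \<in> vol_index N"
  shows "incidence (vol m k) s = (\<Sum>d\<in>UNIV. vol_face_sign m k s d)"
proof -
  have "incidence (vol m k) s =
      (\<Sum>p\<in>{..<n} \<times> vol_index N. if p = (m, k) then \<Sum>d\<in>UNIV. vol_face_sign m k s d else 0)"
    unfolding incidence_def
  proof (rule sum.cong[OF refl])
    fix p assume p: "p \<in> {..<n} \<times> vol_index N"
    obtain m' k' where pm: "p = (m', k')" by (metis prod.exhaust)
    have "vol m' k' = vol m k \<longleftrightarrow> p = (m, k)" using vol_eqD[of m' m k' k] p assms pm by auto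
    then show "(case p of (m', k') \<Rightarrow> if vol m' k' = vol m k then \<Sum>d\<in>UNIV. vol_face_sign m' k' s d else 0) =
        (if p = (m, k) then \<Sum>d\<in>UNIV. vol_face_sign m k s d else 0)" by (auto simp: pm)
  qed
  then show ?thesis using assms finite_vol_index by simp
qed

text \<open>The six faces of a small volume are different sets, so at most one of the six signs
  survives for a given \<open>s\<close>.\<close>

lemma incidence_values:
  assumes m: "m < n" and k: "k \<in> vol_index N"
  shows "incidence (vol m k) s \<in> {-1, 0, 1}"
proof -
  note lf = vol_local_faces[OF m k]
  have nk: "next_index k d \<noteq> k" for d by (auto simp: next_index_def vec_eq_iff)
  have single: "(\<Sum>d\<in>UNIV. vol_face_sign m k s d) = vol_face_sign m k s e"
    if "\<And>d. d \<noteq> e \<Longrightarrow> vol_face_sign m k s d = 0" for e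
  proof -
    have "(\<Sum>d\<in>UNIV. vol_face_sign m k s d) = (\<Sum>d\<in>UNIV. if d = e then vol_face_sign m k s e else 0)"
      by (rule sum.cong[OF refl]) (use that in auto)
    then show ?thesis by simp
  qed
  consider (upper) e where "s = face_set (m, e, next_index k e)" | (lower) e where "s = face_set (m, e, k)"
    | (none) "\<And>d. s \<noteq> face_set (m, d, next_index k d)" "\<And>d. s \<noteq> face_set (m, d, k)" by blast
  then show ?thesis
  proof cases
    case upper
    have u: "s = face_set (m, d, next_index k d) \<longleftrightarrow> d = e" for d
      using face_set_eqD[OF lf(2)[of e] lf(2)[of d]] upper by auto
    have l: "s \<noteq> face_set (m, d, k)" for d
      using face_set_eqD[OF lf(2)[of e] lf(1)[of d]] upper nk by auto
    have "vol_face_sign m k s d = (if d = e then face_sign (m, e, next_index k e) else 0)" for d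
      unfolding vol_face_sign_def u using l by auto
    then show ?thesis using face_sign(1)[OF lf(2)[of e]] single[of e] by (auto simp: incidence_vol[OF m k])
  next
    case lower
    have u: "s = face_set (m, d, k) \<longleftrightarrow> d = e" for d
      using face_set_eqD[OF lf(1)[of e] lf(1)[of d]] lower by auto
    have l: "s \<noteq> face_set (m, d, next_index k d)" for d
      using face_set_eqD[OF lf(1)[of e] lf(2)[of d]] lower nk[of d] by metis
    have "vol_face_sign m k s d = (if d = e then - face_sign (m, e, k) else 0)" for d
      unfolding vol_face_sign_def u using l by auto
    then show ?thesis using face_sign(1)[OF lf(1)[of e]] single[of e] by (auto simp: incidence_vol[OF m k])
  next
    case none
    then have "vol_face_sign m k s d = 0" for d by (simp add: vol_face_sign_def)
    then show ?thesis by (simp add: incidence_vol[OF m k])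
  qed
qed

text \<open>The orientation sign enters twice, in the matrix entry and in the degree of freedom, and
  cancels. What remains is the net outflow through the six faces.\<close>

lemma incidence_flux:
  assumes m: "m < n" and k: "k \<in> vol_index N"
    and u: "matched u" "\<And>m. m < n \<Longrightarrow> u m \<in> D_ref N"
    and q: "\<And>m \<xi>. m < n \<Longrightarrow> \<xi> \<in> Ki \<Longrightarrow> q (\<Phi> m \<xi>) = piola u m \<xi>"
  shows "mat_vec small_faces incidence (N2 q) (vol m k) =
    (\<Sum>d\<in>UNIV. local_flux u (m, d, next_index k d) - local_flux u (m, d, k))"
proof -
  have pick: "(\<Sum>s\<in>small_faces. (if s = face_set f then face_sign f else 0) * N2 q s) = local_flux u f"
    if f: "is_local_face f" for f
  proof -
    have "face_set f \<in> small_faces" unfolding small_faces_def using f by blast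
    then have "(\<Sum>s\<in>small_faces. (if s = face_set f then face_sign f else 0) * N2 q s) = face_sign f * N2 q (face_set f)"
      using finite_small_faces by (simp add: if_distrib[of "\<lambda>x. x * _"] cong: if_cong)
    also have "\<dots> = (face_sign f * face_sign f) * local_flux u f"
    proof -
      have "N2 q (face_set f) = face_sign f * local_flux u f"
        by (rule N2_local_face[OF f u(1)]) (fact u(2) q)+
      then show ?thesis by (simp only: mult.assoc)
    qed
    also have "face_sign f * face_sign f = 1"
    proof -
      obtain m d k where fm: "f = (m, d, k)" by (metis prod.exhaust)
      show ?thesis using face_sign(1)[OF f[unfolded fm]] unfolding fm by auto
    qed
    finally show ?thesis by simp
  qed
  note lf = vol_local_faces[OF m k]
  have "mat_vec small_faces incidence (N2 q) (vol m k) =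
      (\<Sum>s\<in>small_faces. \<Sum>d\<in>UNIV. vol_face_sign m k s d * N2 q s)"
    unfolding mat_vec_def incidence_vol[OF m k] sum_distrib_right ..
  also have "\<dots> = (\<Sum>d\<in>UNIV. \<Sum>s\<in>small_faces. vol_face_sign m k s d * N2 q s)"
    by (rule sum.swap)
  also have "\<dots> = (\<Sum>d\<in>UNIV. local_flux u (m, d, next_index k d) - local_flux u (m, d, k))"
    unfolding vol_face_sign_def left_diff_distrib sum_subtractf pick[OF lf(1)] pick[OF lf(2)] ..
  finally show ?thesis .
qed

text \<open>On each element the divergence of the reference field and the reference polynomial of
  the expansion have equal integrals over all grid boxes, by the divergence theorem on each box.
  Both are in S(K), so they coincide, and the elementwise identity gives the weak
  divergence.\<close>

lemma incidence_exists: "\<exists>E. is_incidence E"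
proof -
  have "has_divergence \<Omega> q (\<lambda>x. \<Sum>v\<in>small_volumes. Psi3 v x * mat_vec small_faces incidence (N2 q) v)"
    if qD: "q \<in> D_space" for q
  proof -
    obtain u where u: "\<And>m. m < n \<Longrightarrow> u m \<in> D_ref N"
      "\<And>m \<xi>. m < n \<Longrightarrow> \<xi> \<in> Ki \<Longrightarrow> q (\<Phi> m \<xi>) = piola u m \<xi>" "matched u"
      by (rule D_spaceE[OF qD]) blast
    have "\<exists>w. (\<forall>d. w d \<in> S_ref N) \<and> partials (u m) w" if "m < n" for m
      using D_ref_partials[OF u(1)[OF that]] .
    then obtain w where w: "\<And>m d. m < n \<Longrightarrow> w m d \<in> S_ref N" "\<And>m. m < n \<Longrightarrow> partials (u m) (w m)" by metis
    let ?c = "mat_vec small_faces incidence (N2 q)"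
    let ?f = "\<lambda>x. \<Sum>v\<in>small_volumes. Psi3 v x * ?c v"
    obtain g where g: "S_pieces ?f g"
      "\<And>m k. m < n \<Longrightarrow> k \<in> vol_index N \<Longrightarrow> integral (vol_box N k) (g m) = ?c (vol m k)"
      using Psi3_combination[of ?c] by blast
    have gw: "g m = (\<lambda>\<xi>. \<Sum>d\<in>UNIV. w m d \<xi>)" if m: "m < n" for m
    proof (rule S_ref_eqI[OF N_pos S_piecesD(1)[OF g(1) m]])
      show "(\<lambda>\<xi>. \<Sum>d\<in>UNIV. w m d \<xi>) \<in> S_ref N"
        using w(1)[OF m] unfolding S_ref_def by (rule tensor_poly_sum)
      fix k assume k: "k \<in> vol_index N"
      have "integral (vol_box N k) (g m) = (\<Sum>d\<in>UNIV. local_flux u (m, d, next_index k d) - local_flux u (m, d, k))"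
        unfolding g(2)[OF m k] by (rule incidence_flux[OF m k u(3) u(1) u(2)])
      also have "\<dots> = integral (vol_box N k) (\<lambda>\<xi>. \<Sum>d\<in>UNIV. w m d \<xi>)"
        by (rule vol_divergence[where u = u, OF m k u(1)[OF m] w(2)[OF m] w(1)[OF m], symmetric])
      finally show "integral (vol_box N k) (g m) = integral (vol_box N k) (\<lambda>\<xi>. \<Sum>d\<in>UNIV. w m d \<xi>)" .
    qed
    show ?thesis
    proof (rule piecewise_has_divergence[OF u(1) u(3) w(2) w(1)])
      fix m \<xi> assume m: "m < n" and \<xi>: "\<xi> \<in> Ki"
      show "q (\<Phi> m \<xi>) = (1 / det (jac m \<xi>)) *\<^sub>R (jac m \<xi> *v u m \<xi>)"
        using u(2)[OF m \<xi>] unfolding piola_def .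
      show "?f (\<Phi> m \<xi>) = (\<Sum>d\<in>UNIV. w m d \<xi>) / det (jac m \<xi>)"
        using S_piecesD(2)[OF g(1) m \<xi>] unfolding gw[OF m] .
    qed
  qed
  moreover have "incidence v s \<in> {-1, 0, 1}" if v: "v \<in> small_volumes" for v s
  proof -
    obtain m k where "m < n" "k \<in> vol_index N" "v = vol m k" using v unfolding small_volumes_eq by auto
    then show ?thesis using incidence_values by blast
  qed
  ultimately have "is_incidence incidence" unfolding is_incidence_def by blast
  then show ?thesis by blast
qed

lemma is_incidence_E32: "is_incidence E32"
  unfolding E32_def using incidence_exists by (rule someI_ex)

text \<open>\<open>p\<close> and the expansion formed with \<open>E32\<close> are both weak
  divergences of \<open>u\<close>. These are determined almost everywhere, which is enough to
  compare integrals over small volumes.\<close>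

lemma discrete_divergence_eq:
  assumes p: "p \<in> S_space" and u: "u \<in> D_space" "has_divergence \<Omega> u p" and v: "v \<in> small_volumes"
  shows "mat_vec small_faces E32 (N2 u) v = N3 p v"
proof -
  let ?c = "mat_vec small_faces E32 (N2 u)"
  let ?f = "\<lambda>x. \<Sum>v\<in>small_volumes. Psi3 v x * ?c v"
  have d: "has_divergence \<Omega> u ?f" using is_incidence_E32 u(1) unfolding is_incidence_def by blast
  obtain g where g: "S_pieces ?f g"
    "\<And>m k. m < n \<Longrightarrow> k \<in> vol_index N \<Longrightarrow> integral (vol_box N k) (g m) = ?c (vol m k)"
    using Psi3_combination[of ?c] by blast
  obtain h where h: "S_pieces p h" by (rule S_spaceE[OF p])
  obtain m k where mk: "m < n" "k \<in> vol_index N" "v = vol m k" using v unfolding small_volumes_eq by auto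
  have "N3 p v = N3 ?f v" by (rule divergence_pieces_unique[OF u(2) d h g(1) v])
  also have "\<dots> = ?c v" unfolding mk(3) N3_vol[OF g(1) mk(1,2)] by (rule g(2)[OF mk(1,2)])
  finally show ?thesis by simp
qed

theorem discrete_divergence_surjective:
  assumes "p \<in> S_tilde"
  shows "\<exists>u\<in>D_space. has_divergence \<Omega> u p \<and> (\<forall>v\<in>small_volumes.
    mat_vec small_volumes M3 (mat_vec small_faces E32 (N2 u)) v = N0_tilde p v)"
proof -
  have p: "p \<in> S_space" using assms by (simp add: S_tilde_def)
  obtain u where u: "u \<in> D_space" "has_divergence \<Omega> u p" using divergence_surjective[OF p] by blast
  \<comment> \<open>The mass matrix is applied to both sides of the equation between primal degrees
    of freedom.\<close>
  have "mat_vec small_volumes M3 (mat_vec small_faces E32 (N2 u)) v = N0_tilde p v" for v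
    unfolding N0_tilde_def mat_vec_def[of small_volumes]
    by (rule sum.cong[OF refl]) (simp add: discrete_divergence_eq[OF p u])
  then show ?thesis using u by blast
qed

end

theorem mainTheorem4:
  fixes N n :: nat and \<Phi> :: "nat \<Rightarrow> real^3 \<Rightarrow> real^3" and \<Omega> :: "(real^3) set"
    and \<nu> :: "(real^3) set \<Rightarrow> real^3 \<Rightarrow> real^3" and p :: "real^3 \<Rightarrow> real"
  assumes mesh: "oriented_gll_mesh N n \<Phi> \<Omega> \<nu>"
    and p: "p \<in> gll_mesh.S_tilde N n \<Phi> \<Omega>"
  shows "\<exists>u \<in> gll_mesh.D_space N n \<Phi> \<Omega>.
           has_divergence \<Omega> u p \<and>
           (\<forall>v \<in> gll_mesh.small_volumes N n \<Phi>.
              mat_vec (gll_mesh.small_volumes N n \<Phi>) (gll_mesh.M3 N n \<Phi> \<Omega>)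
                (mat_vec (gll_mesh.small_faces N n \<Phi>) (oriented_gll_mesh.E32 N n \<Phi> \<Omega> \<nu>)
                  (oriented_gll_mesh.N2 N n \<Phi> \<nu> u)) v
              = gll_mesh.N0_tilde N n \<Phi> \<Omega> p v)"
  using oriented_gll_mesh.discrete_divergence_surjective[OF mesh p] .

end
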